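(* Let $\Omega\subset\mathbb{R}^n$ be a bounded domain and let $\mu$, $\mathcal{A}$, $a^i$, $b^i$, $a$ satisfy the standing assumptions listed in the context (where only $\lambda^{-1}\in L^1_{\rm loc}(\mathbb{R}^n)$ is required). Assume moreover that $\mu(\{1\})>0$. Let $$f(x):=b^{ij}(x)\big(a^i(x)a^j(x)+b^i(x)b^j(x)\big)+|a(x)|$$ and suppose that $f$ is compactly bounded on $H^0(\mathcal{A},\Omega)$. Then there exist $\sigma_0\in\mathbb{R}$ and a countable isolated set of real numbers $\Sigma\subset(-\infty,\sigma_0)$ (eigenvalues of $\mathcal{L}$) such that: (1) for any $\sigma\notin\Sigma$, $\mathcal{L}_\sigma(f)$ is a bijective mapping from $H^0(\mathcal{A},\Omega)$ to $(H^0(\mathcal{A},\Omega))'$; in particular, for every $T\in(H^0(\mathcal{A},\Omega))'$ the problem $\mathcal{L}_\sigma(f)u=T$ in $(H^0(\mathcal{A},\Omega))'$ admits a unique solution $u\in H^0(\mathcal{A},\Omega)$; (2) if instead $\sigma\in\Sigma$, then the kernels of $\mathcal{L}_\sigma(f)$ and $\mathcal{L}^*_\sigma(f)$ coincide and are of positive, finite dimension; and, for every $T\in(H^0(\mathcal{A},\Omega))'$, the problem $\mathcal{L}_\sigma(f)u=T$ in $(H^0(\mathcal{A},\Omega))'$ either admits no solutions or admits infinitely many solutions $u\in H^0(\mathcal{A},\Omega)$. In particular, given $\sigma\in\mathbb{R}$ and $T\in(H^0(\mathcal{A},\Omega))'$, the problem $\mathcal{L}_\sigma(f)u=T$ in $(H^0(\mathcal{A},\Omega))'$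 admits a solution $u\in H^0(\mathcal{A},\Omega)$ if and only if $\langle T,u^*\rangle=0$ for every $u^*\in H^0(\mathcal{A},\Omega)$ which solves $\mathcal{L}^*_\sigma(f)u^*=0$ in $(H^0(\mathcal{A},\Omega))'$.
   Context: Summation over repeated indices is used. $\mathcal{D}(\Omega)=C_c^\infty(\Omega)$; functions in $\mathcal{D}(\Omega)$ are extended by $0$ to $\mathbb{R}^n$. $V'$ is the dual of $V$ and $\langle T,x\rangle$ is the application of $T\in V'$ to $x\in V$. Fractional gradient: for $s\in(0,1)$ and $\phi\in\mathcal{D}(\mathbb{R}^n)$, $D^s\phi(x):=c_s\lim_{\epsilon\searrow0}\int_{\mathbb{R}^n\setminus B_\epsilon}\frac{z\,\phi(x+z)}{|z|^{n+s+1}}\,dz$ with $c_s=\frac{2^s\pi^{-n/2}\Gamma(\frac{n+s+1}{2})}{\Gamma(\frac{1-s}{2})}$; $D^1\phi:=D\phi$ is the classical gradient. $D^s_i$ is the $i$-th component. Standing assumptions. $\mu$ is a $\sigma$-finite and nonnegative measure on $[0,1]$ whose support is bounded away from $0$. $\mathcal{A}(s,x)=[a^{ij}(s,x)]$ (real $n\times n$ matrix), $a^i(s,x)$, $b^i(s,x)$ are measurable on $[0,1]\times\mathbb{R}^n$, and $a$ is a measurable function on $\Omega$. $\mathcal{A}(s,x)$ is positive definite for every $s\in(0,1]$ (not necessarily symmetric), with symmetric part $\mathcal{A}_S=[a_S^{ij}]$ and inverse $\mathcal{B}(s,x)=[b^{ij}(s,x)]$. There are $\lambda,\Lambda:\mathbb{R}^n\to[0,+\infty)$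 with $\lambda(x)|\xi|^2\le\xi^T\mathcal{A}(s,x)\xi\le\Lambda(x)|\xi|^2$ for all $x,\xi\in\mathbb{R}^n$, $s\in(0,1]$, and there are $R,C>0$ and $p<n$ with $\Lambda\in L^1(B_R)$, $\Lambda(x)\le C|x|^p$ for $x\in\mathbb{R}^n\setminus B_R$, and $\lambda^{-1}\in L^{1}_{\rm loc}(\mathbb{R}^n)$. There is $\mathcal{K}_{\mathcal{A}}>0$ with $|\xi^T\mathcal{A}(s,x)\psi|^2\le \mathcal{K}_{\mathcal{A}}(\xi^T\mathcal{A}(s,x)\xi)(\psi^T\mathcal{A}(s,x)\psi)$ for all $x,\xi,\psi\in\mathbb{R}^n$, $s\in(0,1]$. There are functions $b^{ij}(x),a^i(x),b^i(x)$ with $|b^{ij}(s,x)|\le b^{ij}(x)$, $|a^i(s,x)|\le a^i(x)$, $|b^i(s,x)|\le b^i(x)$ for all $i,j$, $s\in(0,1]$, $x\in\mathbb{R}^n$; these bounding functions are the ones in the definition of $f$. $H^0(\mathcal{A},\Omega)$ is the Hilbert space completion of $\mathcal{D}(\Omega)$ for the scalar product $\langle u,v\rangle=\int_{\mathbb{R}^n}\int_{(0,1]}a_S^{ij}(s,x)D^s_iu(x)D^s_jv(x)\,d\mu(s)\,dx$; $D^su$ for $u$ in the completion is understood as the corresponding limit. A nonnegative measurable $f$ on $\Omega$ is compactly bounded on $H^0(\mathcal{A},\Omega)$ if for every $\epsilon>0$ there is $K_\epsilon\ge0$ with $\int_\Omega f\phi^2\,dx\le\epsilon\|\phi\|^2_{H^0(\mathcal{A},\Omega)}+K_\epsilon\|\phi\|^2_{L^1(\Omega)}$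 for all $\phi\in\mathcal{D}(\Omega)$. On $H^0(\mathcal{A},\Omega)\times H^0(\mathcal{A},\Omega)$ define $(\mathcal{L}u,v):=\int_{\mathbb{R}^n}\int_{(0,1]}\big(a^{ij}(s,x)D^s_ju\,D^s_iv+a^i(s,x)u\,D^s_iv+b^i(s,x)v\,D^s_iu\big)d\mu(s)\,dx+\int_\Omega a(x)uv\,dx$, $(\mathcal{L}^*u,v):=\int_{\mathbb{R}^n}\int_{(0,1]}\big(a^{ji}(s,x)D^s_ju\,D^s_iv+b^i(s,x)u\,D^s_iv+a^i(s,x)v\,D^s_iu\big)d\mu(s)\,dx+\int_\Omega a(x)uv\,dx$ (the formal dual of $\mathcal{L}$), $(\mathcal{I}(f)u,v):=\int_\Omega fuv\,dx$, $\mathcal{L}_\sigma(f):=\mathcal{L}+\sigma\mathcal{I}(f)$ and $\mathcal{L}^*_\sigma(f):=\mathcal{L}^*+\sigma\mathcal{I}(f)$, regarded as operators from $H^0(\mathcal{A},\Omega)$ to its dual. Eigenvalues of $\mathcal{L}$ are real numbers $\sigma$ for which $\mathcal{L}_\sigma(f)$ has nontrivial kernel. A set is isolated if each of its points is an isolated point of it; countable includes finite or empty.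
   Formalization: In (2), "the kernels coincide and are of positive, finite dimension" is proved as "the kernels have the same positive, finite dimension"; equality as sets fails, e.g. for -u''+bu' on (0,1) with constant b≠0, where the kernels are spanned by exp(±bx/2)sin(kπx). *)

theory Defs
  imports "HOL-Analysis.Analysis"
begin

section \<open>Test functions and the fractional gradient\<close>

definition partial_deriv :: "'n::finite \<Rightarrow> (real^'n \<Rightarrow> real) \<Rightarrow> real^'n \<Rightarrow> real" where
  "partial_deriv i \<phi> x = frechet_derivative \<phi> (at x) (axis i 1)"

primrec C_k :: "nat \<Rightarrow> (real^'n::finite \<Rightarrow> real) \<Rightarrow> bool" where
  "C_k 0 \<phi> \<longleftrightarrow> continuous_on UNIV \<phi>"
| "C_k (Suc k) \<phi> \<longleftrightarrow> (\<forall>x. \<phi> differentiable (at x)) \<and> (\<forall>i. C_k k (partial_deriv i \<phi>))"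

definition test_functions :: "(real^'n::finite) set \<Rightarrow> (real^'n \<Rightarrow> real) set" where
  "test_functions \<Omega> =
     {\<phi>. (\<forall>k. C_k k \<phi>) \<and> compact (closure {x. \<phi> x \<noteq> 0}) \<and> closure {x. \<phi> x \<noteq> 0} \<subseteq> \<Omega>}"

definition frac_const :: "'n::finite itself \<Rightarrow> real \<Rightarrow> real" where
  "frac_const TYPE('n) s =
     2 powr s * pi powr (- real CARD('n) / 2) * Gamma ((real CARD('n) + s + 1) / 2)
       / Gamma ((1 - s) / 2)"

definition frac_grad :: "real \<Rightarrow> (real^'n::finite \<Rightarrow> real) \<Rightarrow> real^'n \<Rightarrow> real^'n" where
  "frac_grad s \<phi> x =
     (if s = 1 then (\<chi> i. partial_deriv i \<phi> x)
      else frac_const TYPE('n) s *\<^sub>R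
        Lim (at_right 0) (\<lambda>\<epsilon>. LINT z:{z. \<epsilon> \<le> norm z}|lebesgue.
          (\<phi> (x + z) / norm z powr (real CARD('n) + s + 1)) *\<^sub>R z))"


section \<open>The measure and the energy\<close>

definition measure_support :: "'a::topological_space measure \<Rightarrow> 'a set" where
  "measure_support \<mu> =
     {s \<in> space \<mu>. \<forall>U. open U \<and> s \<in> U \<longrightarrow> 0 < emeasure \<mu> (U \<inter> space \<mu>)}"

definition sym_part :: "real^'n^'n \<Rightarrow> real^'n^'n" where
  "sym_part M = (1/2) *\<^sub>R (M + transpose M)"

definition energy_density ::
  "(real \<Rightarrow> real^'n \<Rightarrow> real^'n^'n) \<Rightarrow> (real \<Rightarrow> real^'n \<Rightarrow> real^'n) \<Rightarrow> (real \<Rightarrow> real^'n \<Rightarrow> real^'n)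
     \<Rightarrow> real \<Rightarrow> real^'n::finite \<Rightarrow> real" where
  "energy_density A G H s x = (\<Sum>i\<in>UNIV. \<Sum>j\<in>UNIV. sym_part (A s x) $ i $ j * G s x $ i * H s x $ j)"

definition H0_inner ::
  "real measure \<Rightarrow> (real \<Rightarrow> real^'n \<Rightarrow> real^'n^'n) \<Rightarrow> (real^'n::finite \<Rightarrow> real) \<Rightarrow> (real^'n \<Rightarrow> real) \<Rightarrow> real"
  where
  "H0_inner \<mu> A \<phi> \<psi> =
     (LINT x|lebesgue. (LINT s:{0<..1}|\<mu>.
        energy_density A (\<lambda>s. frac_grad s \<phi>) (\<lambda>s. frac_grad s \<psi>) s x))"


section \<open>The space \<open>H\<^sup>0\<close>\<close>

text \<open>
  A completion is determined only up to isometry. It is represented by a Hilbert space (a type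
  \<open>'h\<close>) with a linear, inner-product preserving map \<open>\<iota>\<close> from the test functions onto a dense
  subspace. The first conjunct says that the integrals defining the inner product converge;
  without it, divergent integrals would silently count as \<open>0\<close>.
\<close>

definition is_H0_completion ::
  "(real^'n::finite) set \<Rightarrow> real measure \<Rightarrow> (real \<Rightarrow> real^'n \<Rightarrow> real^'n^'n)
     \<Rightarrow> ((real^'n \<Rightarrow> real) \<Rightarrow> 'h::{real_inner, complete_space}) \<Rightarrow> bool" where
  "is_H0_completion \<Omega> \<mu> A \<iota> \<longleftrightarrow>
     (\<forall>\<phi>\<in>test_functions \<Omega>. \<forall>\<psi>\<in>test_functions \<Omega>.
        set_integrable (\<mu> \<Otimes>\<^sub>M lebesgue) ({0<..1} \<times> UNIV)
          (\<lambda>(s, x). energy_density A (\<lambda>s. frac_grad s \<phi>) (\<lambda>s. frac_grad s \<psi>) s x)) \<and>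
     (\<forall>\<phi>\<in>test_functions \<Omega>. \<forall>\<psi>\<in>test_functions \<Omega>. \<forall>c d.
        \<iota> (\<lambda>x. c * \<phi> x + d * \<psi> x) = c *\<^sub>R \<iota> \<phi> + d *\<^sub>R \<iota> \<psi>) \<and>
     (\<forall>\<phi>\<in>test_functions \<Omega>. \<forall>\<psi>\<in>test_functions \<Omega>. inner (\<iota> \<phi>) (\<iota> \<psi>) = H0_inner \<mu> A \<phi> \<psi>) \<and>
     closure (\<iota> ` test_functions \<Omega>) = UNIV"

text \<open>
  The function \<open>w\<close> and the family \<open>G s = D\<^sup>s u\<close> attached to an element \<open>u\<close> of the completion are the
  limits, in \<open>L\<^sup>1(\<Omega>)\<close> and in the weighted \<open>L\<^sup>2\<close> space of the energy respectively, of a sequence of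
  test functions converging to \<open>u\<close> and of its fractional gradients. As \<open>\<lambda>\<^sup>-\<^sup>1\<close> is locally
  integrable and \<open>\<mu>\<close> charges \<open>1\<close>, convergence in \<open>H\<^sup>0\<close> forces \<open>L\<^sup>1\<close> convergence on the
  bounded set \<open>\<Omega>\<close>, so both limits exist and are unique almost everywhere.
\<close>

definition represents ::
  "(real^'n::finite) set \<Rightarrow> real measure \<Rightarrow> (real \<Rightarrow> real^'n \<Rightarrow> real^'n^'n)
     \<Rightarrow> ((real^'n \<Rightarrow> real) \<Rightarrow> 'h::{real_inner, complete_space})
     \<Rightarrow> 'h \<Rightarrow> (real^'n \<Rightarrow> real) \<Rightarrow> (real \<Rightarrow> real^'n \<Rightarrow> real^'n) \<Rightarrow> bool" where
  "represents \<Omega> \<mu> A \<iota> u w G \<longleftrightarrow>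
     integrable lebesgue w \<and> (\<forall>x. x \<notin> \<Omega> \<longrightarrow> w x = 0) \<and>
     (\<lambda>(s, x). G s x) \<in> borel_measurable (\<mu> \<Otimes>\<^sub>M lebesgue) \<and>
     (\<exists>\<phi>. (\<forall>k. \<phi> k \<in> test_functions \<Omega>) \<and>
        (\<lambda>k. \<iota> (\<phi> k)) \<longlonglongrightarrow> u \<and>
        (\<lambda>k. LINT x|lebesgue. \<bar>\<phi> k x - w x\<bar>) \<longlonglongrightarrow> 0 \<and>
        (\<lambda>k. \<integral>\<^sup>+(s, x)\<in>{0<..1} \<times> UNIV.
            ennreal (energy_density A (\<lambda>s x. frac_grad s (\<phi> k) x - G s x)
                                      (\<lambda>s x. frac_grad s (\<phi> k) x - G s x) s x)
          \<partial>(\<mu> \<Otimes>\<^sub>M lebesgue)) \<longlonglongrightarrow> 0)"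

definition H0_fun ::
  "(real^'n::finite) set \<Rightarrow> real measure \<Rightarrow> (real \<Rightarrow> real^'n \<Rightarrow> real^'n^'n)
     \<Rightarrow> ((real^'n \<Rightarrow> real) \<Rightarrow> 'h::{real_inner, complete_space}) \<Rightarrow> 'h \<Rightarrow> real^'n \<Rightarrow> real" where
  "H0_fun \<Omega> \<mu> A \<iota> u = (SOME w. \<exists>G. represents \<Omega> \<mu> A \<iota> u w G)"

definition H0_grad ::
  "(real^'n::finite) set \<Rightarrow> real measure \<Rightarrow> (real \<Rightarrow> real^'n \<Rightarrow> real^'n^'n)
     \<Rightarrow> ((real^'n \<Rightarrow> real) \<Rightarrow> 'h::{real_inner, complete_space})
     \<Rightarrow> 'h \<Rightarrow> real \<Rightarrow> real^'n \<Rightarrow> real^'n" where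
  "H0_grad \<Omega> \<mu> A \<iota> u = (SOME G. \<exists>w. represents \<Omega> \<mu> A \<iota> u w G)"

definition compactly_bounded ::
  "(real^'n::finite) set \<Rightarrow> real measure \<Rightarrow> (real \<Rightarrow> real^'n \<Rightarrow> real^'n^'n) \<Rightarrow> (real^'n \<Rightarrow> real) \<Rightarrow> bool"
  where
  "compactly_bounded \<Omega> \<mu> A f \<longleftrightarrow>
     f \<in> borel_measurable (lebesgue_on \<Omega>) \<and> (\<forall>x\<in>\<Omega>. 0 \<le> f x) \<and>
     (\<forall>\<epsilon>>0. \<exists>K\<ge>0. \<forall>\<phi>\<in>test_functions \<Omega>.
        (\<integral>\<^sup>+x\<in>\<Omega>. ennreal (f x * (\<phi> x)\<^sup>2) \<partial>lebesgue)
          \<le> ennreal (\<epsilon> * H0_inner \<mu> A \<phi> \<phi> + K * (LINT x:\<Omega>|lebesgue. \<bar>\<phi> x\<bar>)\<^sup>2))"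


section \<open>The operators\<close>

definition L_form ::
  "(real^'n::finite) set \<Rightarrow> real measure \<Rightarrow> (real \<Rightarrow> real^'n \<Rightarrow> real^'n^'n)
     \<Rightarrow> (real \<Rightarrow> real^'n \<Rightarrow> real^'n) \<Rightarrow> (real \<Rightarrow> real^'n \<Rightarrow> real^'n) \<Rightarrow> (real^'n \<Rightarrow> real)
     \<Rightarrow> ((real^'n \<Rightarrow> real) \<Rightarrow> 'h::{real_inner, complete_space}) \<Rightarrow> 'h \<Rightarrow> 'h \<Rightarrow> real" where
  "L_form \<Omega> \<mu> A a1 b1 a \<iota> u v =
     (let fu = H0_fun \<Omega> \<mu> A \<iota> u; fv = H0_fun \<Omega> \<mu> A \<iota> v;
          Du = H0_grad \<Omega> \<mu> A \<iota> u; Dv = H0_grad \<Omega> \<mu> A \<iota> v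
      in (LINT x|lebesgue. (LINT s:{0<..1}|\<mu>.
           ((\<Sum>i\<in>UNIV. \<Sum>j\<in>UNIV. A s x $ i $ j * Du s x $ j * Dv s x $ i)
            + (\<Sum>i\<in>UNIV. a1 s x $ i * fu x * Dv s x $ i)
            + (\<Sum>i\<in>UNIV. b1 s x $ i * fv x * Du s x $ i))))
         + (LINT x:\<Omega>|lebesgue. a x * fu x * fv x))"

definition L_adj_form ::
  "(real^'n::finite) set \<Rightarrow> real measure \<Rightarrow> (real \<Rightarrow> real^'n \<Rightarrow> real^'n^'n)
     \<Rightarrow> (real \<Rightarrow> real^'n \<Rightarrow> real^'n) \<Rightarrow> (real \<Rightarrow> real^'n \<Rightarrow> real^'n) \<Rightarrow> (real^'n \<Rightarrow> real)
     \<Rightarrow> ((real^'n \<Rightarrow> real) \<Rightarrow> 'h::{real_inner, complete_space}) \<Rightarrow> 'h \<Rightarrow> 'h \<Rightarrow> real" where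
  "L_adj_form \<Omega> \<mu> A a1 b1 a \<iota> u v =
     (let fu = H0_fun \<Omega> \<mu> A \<iota> u; fv = H0_fun \<Omega> \<mu> A \<iota> v;
          Du = H0_grad \<Omega> \<mu> A \<iota> u; Dv = H0_grad \<Omega> \<mu> A \<iota> v
      in (LINT x|lebesgue. (LINT s:{0<..1}|\<mu>.
           ((\<Sum>i\<in>UNIV. \<Sum>j\<in>UNIV. A s x $ j $ i * Du s x $ j * Dv s x $ i)
            + (\<Sum>i\<in>UNIV. b1 s x $ i * fu x * Dv s x $ i)
            + (\<Sum>i\<in>UNIV. a1 s x $ i * fv x * Du s x $ i))))
         + (LINT x:\<Omega>|lebesgue. a x * fu x * fv x))"

definition I_form ::
  "(real^'n::finite) set \<Rightarrow> real measure \<Rightarrow> (real \<Rightarrow> real^'n \<Rightarrow> real^'n^'n) \<Rightarrow> (real^'n \<Rightarrow> real)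
     \<Rightarrow> ((real^'n \<Rightarrow> real) \<Rightarrow> 'h::{real_inner, complete_space}) \<Rightarrow> 'h \<Rightarrow> 'h \<Rightarrow> real" where
  "I_form \<Omega> \<mu> A f \<iota> u v = (LINT x:\<Omega>|lebesgue. f x * H0_fun \<Omega> \<mu> A \<iota> u x * H0_fun \<Omega> \<mu> A \<iota> v x)"

definition L_op ::
  "(real^'n::finite) set \<Rightarrow> real measure \<Rightarrow> (real \<Rightarrow> real^'n \<Rightarrow> real^'n^'n)
     \<Rightarrow> (real \<Rightarrow> real^'n \<Rightarrow> real^'n) \<Rightarrow> (real \<Rightarrow> real^'n \<Rightarrow> real^'n) \<Rightarrow> (real^'n \<Rightarrow> real)
     \<Rightarrow> ((real^'n \<Rightarrow> real) \<Rightarrow> 'h::{real_inner, complete_space})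
     \<Rightarrow> (real^'n \<Rightarrow> real) \<Rightarrow> real \<Rightarrow> 'h \<Rightarrow> 'h \<Rightarrow> real" where
  "L_op \<Omega> \<mu> A a1 b1 a \<iota> f \<sigma> u = (\<lambda>v. L_form \<Omega> \<mu> A a1 b1 a \<iota> u v + \<sigma> * I_form \<Omega> \<mu> A f \<iota> u v)"

definition L_adj_op ::
  "(real^'n::finite) set \<Rightarrow> real measure \<Rightarrow> (real \<Rightarrow> real^'n \<Rightarrow> real^'n^'n)
     \<Rightarrow> (real \<Rightarrow> real^'n \<Rightarrow> real^'n) \<Rightarrow> (real \<Rightarrow> real^'n \<Rightarrow> real^'n) \<Rightarrow> (real^'n \<Rightarrow> real)
     \<Rightarrow> ((real^'n \<Rightarrow> real) \<Rightarrow> 'h::{real_inner, complete_space})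
     \<Rightarrow> (real^'n \<Rightarrow> real) \<Rightarrow> real \<Rightarrow> 'h \<Rightarrow> 'h \<Rightarrow> real" where
  "L_adj_op \<Omega> \<mu> A a1 b1 a \<iota> f \<sigma> u =
     (\<lambda>v. L_adj_form \<Omega> \<mu> A a1 b1 a \<iota> u v + \<sigma> * I_form \<Omega> \<mu> A f \<iota> u v)"

definition dual :: "('h::real_normed_vector \<Rightarrow> real) set" where
  "dual = {T. bounded_linear T}"

definition op_kernel :: "('h \<Rightarrow> 'h \<Rightarrow> real) \<Rightarrow> 'h set" where
  "op_kernel L = {u. L u = (\<lambda>v. 0)}"

text \<open>\<open>dim\<close> is \<open>0\<close> on infinite-dimensional spaces, hence the separate notion of finite dimension.\<close>

definition finite_dim :: "'h::real_vector set \<Rightarrow> bool" where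
  "finite_dim V \<longleftrightarrow> (\<exists>B. finite B \<and> span B = V)"

end

theory Submission
  imports Defs
begin

text \<open>
  Compact boundedness of \<open>f\<close> together with the sector condition makes \<open>L_form\<close> a bounded bilinear form
  with a Garding inequality whose error term is a multiple of \<open>I_form\<close>, and makes \<open>I_form\<close> bounded. A Rellich
  inequality for averages over small cubes, applied to the \<open>s = 1\<close> part of the energy, shows that for
  every \<open>\<epsilon>\<close> the form \<open>I_form\<close> is at most \<open>\<epsilon>\<close> times the squared norm up to finitely many bounded linear
  functionals, i.e. that it is compact. Hence the operator is coercive for large \<open>\<sigma>\<close>, and for every \<open>\<sigma>\<close> it is a
  finite-rank perturbation of a coercive operator, for which the Fredholm alternative is linear
  algebra. Eigenvalues bounded below are finite in number by compactness and Bessel's inequality.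
\<close>


section \<open>Forms on a Hilbert space\<close>

text \<open>The obstacle is degenerate ellipticity. With the reciprocal of \<open>lam\<close> only
  locally integrable, the Cauchy-Schwarz inequality turns energy into control of the gradient in L1
  and nothing better. Compactness is therefore obtained in L1 and carried over to the weighted
  square integral of \<open>f\<close> by compact boundedness, whose remainder is exactly an L1 norm.
  It is phrased throughout as an inequality between quadratic forms with finitely many functionals;
  weak convergence never appears, and this shape is what makes a finite-rank correction coercive. As
  the form is not symmetric, eigenvectors have to be orthonormalised, after which the solution
  operator is triangular rather than diagonal. Elements of the abstract completion have functions
  and gradients determined only almost everywhere, so the forms are studied as integrals over the
  product of \<open>\<mu>\<close> and Lebesgue measure. A quantity that does not depend on
  \<open>s\<close> can be integrable there only if \<open>\<mu>\<close> has finite mass on the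
  interval; this is why a lower bound for fractional gradients, uniform in \<open>s\<close>, is
  proved for one explicit test function.\<close>

lemma riesz_representation:
  fixes T :: "'h::{real_inner,complete_space} \<Rightarrow> real"
  assumes "bounded_linear T"
  obtains t where "\<And>v. T v = inner t v"
proof -
  interpret T: bounded_linear T by fact
  obtain K where K: "\<And>x. \<bar>T x\<bar> \<le> norm x * K" "K > 0"
    using T.pos_bounded by auto
  \<comment> \<open>The minimiser of this energy is the representing vector; completeness provides
    it directly, without orthogonal complements.\<close>
  define J where "J u = inner u u / 2 - T u" for u
  have lb: "J u \<ge> - K\<^sup>2/2" for u
  proof -
    have "T u \<le> norm u * K" using K(1)[of u] by auto
    moreover have "(norm u - K)\<^sup>2 \<ge> 0" by simp
    ultimately show ?thesis
      unfolding J_def by (simp add: power2_norm_eq_inner[symmetric] power2_diff)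
  qed
  define d where "d = Inf (range J)"
  have bdd: "bdd_below (range J)" using lb by (auto intro!: bdd_belowI2)
  have d: "d \<le> J u" for u unfolding d_def by (rule cInf_lower[OF _ bdd]) auto
  have "\<exists>u. J u < d + inverse (real (Suc n))" for n
    using cInf_lessD[of "range J" "d + inverse (real (Suc n))"] unfolding d_def by auto
  then obtain u where u: "\<And>n. J (u n) < d + inverse (real (Suc n))" by metis
  \<comment> \<open>Parallelogram law: the midpoint has energy at least \<open>d\<close>, so two
    near-minimisers are close and the minimising sequence is Cauchy.\<close>
  have para: "(norm (x - y))\<^sup>2 / 4 \<le> (J x - d) + (J y - d)" for x y
  proof -
    have "J ((1/2) *\<^sub>R (x + y)) = (inner x x + 2 * inner x y + inner y y) / 8 - (T x + T y) / 2"
      by (simp add: J_def inner_add_left inner_add_right T.add T.scaleR inner_commute[of y x] field_simps)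
    moreover have "(norm (x - y))\<^sup>2 = inner x x - 2 * inner x y + inner y y"
      by (simp add: power2_norm_eq_inner inner_diff_left inner_diff_right inner_commute[of y x])
    ultimately show ?thesis using d[of "(1/2) *\<^sub>R (x + y)"] by (simp add: J_def[of x] J_def[of y] field_simps)
  qed
  have "Cauchy u"
  proof (rule metric_CauchyI)
    fix e :: real assume "e > 0"
    obtain N where N: "inverse (real (Suc N)) < e\<^sup>2 / 8"
      using reals_Archimedean[of "e\<^sup>2/8"] \<open>e > 0\<close> by auto
    have "dist (u m) (u n) < e" if "m \<ge> N" "n \<ge> N" for m n
    proof -
      have "J (u m) - d < e\<^sup>2/8" if "m \<ge> N" for m
      proof -
        have "inverse (real (Suc m)) \<le> inverse (real (Suc N))"
          using that by (intro le_imp_inverse_le) auto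
        then show ?thesis using u[of m] N by linarith
      qed
      from this[of m] this[of n] that para[of "u m" "u n"]
      have "(norm (u m - u n))\<^sup>2 < e\<^sup>2" by simp
      then show ?thesis using \<open>e > 0\<close> by (simp add: dist_norm power_less_imp_less_base)
    qed
    then show "\<exists>M. \<forall>m\<ge>M. \<forall>n\<ge>M. dist (u m) (u n) < e" by blast
  qed
  then obtain U where U: "u \<longlonglongrightarrow> U" using Cauchy_convergent convergent_def by blast
  have "(\<lambda>n. J (u n)) \<longlonglongrightarrow> J U"
    unfolding J_def by (auto intro!: tendsto_intros T.tendsto U)
  moreover have "(\<lambda>n. d + inverse (real (Suc n))) \<longlonglongrightarrow> d + 0"
    by (intro tendsto_intros LIMSEQ_inverse_real_of_nat)
  ultimately have JU: "J U \<le> d"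
    using LIMSEQ_le[of "\<lambda>n. J (u n)" "J U" "\<lambda>n. d + inverse (real (Suc n))" "d + 0"] u
    by (auto simp del: of_nat_Suc intro: less_imp_le)
  have "T v = inner U v" for v
  proof -
    define a where "a = inner U v - T v"
    define q where "q = inner v v / 2"
    have q: "q \<ge> 0" by (simp add: q_def)
    \<comment> \<open>The optimal step would be \<open>- a / (2 * q)\<close>; the shift by 1 keeps
      the denominator positive for \<open>v = 0\<close> and still lowers the energy strictly unless
      \<open>a = 0\<close>.\<close>
    define t where "t = - a / (2*q + 1)"
    have "J U \<le> J (U + t *\<^sub>R v)" using JU d order_trans by blast
    then have "0 \<le> a * t + q * t\<^sup>2"
      unfolding J_def a_def q_def
      by (simp add: inner_simps T.add T.scaleR inner_commute power2_eq_square field_simps)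
    also have "a * t + q * t\<^sup>2 = - (a\<^sup>2 * (q + 1) / (2*q+1)\<^sup>2)"
      using q unfolding t_def by (simp add: divide_simps power2_eq_square) (simp add: algebra_simps)
    finally have "a\<^sup>2 * (q + 1) / (2*q+1)\<^sup>2 \<le> 0" by simp
    then have "a\<^sup>2 \<le> 0"
      using q by (simp add: divide_le_0_iff mult_le_0_iff zero_less_power2)
    then show ?thesis unfolding a_def by simp
  qed
  then show ?thesis using that by blast
qed

text \<open>With the Riesz operator \<open>W\<close> of \<open>D\<close> the equation becomes
  \<open>W u = t\<close>, and a damped step towards a solution is a contraction. This covers
  nonsymmetric forms.\<close>

lemma lax_milgram:
  fixes D :: "'h::{real_inner,complete_space} \<Rightarrow> 'h \<Rightarrow> real"
  assumes "bounded_bilinear D" and c: "c > 0" and coer: "\<And>u. c * (norm u)\<^sup>2 \<le> D u u"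
    and T: "bounded_linear T"
  shows "\<exists>!u. \<forall>v. D u v = T v"
proof -
  interpret D: bounded_bilinear D by fact
  obtain K where K: "\<And>u v. \<bar>D u v\<bar> \<le> norm u * norm v * K" "K > 0"
    using D.pos_bounded by auto
  have "\<exists>w. \<forall>v. D u v = inner w v" for u
    using riesz_representation[OF D.bounded_linear_right[of u]] by metis
  then obtain W where W: "\<And>u v. D u v = inner (W u) v" by metis
  obtain t where t: "\<And>v. T v = inner t v" using riesz_representation[OF T] by blast
  have Wd: "W u - W v = W (u - v)" for u v
  proof -
    have "inner (W u - W v - W (u - v)) z = 0" for z
      by (simp add: inner_simps W[symmetric] D.diff_left)
    from this[of "W u - W v - W (u - v)"] show ?thesis by simp
  qed
  have Wn: "norm (W u) \<le> K * norm u" for u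
  proof (cases "W u = 0")
    case True then show ?thesis using K(2) by simp
  next
    case False
    have "norm (W u) * norm (W u) = D u (W u)"
      by (simp add: W power2_norm_eq_inner[symmetric] power2_eq_square)
    also have "\<dots> \<le> norm u * norm (W u) * K" using K(1)[of u "W u"] by auto
    finally show ?thesis using False by (simp add: mult_ac)
  qed
  \<comment> \<open>Enlarging \<open>K\<close> by \<open>c\<close> gives \<open>c \<le> L\<close>,
    so the squared contraction factor \<open>1 - c\<^sup>2 / L\<^sup>2\<close> is not
    negative.\<close>
  define L where "L = K + c"
  have L: "L > 0" "K \<le> L" "c \<le> L" using K(2) c by (auto simp: L_def)
  \<comment> \<open>This step size minimises \<open>1 - 2 * (r * c) + r\<^sup>2 * L\<^sup>2\<close>,
    the bound for the squared Lipschitz constant.\<close>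
  define r where "r = c / L\<^sup>2"
  have r: "r > 0" using c L by (simp add: r_def)
  define q where "q = sqrt (1 - c\<^sup>2 / L\<^sup>2)"
  have cL: "c\<^sup>2 / L\<^sup>2 \<le> 1" using c L by (auto simp: divide_le_eq intro!: power_mono)
  have cL0: "c\<^sup>2 / L\<^sup>2 > 0" using c L by simp
  have q: "0 \<le> q" "q < 1" "q\<^sup>2 = 1 - c\<^sup>2 / L\<^sup>2" using cL cL0 by (auto simp: q_def)
  define \<Phi> where "\<Phi> u = u - r *\<^sub>R (W u - t)" for u
  have lip: "dist (\<Phi> u) (\<Phi> v) \<le> q * dist u v" for u v
  proof -
    define w where "w = u - v"
    have e: "\<Phi> u - \<Phi> v = w - r *\<^sub>R W w"
      by (simp add: \<Phi>_def w_def Wd[symmetric] algebra_simps)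
    have "(norm (w - r *\<^sub>R W w))\<^sup>2 = (norm w)\<^sup>2 - 2 * r * D w w + r\<^sup>2 * (norm (W w))\<^sup>2"
      unfolding power2_norm_eq_inner W
      by (simp add: inner_diff_left inner_diff_right inner_commute[of w "W w"] power2_eq_square algebra_simps)
    also have "\<dots> \<le> (norm w)\<^sup>2 - 2 * r * (c * (norm w)\<^sup>2) + r\<^sup>2 * (L * norm w)\<^sup>2"
    proof -
      have "(norm (W w))\<^sup>2 \<le> (L * norm w)\<^sup>2"
        using Wn[of w] L mult_right_mono[OF L(2), of "norm w"] by (intro power_mono) auto
      then have "r\<^sup>2 * (norm (W w))\<^sup>2 \<le> r\<^sup>2 * (L * norm w)\<^sup>2" by (intro mult_left_mono) auto
      moreover have "2 * r * (c * (norm w)\<^sup>2) \<le> 2 * r * D w w"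
        using coer[of w] r by (intro mult_left_mono) auto
      ultimately show ?thesis by linarith
    qed
    also have "\<dots> = (norm w)\<^sup>2 * (1 - 2 * (r * c) + r\<^sup>2 * L\<^sup>2)"
      by (simp add: algebra_simps power_mult_distrib)
    also have "1 - 2 * (r * c) + r\<^sup>2 * L\<^sup>2 = q\<^sup>2"
    proof -
      have "r * c = c\<^sup>2 / L\<^sup>2" by (simp add: r_def power2_eq_square)
      moreover have "r\<^sup>2 * L\<^sup>2 = c\<^sup>2 / L\<^sup>2"
        using L by (simp add: r_def power2_eq_square)
      ultimately show ?thesis by (simp add: q(3))
    qed
    finally have "(norm (w - r *\<^sub>R W w))\<^sup>2 \<le> (q * norm w)\<^sup>2" by (simp add: power_mult_distrib mult.commute)
    then have "norm (w - r *\<^sub>R W w) \<le> q * norm w" by (rule power2_le_imp_le) (use q in simp)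
    then show ?thesis by (simp add: dist_norm e w_def)
  qed
  have "\<exists>!u. \<Phi> u = u" by (rule banach_fix_type[OF q(1,2)]) (use lip in auto)
  moreover have "\<Phi> u = u \<longleftrightarrow> (\<forall>v. D u v = T v)" for u
  proof -
    have "\<Phi> u = u \<longleftrightarrow> W u = t" using r by (auto simp: \<Phi>_def)
    also have "\<dots> \<longleftrightarrow> (\<forall>v. D u v = T v)"
      unfolding W t by (metis vector_eq_rdot)
    finally show ?thesis .
  qed
  ultimately show ?thesis by simp
qed

section \<open>Orthogonal projections and linear algebra on a finite span\<close>

lemma orthogonal_decomposition_span:
  fixes B :: "'h::real_inner set"
  assumes "finite B"
  shows "\<exists>p\<in>span B. \<forall>b\<in>span B. inner (z - p) b = 0"
  using assms
proof (induction B arbitrary: z)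
  case empty then show ?case by simp
next
  case (insert b B)
  have orth: "inner v x = 0" if "\<forall>b\<in>C. inner v b = 0" "x \<in> span C" for v x and C :: "'h set"
    using that(2) by (induction rule: span_induct_alt) (auto simp: inner_simps that)
  obtain p where p: "p \<in> span B" "\<And>x. x \<in> span B \<Longrightarrow> inner (z - p) x = 0"
    using insert.IH[of z] by blast
  obtain pb where pb: "pb \<in> span B" "\<And>x. x \<in> span B \<Longrightarrow> inner (b - pb) x = 0"
    using insert.IH[of b] by blast
  define e where "e = b - pb"
  have e: "e \<in> span (insert b B)"
    unfolding e_def using pb(1) span_mono[of B "insert b B"] by (intro span_diff) (auto intro: span_base)
  \<comment> \<open>Gram-Schmidt coefficient along the part of \<open>b\<close> orthogonal to
    \<open>span B\<close>; if that part is zero, \<open>b\<close> adds nothing to the span and the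
    coefficient is 0.\<close>
  define k where "k = (if e = 0 then 0 else inner (z - p) e / inner e e)"
  have k: "inner (z - p - k *\<^sub>R e) e = 0" by (simp add: k_def inner_simps)
  have e0: "inner (z - p - k *\<^sub>R e) x = 0" if "x \<in> span B" for x
    using p(2)[OF that] pb(2)[OF that] by (simp add: inner_diff_left e_def)
  have "inner (z - p - k *\<^sub>R e) b = inner (z - p - k *\<^sub>R e) e + inner (z - p - k *\<^sub>R e) pb"
    by (simp add: e_def inner_diff_right)
  then have "inner (z - p - k *\<^sub>R e) b = 0" using k e0[OF pb(1)] by simp
  then have "\<forall>x\<in>insert b B. inner (z - p - k *\<^sub>R e) x = 0"
    using e0 by (auto intro: span_base)
  then have "\<forall>x\<in>span (insert b B). inner (z - p - k *\<^sub>R e) x = 0"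
    using orth[where C="insert b B" and v="z - p - k *\<^sub>R e"] by metis
  moreover have "p + k *\<^sub>R e \<in> span (insert b B)"
    using p(1) e span_mono[of B "insert b B"] by (intro span_add span_scale) auto
  ultimately show ?case by (intro bexI[of _ "p + k *\<^sub>R e"]) (auto simp: diff_diff_eq)
qed

text \<open>Linearity needs no formula for \<open>P\<close>: orthogonal decompositions are unique,
  so sums and multiples of projections are again the projections.\<close>

lemma orthogonal_projection_span:
  fixes B :: "'h::real_inner set"
  assumes "finite B"
  obtains P where "bounded_linear P" "\<And>z. P z \<in> span B" "\<And>z b. b \<in> span B \<Longrightarrow> inner (P z) b = inner z b"
    "\<And>b. b \<in> span B \<Longrightarrow> P b = b" "\<And>z. norm (P z) \<le> norm z"
proof -
  obtain P where P: "\<And>z. P z \<in> span B" "\<And>z b. b \<in> span B \<Longrightarrow> inner (z - P z) b = 0"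
    using orthogonal_decomposition_span[OF assms] by metis
  have uniq: "P z = p" if "p \<in> span B" "\<And>b. b \<in> span B \<Longrightarrow> inner (z - p) b = 0" for z p
  proof -
    have m: "P z - p \<in> span B" using P that by (intro span_diff) auto
    have "inner (P z - p) (P z - p) = inner (z - p) (P z - p) - inner (z - P z) (P z - p)"
      by (simp add: inner_simps)
    then show ?thesis using that(2)[OF m] P(2)[OF m] by simp
  qed
  have n: "norm (P z) \<le> norm z" for z
  proof -
    have "(norm z)\<^sup>2 = (norm (P z))\<^sup>2 + (norm (z - P z))\<^sup>2"
      using P(2)[OF P(1), of z z] by (simp add: power2_norm_eq_inner inner_simps inner_commute)
    then show ?thesis by (metis le_add_same_cancel1 norm_ge_zero power2_le_imp_le zero_le_power2)
  qed
  have "bounded_linear P"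
  proof (rule bounded_linear_intro[where K=1])
    show "P (x + y) = P x + P y" for x y
    proof (rule uniq)
      fix b assume "b \<in> span B"
      then show "inner (x + y - (P x + P y)) b = 0"
        using P(2)[of b x] P(2)[of b y] by (simp add: inner_add_left inner_diff_left)
    qed (simp add: P span_add)
    show "P (r *\<^sub>R x) = r *\<^sub>R P x" for r x
    proof (rule uniq)
      fix b assume "b \<in> span B"
      then show "inner (r *\<^sub>R x - r *\<^sub>R P x) b = 0"
        using P(2)[of b x] by (simp add: scaleR_diff_right[symmetric])
    qed (simp add: P span_scale)
  qed (use n in simp)
  moreover have "P b = b" if "b \<in> span B" for b by (rule uniq[OF that]) simp
  moreover have "inner (P z) b = inner z b" if "b \<in> span B" for z b
    using P(2)[OF that, of z] by (simp add: inner_simps)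
  ultimately show ?thesis using that P(1) n by blast
qed

text \<open>The ambient space may be infinite-dimensional. A basis of the kernel is extended to a
  basis of \<open>span G\<close>, and \<open>f\<close> is injective on the span of the added
  vectors.\<close>

lemma rank_nullity_span:
  fixes f :: "'a::real_vector \<Rightarrow> 'b::real_vector"
  assumes "linear f" "finite G"
  shows "dim {x \<in> span G. f x = 0} + dim (f ` span G) = dim (span G)"
    and "\<exists>B. finite B \<and> span B = {x \<in> span G. f x = 0}"
proof -
  interpret f: linear f by fact
  define K where "K = {x \<in> span G. f x = 0}"
  have sK: "subspace K" unfolding K_def
    by (auto simp: subspace_def f.add f.scale span_add span_scale span_zero)
  obtain B0 where B0: "B0 \<subseteq> K" "independent B0" "K \<subseteq> span B0"
    using real_vector.maximal_independent_subset by blast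
  have spB0: "span B0 = K" using B0 sK by (simp add: span_subspace)
  have "B0 \<subseteq> span G" using B0(1) K_def by auto
  then obtain B where B: "B0 \<subseteq> B" "B \<subseteq> span G" "independent B" "span G \<subseteq> span B"
    using real_vector.maximal_independent_subset_extend[OF _ B0(2)] by blast
  have finB: "finite B" using independent_span_bound[OF assms(2) B(3) B(2)] by simp
  have spB: "span B = span G" using B by (metis span_subspace subspace_span)
  define C where "C = B - B0"
  have BC: "B = B0 \<union> C" "B0 \<inter> C = {}" using B(1) by (auto simp: C_def)
  have iC: "independent C" using B(3) by (rule independent_mono) (auto simp: C_def)
  have inj: "inj_on f (span C)"
  proof (subst linear_injective_on_subspace_0[OF assms(1) subspace_span], intro ballI impI)
    fix x assume x: "x \<in> span C" "f x = 0"
    have finC: "finite C" "finite B0" using finB B(1) by (auto simp: C_def intro: finite_subset)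
    have "x \<in> span G" using x(1) spB span_mono[of C B] C_def by auto
    then have "x \<in> span B0" using x by (simp add: spB0 K_def)
    then obtain u where u: "x = (\<Sum>v\<in>B0. u v *\<^sub>R v)" using span_finite[OF finC(2)] by auto
    obtain w where w: "x = (\<Sum>v\<in>C. w v *\<^sub>R v)" using x(1) span_finite[OF finC(1)] by auto
    \<comment> \<open>The same \<open>x\<close> is expanded in \<open>C\<close> and in
      \<open>B0\<close>; the difference of the expansions is a vanishing combination over the
      independent set \<open>B\<close>.\<close>
    define g where "g v = (if v \<in> C then w v else - u v)" for v
    have "(\<Sum>v\<in>B. g v *\<^sub>R v) = (\<Sum>v\<in>B0. g v *\<^sub>R v) + (\<Sum>v\<in>C. g v *\<^sub>R v)"
      unfolding BC(1) using finC BC(2) by (intro sum.union_disjoint) auto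
    also have "(\<Sum>v\<in>B0. g v *\<^sub>R v) = - x"
      unfolding u sum_negf[symmetric] using BC(2) by (intro sum.cong) (auto simp: g_def)
    also have "(\<Sum>v\<in>C. g v *\<^sub>R v) = x" unfolding w by (intro sum.cong) (auto simp: g_def)
    finally have "(\<Sum>v\<in>B. g v *\<^sub>R v) = 0" by simp
    then have "\<forall>v\<in>B. g v = 0" using B(3) finB dependent_finite by blast
    then have "w v = 0" if "v \<in> C" for v using BC(1) that g_def by (metis UnI2)
    then show "x = 0" unfolding w by simp
  qed
  have "f ` span G = f ` span C"
  proof
    have "f ` B \<subseteq> insert 0 (f ` C)" using BC B0(1) K_def by auto
    then have "span (f ` B) \<subseteq> span (insert 0 (f ` C))" by (rule span_mono)
    also have "\<dots> = span (f ` C)" by simp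
    finally show "f ` span G \<subseteq> f ` span C"
      unfolding spB[symmetric] linear_span_image[OF assms(1), symmetric] .
    show "f ` span C \<subseteq> f ` span G"
      unfolding spB[symmetric] using span_mono[of C B] C_def by auto
  qed
  then have "dim (f ` span G) = dim (f ` C)"
    by (simp add: linear_span_image[OF assms(1), symmetric])
  also have "\<dots> = card (f ` C)"
    by (intro dim_eq_card_independent linear_independent_injective_image[OF assms(1) iC inj])
  also have "\<dots> = card C"
    by (intro card_image inj_on_subset[OF inj] span_superset)
  finally have d1: "dim (f ` span G) = card C" .
  have d2: "dim K = card B0" using B0 spB0 by (metis dim_span_eq_card_independent)
  have d3: "dim (span G) = card B" using B(3) spB by (metis dim_span_eq_card_independent)
  have "card B = card B0 + card C"
    unfolding BC(1) using finB BC by (intro card_Un_disjoint) (auto intro: finite_subset)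
  then show "dim {x \<in> span G. f x = 0} + dim (f ` span G) = dim (span G)"
    using d1 d2 d3 unfolding K_def by simp
  show "\<exists>B. finite B \<and> span B = {x \<in> span G. f x = 0}"
    using spB0 finB B(1) finite_subset unfolding K_def by blast
qed

lemma finite_dim_image:
  fixes f :: "'a::real_vector \<Rightarrow> 'b::real_vector"
  assumes "linear f" "finite B" "inj_on f (span B)"
  shows "dim (f ` span B) = dim (span B)" "\<exists>B'. finite B' \<and> span B' = f ` span B"
proof -
  interpret f: linear f by fact
  have "{x \<in> span B. f x = 0} = {0}"
    using assms(3) linear_injective_on_subspace_0[OF assms(1) subspace_span, of B]
    by (auto simp: span_zero)
  moreover have "dim {0 :: 'a} = 0" using dim_eq_card_independent[OF independent_empty] dim_span[of "{} :: 'a set"] by simp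
  ultimately show "dim (f ` span B) = dim (span B)" using rank_nullity_span(1)[OF assms(1,2)] by simp
  show "\<exists>B'. finite B' \<and> span B' = f ` span B"
    using linear_span_image[OF assms(1), of B] assms(2) by blast
qed

text \<open>The kernel of the adjoint \<open>N\<close> is the orthogonal complement of the range of
  \<open>M\<close> in \<open>span G\<close>, that is, the kernel of the projection \<open>Q\<close>
  onto this range. Since \<open>M\<close> and \<open>Q\<close> have the same range, rank-nullity
  gives kernels of equal dimension.\<close>

lemma finite_dim_fredholm:
  fixes M N :: "'h::real_inner \<Rightarrow> 'h"
  assumes M: "linear M" "\<And>y. y \<in> span G \<Longrightarrow> M y \<in> span G"
    and N: "linear N" "\<And>y. y \<in> span G \<Longrightarrow> N y \<in> span G"
    and adj: "\<And>x y. x \<in> span G \<Longrightarrow> y \<in> span G \<Longrightarrow> inner (M x) y = inner x (N y)"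
    and G: "finite G"
  shows "dim {y \<in> span G. M y = 0} = dim {y \<in> span G. N y = 0}"
    and "\<And>z. z \<in> span G \<Longrightarrow> (\<And>y. y \<in> span G \<Longrightarrow> N y = 0 \<Longrightarrow> inner z y = 0) \<Longrightarrow> z \<in> M ` span G"
proof -
  have img: "M ` span G = span (M ` G)" by (simp add: linear_span_image[OF M(1)])
  have fin: "finite (M ` G)" using G by simp
  obtain Q where Q: "bounded_linear Q" "\<And>z. Q z \<in> span (M ` G)"
    "\<And>z b. b \<in> span (M ` G) \<Longrightarrow> inner (Q z) b = inner z b"
    "\<And>b. b \<in> span (M ` G) \<Longrightarrow> Q b = b" "\<And>z. norm (Q z) \<le> norm z"
    using orthogonal_projection_span[OF fin] by blast
  have MG: "span (M ` G) \<subseteq> span G" unfolding img[symmetric] using M(2) by blast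
  have ker: "N y = 0 \<longleftrightarrow> Q y = 0" if y: "y \<in> span G" for y
  proof
    assume "N y = 0"
    obtain x where x: "x \<in> span G" "Q y = M x" using Q(2)[of y] img by auto
    have "inner (Q y) (Q y) = inner y (Q y)" using Q(2,3) by blast
    also have "\<dots> = inner x (N y)" using adj[OF x(1) y] x(2) by (simp add: inner_commute)
    finally show "Q y = 0" using \<open>N y = 0\<close> by simp
  next
    assume "Q y = 0"
    have "inner (N y) (N y) = inner (M (N y)) y" using adj[OF N(2)[OF y] y] by simp
    also have "\<dots> = inner (Q y) (M (N y))"
      using Q(3)[of "M (N y)" y] img N(2)[OF y] by (metis imageI inner_commute)
    finally show "N y = 0" using \<open>Q y = 0\<close> by simp
  qed
  have Ql: "linear Q" using Q(1) by (rule bounded_linear.linear)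
  have "Q ` span G = M ` span G"
    unfolding img
  proof
    show "Q ` span G \<subseteq> span (M ` G)" using Q(2) by auto
    show "span (M ` G) \<subseteq> Q ` span G"
    proof
      fix x assume "x \<in> span (M ` G)"
      then have "x = Q x" "x \<in> span G" using Q(4) MG by auto
      then show "x \<in> Q ` span G" by blast
    qed
  qed
  moreover have "{y \<in> span G. Q y = 0} = {y \<in> span G. N y = 0}" using ker by auto
  ultimately show "dim {y \<in> span G. M y = 0} = dim {y \<in> span G. N y = 0}"
    using rank_nullity_span(1)[OF M(1) G] rank_nullity_span(1)[OF Ql G] by simp
  fix z assume z: "z \<in> span G" "\<And>y. y \<in> span G \<Longrightarrow> N y = 0 \<Longrightarrow> inner z y = 0"
  define q where "q = z - Q z"
  have q: "q \<in> span G" using z(1) Q(2)[of z] MG unfolding q_def by (auto intro: span_diff)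
  have "Q q = 0" unfolding q_def
    using linear_diff[OF Ql] Q(4)[OF Q(2)[of z]] by simp
  then have "inner z q = 0" using z(2)[OF q] ker[OF q] by simp
  moreover have "inner (Q z) q = 0"
    using Q(3)[OF Q(2)[of z], of q] \<open>Q q = 0\<close> by (simp add: inner_commute)
  ultimately have "inner q q = 0" by (simp add: q_def inner_diff_left)
  then have "z = Q z" by (simp add: q_def)
  then show "z \<in> M ` span G" using Q(2)[of z] img by metis
qed

section \<open>Fredholm alternative for a coercive form perturbed by finite rank\<close>

lemma coercive_form_solution:
  fixes D :: "'h::{real_inner,complete_space} \<Rightarrow> 'h \<Rightarrow> real"
  assumes "bounded_bilinear D" and c: "c > 0" and coer: "\<And>u. c * (norm u)\<^sup>2 \<le> D u u"
  obtains S where "linear S" "\<And>z v. D (S z) v = inner z v"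
    "\<And>u z. (\<And>v. D u v = inner z v) \<Longrightarrow> u = S z"
proof -
  interpret D: bounded_bilinear D by fact
  have ex: "\<exists>!u. \<forall>v. D u v = inner z v" for z
    by (rule lax_milgram[OF assms(1) c coer]) (simp add: bounded_linear_inner_right)
  then obtain S where S: "\<And>z v. D (S z) v = inner z v" by metis
  have u: "u = S z" if "\<And>v. D u v = inner z v" for u z using ex S that by metis
  have "linear S"
    by (rule linearI; rule u[symmetric]) (simp_all add: D.add_left D.scaleR_left S inner_simps)
  then show ?thesis using that S u by blast
qed

lemma bounded_bilinear_sum:
  assumes "bounded_bilinear f" "bounded_bilinear g"
  shows "bounded_bilinear (\<lambda>u v. f u v + g u v)"
proof -
  interpret f: bounded_bilinear f by fact
  interpret g: bounded_bilinear g by fact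
  obtain K L where K: "\<And>u v. norm (f u v) \<le> norm u * norm v * K" and L: "\<And>u v. norm (g u v) \<le> norm u * norm v * L"
    using f.bounded g.bounded by blast
  show ?thesis
  proof
    show "\<exists>K. \<forall>a b. norm (f a b + g a b) \<le> norm a * norm b * K"
    proof (intro exI allI)
      fix a b show "norm (f a b + g a b) \<le> norm a * norm b * (K + L)"
        using norm_triangle_le[OF add_mono[OF K[of a b] L[of a b]]] by (simp add: distrib_left)
    qed
  qed (simp_all add: f.add_left g.add_left f.add_right g.add_right f.scaleR_left g.scaleR_left
      f.scaleR_right g.scaleR_right algebra_simps)
qed

text \<open>Adding a large multiple of the orthogonal projection onto the span of \<open>G\<close> makes the form
  coercive, which reduces the alternative to linear algebra on that span.\<close>

lemma fredholm_alternative_form: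
  fixes A :: "'h::{real_inner,complete_space} \<Rightarrow> 'h \<Rightarrow> real"
  assumes bil: "bounded_bilinear A" and c: "c > 0" and G: "finite G"
    and gard: "\<And>u. c * (norm u)\<^sup>2 - (\<Sum>g\<in>G. (inner g u)\<^sup>2) \<le> A u u"
  defines "A' \<equiv> (\<lambda>u v. A v u)"
  shows "finite_dim (op_kernel A)" "finite_dim (op_kernel A')"
    "dim (op_kernel A) = dim (op_kernel A')"
    "\<And>T. bounded_linear T \<Longrightarrow> (\<exists>u. A u = T) \<longleftrightarrow> (\<forall>u'. A' u' = (\<lambda>v. 0) \<longrightarrow> T u' = 0)"
proof -
  interpret A: bounded_bilinear A by fact
  obtain P where P: "bounded_linear P" "\<And>z. P z \<in> span G"
    "\<And>z b. b \<in> span G \<Longrightarrow> inner (P z) b = inner z b"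
    "\<And>b. b \<in> span G \<Longrightarrow> P b = b" "\<And>z. norm (P z) \<le> norm z"
    using orthogonal_projection_span[OF G] by blast
  interpret P: bounded_linear P by fact
  \<comment> \<open>By Cauchy-Schwarz this multiple of the projection dominates the squared
    functionals in \<open>gard\<close>; the added 1 keeps \<open>s\<close> positive for empty
    \<open>G\<close>.\<close>
  define s where "s = (\<Sum>g\<in>G. (norm g)\<^sup>2) + 1"
  have s: "s > 0" unfolding s_def by (smt (verit) sum_nonneg zero_le_power2)
  have Psym: "inner (P u) v = inner u (P v)" for u v
    by (metis P(2,3) inner_commute)
  have sP: "(\<Sum>g\<in>G. (inner g u)\<^sup>2) \<le> s * inner (P u) u" for u
  proof -
    have "(\<Sum>g\<in>G. (inner g u)\<^sup>2) \<le> (\<Sum>g\<in>G. (norm g)\<^sup>2 * (norm (P u))\<^sup>2)"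
    proof (intro sum_mono)
      fix g assume "g \<in> G"
      then have "inner g u = inner g (P u)" using P(3)[of g u] by (simp add: span_base inner_commute)
      then show "(inner g u)\<^sup>2 \<le> (norm g)\<^sup>2 * (norm (P u))\<^sup>2"
        by (metis Cauchy_Schwarz_ineq power2_norm_eq_inner)
    qed
    also have "\<dots> = (s - 1) * (norm (P u))\<^sup>2" by (simp add: s_def sum_distrib_right)
    also have "\<dots> \<le> s * (norm (P u))\<^sup>2" by (intro mult_right_mono) auto
    also have "(norm (P u))\<^sup>2 = inner (P u) u"
      using P(3)[OF P(2)[of u], of u] by (simp add: power2_norm_eq_inner inner_commute)
    finally show ?thesis .
  qed
  define D where "D u v = A u v + s * inner (P u) v" for u v
  define D' where "D' u v = D v u" for u v
  have bP: "bounded_bilinear (\<lambda>u v. s * inner (P u) v)"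
  proof
    show "\<exists>K. \<forall>a b. norm (s * inner (P a) b) \<le> norm a * norm b * K"
    proof (intro exI allI)
      fix a b
      have "norm (inner (P a) b) \<le> norm (P a) * norm b" by (simp add: Cauchy_Schwarz_ineq2)
      also have "\<dots> \<le> norm a * norm b" by (intro mult_right_mono P(5)) auto
      finally show "norm (s * inner (P a) b) \<le> norm a * norm b * s"
        using s by (simp add: abs_mult mult.commute)
    qed
  qed (auto simp: P.add P.scaleR inner_simps algebra_simps)
  have bD: "bounded_bilinear D" unfolding D_def by (rule bounded_bilinear_sum[OF bil bP])
  have bD': "bounded_bilinear D'" unfolding D'_def by (rule bounded_bilinear.flip[OF bD])
  have cD: "c * (norm u)\<^sup>2 \<le> D u u" for u
    using gard[of u] sP[of u] unfolding D_def by linarith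
  have cD': "c * (norm u)\<^sup>2 \<le> D' u u" for u using cD D'_def by simp
  obtain S where S: "linear S" "\<And>z v. D (S z) v = inner z v"
    "\<And>u z. (\<And>v. D u v = inner z v) \<Longrightarrow> u = S z"
    using coercive_form_solution[OF bD c cD] by blast
  obtain S' where S': "linear S'" "\<And>z v. D' (S' z) v = inner z v"
    "\<And>u z. (\<And>v. D' u v = inner z v) \<Longrightarrow> u = S' z"
    using coercive_form_solution[OF bD' c cD'] by blast
  have A'D': "A' u v = D' u v - s * inner (P u) v" for u v
    by (simp add: A'_def D'_def D_def Psym[of u v]) (simp add: inner_commute)
  have SS': "inner (S y) z = inner y (S' z)" for y z
    by (metis D'_def S(2) S'(2) inner_commute)
  \<comment> \<open>If \<open>T\<close> is represented by \<open>\<tau>\<close> and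
    \<open>y = P u\<close>, then \<open>A u = T\<close> means
    \<open>u = S (\<tau> + s *\<^sub>R y)\<close>. Applying \<open>P\<close> leaves the equation
    \<open>M y = P (S \<tau>)\<close> inside \<open>span G\<close>. \<open>N\<close> is the same
    construction for the flipped form.\<close>
  define M where "M y = y - s *\<^sub>R P (S y)" for y
  define N where "N y = y - s *\<^sub>R P (S' y)" for y
  have lM: "linear M" and lN: "linear N"
    unfolding M_def N_def
    using linear_add[OF S(1)] linear_scale[OF S(1)] linear_add[OF S'(1)] linear_scale[OF S'(1)]
    by (auto intro!: linearI simp: P.add P.scaleR algebra_simps)
  have MG: "M y \<in> span G" and NG: "N y \<in> span G" if "y \<in> span G" for y
    using that P(2) by (auto simp: M_def N_def span_diff span_scale)
  have adj: "inner (M x) y = inner x (N y)" if "x \<in> span G" "y \<in> span G" for x y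
  proof -
    have "inner (P (S x)) y = inner (S x) y" using P(3)[OF that(2)] .
    moreover have "inner x (P (S' y)) = inner x (S' y)"
      using P(3)[OF that(1), of "S' y"] by (simp add: inner_commute)
    ultimately show ?thesis using SS'[of x y] by (simp add: M_def N_def inner_simps)
  qed
  note fin = finite_dim_fredholm[OF lM MG lN NG adj G]
  \<comment> \<open>\<open>P\<close> and multiplication of the solution operator by \<open>s\<close>
    are inverse to each other between the kernel of the form and that of \<open>R\<close> on
    \<open>span G\<close>. The claim is generic in order to serve both \<open>A\<close> and
    \<open>A'\<close>.\<close>
  have kernel: "finite_dim (op_kernel E) \<and> dim (op_kernel E) = dim {y \<in> span G. R y = 0}
      \<and> (\<forall>y\<in>span G. R y = 0 \<longrightarrow> E (s *\<^sub>R Z y) = (\<lambda>v. 0))"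
    if E: "\<And>u v. E u v = F u v - s * inner (P u) v"
      and F: "bounded_bilinear F"
      and Z: "linear Z" "\<And>z v. F (Z z) v = inner z v" "\<And>u z. (\<And>v. F u v = inner z v) \<Longrightarrow> u = Z z"
      and R: "\<And>y. R y = y - s *\<^sub>R P (Z y)" and lR: "linear R" for E F Z R
  proof -
    interpret F: bounded_bilinear F by fact
    define K where "K = {y \<in> span G. R y = 0}"
    have lsZ: "linear (\<lambda>y. s *\<^sub>R Z y)"
      using linear_add[OF Z(1)] linear_scale[OF Z(1)] by (auto intro!: linearI simp: algebra_simps)
    have PK: "P (s *\<^sub>R Z y) = y" if "y \<in> K" for y using that by (simp add: K_def R P.scaleR)
    have a: "E (s *\<^sub>R Z y) = (\<lambda>v. 0)" if "y \<in> K" for y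
      using PK[OF that] by (simp add: fun_eq_iff E F.scaleR_left Z(2))
    have b: "u \<in> (\<lambda>y. s *\<^sub>R Z y) ` K" if "E u = (\<lambda>v. 0)" for u
    proof
      have "E u v = 0" for v using that by simp
      then have "F u v = inner (s *\<^sub>R P u) v" for v using E by simp
      then have "u = Z (s *\<^sub>R P u)" by (rule Z(3))
      then show u: "u = s *\<^sub>R Z (P u)" by (simp add: linear_scale[OF Z(1)])
      show "P u \<in> K" using P(2) arg_cong[OF u, of P] by (simp add: K_def R P.scaleR)
    qed
    have ker: "op_kernel E = (\<lambda>y. s *\<^sub>R Z y) ` K" using a b by (auto simp: op_kernel_def)
    obtain B where B: "finite B" "span B = K"
      using rank_nullity_span(2)[OF lR G] unfolding K_def by blast
    have inj: "inj_on (\<lambda>y. s *\<^sub>R Z y) (span B)"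
      unfolding B(2) by (rule inj_on_inverseI[where g=P]) (rule PK)
    show ?thesis
      using finite_dim_image[OF lsZ B(1) inj] a unfolding ker B(2) finite_dim_def K_def by blast
  qed
  have kA: "finite_dim (op_kernel A)" "dim (op_kernel A) = dim {y \<in> span G. M y = 0}"
    using kernel[OF _ bD S M_def lM, of A] by (auto simp: D_def)
  have kA': "finite_dim (op_kernel A')" "dim (op_kernel A') = dim {y \<in> span G. N y = 0}"
      "\<And>y. y \<in> span G \<Longrightarrow> N y = 0 \<Longrightarrow> A' (s *\<^sub>R S' y) = (\<lambda>v. 0)"
    using kernel[OF A'D' bD' S' N_def lN] by auto
  show "finite_dim (op_kernel A)" "finite_dim (op_kernel A')"
    "dim (op_kernel A) = dim (op_kernel A')"
    using kA kA' fin(1) by auto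
  fix T :: "'h \<Rightarrow> real" assume T: "bounded_linear T"
  show "(\<exists>u. A u = T) \<longleftrightarrow> (\<forall>u'. A' u' = (\<lambda>v. 0) \<longrightarrow> T u' = 0)"
  proof
    assume "\<exists>u. A u = T"
    then show "\<forall>u'. A' u' = (\<lambda>v. 0) \<longrightarrow> T u' = 0"
      by (auto simp: A'_def dest: fun_cong)
  next
    assume orth: "\<forall>u'. A' u' = (\<lambda>v. 0) \<longrightarrow> T u' = 0"
    obtain \<tau> where \<tau>: "\<And>v. T v = inner \<tau> v" using riesz_representation[OF T] by blast
    \<comment> \<open>\<open>T\<close> vanishes on \<open>s *\<^sub>R S' y\<close> for each
      \<open>y\<close> in the kernel of \<open>N\<close>; moving \<open>S'\<close> to the other side
      of the inner product turns this into the solvability condition for \<open>M\<close>.\<close>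
    have "P (S \<tau>) \<in> M ` span G"
    proof (rule fin(2)[OF _ _ _ _ P(2)])
      fix y assume y: "y \<in> span G" "N y = 0"
      have "T (s *\<^sub>R S' y) = 0" using orth kA'(3)[OF y] by blast
      then have "inner \<tau> (S' y) = 0" using s by (simp add: \<tau>)
      then show "inner (P (S \<tau>)) y = 0" using P(3)[OF y(1)] SS' by simp
    qed (use adj MG NG in auto)
    then obtain y where y: "y \<in> span G" "P (S \<tau>) = M y" by auto
    define u where "u = S (\<tau> + s *\<^sub>R y)"
    have "P u = y" using y(2)
      by (simp add: u_def linear_add[OF S(1)] linear_scale[OF S(1)] P.add P.scaleR M_def)
    then have "A u v = T v" for v
      using S(2)[of "\<tau> + s *\<^sub>R y" v] by (simp add: D_def u_def[symmetric] \<tau> inner_simps)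
    then show "\<exists>u. A u = T" by blast
  qed
qed

section \<open>Eigenvectors and orthonormal systems\<close>

lemma eigenvectors_independent:
  assumes S: "linear (S :: 'a::real_vector \<Rightarrow> 'a)" and "finite I"
    and "\<And>i. i \<in> I \<Longrightarrow> S (x i) = l i *\<^sub>R x i" "inj_on l I"
    and "\<And>i. i \<in> I \<Longrightarrow> x i \<noteq> 0" and "(\<Sum>i\<in>I. k i *\<^sub>R x i) = 0" "i \<in> I"
  shows "k i = 0"
  using assms(2-)
proof (induction I arbitrary: k i)
  case empty then show ?case by simp
next
  case (insert j I)
  have eq: "(\<Sum>i\<in>I. k i *\<^sub>R x i) + k j *\<^sub>R x j = 0" using insert.prems(4) insert.hyps by (simp add: add.commute)
  have "S ((\<Sum>i\<in>I. k i *\<^sub>R x i) + k j *\<^sub>R x j) = 0" unfolding eq by (rule linear_0[OF S])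
  then have e1: "(\<Sum>i\<in>I. (k i * l i) *\<^sub>R x i) + (k j * l j) *\<^sub>R x j = 0"
    using insert.prems(1) by (simp add: linear_add[OF S] linear_sum[OF S] linear_scale[OF S])
  have "l j *\<^sub>R ((\<Sum>i\<in>I. k i *\<^sub>R x i) + k j *\<^sub>R x j) = 0" by (simp add: eq)
  then have e2: "(\<Sum>i\<in>I. (k i * l j) *\<^sub>R x i) + (k j * l j) *\<^sub>R x j = 0"
    by (simp add: scaleR_add_right scaleR_sum_right mult.commute)
  \<comment> \<open>Comparing the image of the relation under \<open>S\<close> with its multiple by
    \<open>l j\<close> cancels the term of \<open>j\<close> and leaves a relation over
    \<open>I\<close> with coefficients \<open>k i * (l i - l j)\<close>.\<close>
  have "(\<Sum>i\<in>I. (k i * l i) *\<^sub>R x i) = (\<Sum>i\<in>I. (k i * l j) *\<^sub>R x i)"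
    using e1[folded e2] by (rule add_right_imp_eq)
  then have "(\<Sum>i\<in>I. (k i * (l i - l j)) *\<^sub>R x i) = 0"
    by (simp add: right_diff_distrib scaleR_left_diff_distrib sum_subtractf)
  then have "k i * (l i - l j) = 0" if "i \<in> I" for i
    using insert.IH[of "\<lambda>i. k i * (l i - l j)" i] insert.prems that by (auto simp: inj_on_def)
  moreover have "l i \<noteq> l j" if "i \<in> I" for i
    using insert.prems(2) insert.hyps that by (auto simp: inj_on_def)
  ultimately have kI: "k i = 0" if "i \<in> I" for i using that by force
  then have "k j *\<^sub>R x j = 0" using eq by simp
  then have "k j = 0" using insert.prems(3) by simp
  then show ?case using kI insert.prems(5) by auto
qed

lemma bessel_inequality:
  fixes w :: "nat \<Rightarrow> 'h::real_inner"
  assumes "\<And>i j. i < N \<Longrightarrow> j < N \<Longrightarrow> inner (w i) (w j) = (if i = j then 1 else 0)"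
  shows "(\<Sum>i<N. (inner g (w i))\<^sup>2) \<le> (norm g)\<^sup>2"
proof -
  define p where "p = (\<Sum>i<N. inner g (w i) *\<^sub>R w i)"
  have a: "inner g p = (\<Sum>i<N. (inner g (w i))\<^sup>2)"
    by (simp add: p_def inner_sum_right power2_eq_square)
  have "inner p (w j) = inner g (w j)" if "j < N" for j
  proof -
    have "inner p (w j) = (\<Sum>i<N. inner g (w i) * (if i = j then 1 else 0))"
      unfolding p_def inner_sum_left using assms that by (intro sum.cong) auto
    also have "\<dots> = inner g (w j)"
      using sum.delta[of "{..<N}" j "\<lambda>i. inner g (w i)"] that
      by (simp add: if_distrib[of "\<lambda>x. _ * x"] cong: if_cong)
    finally show ?thesis .
  qed
  then have b: "inner p p = (\<Sum>i<N. (inner g (w i))\<^sup>2)"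
    by (subst (2) p_def) (simp add: inner_sum_right power2_eq_square)
  have "0 \<le> inner (g - p) (g - p)" by simp
  then show ?thesis using a b by (simp add: inner_diff_left inner_diff_right inner_commute power2_norm_eq_inner)
qed

text \<open>\<open>dim\<close> also vanishes on infinite-dimensional spaces; finite dimension is
  what ties the value 0 to the trivial space.\<close>

lemma finite_dim_dim_eq_0:
  assumes "finite_dim V"
  shows "dim V = 0 \<longleftrightarrow> V = {0}"
proof -
  obtain B where B: "finite B" "span B = V" using assms finite_dim_def by blast
  then have sV: "subspace V" by auto
  obtain I where I: "I \<subseteq> V" "independent I" "V \<subseteq> span I"
    using real_vector.maximal_independent_subset by blast
  have V: "V = span I" using I sV by (metis span_subspace)
  have "finite I" using independent_span_bound[OF B(1) I(2)] I(1) B(2) by auto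
  moreover have "dim V = card I" unfolding V by (rule dim_span_eq_card_independent[OF I(2)])
  ultimately have "dim V = 0 \<longleftrightarrow> I = {}" by simp
  also have "\<dots> \<longleftrightarrow> V = {0}"
    using I V by (auto simp: dependent_zero)
  finally show ?thesis .
qed

text \<open>\<open>S\<close> preserves the span \<open>E m\<close> of the first eigenvectors, so
  Gram-Schmidt makes it triangular with the eigenvalues on the diagonal. The eigenvectors of a
  nonsymmetric \<open>S\<close> need not be orthogonal themselves.\<close>

lemma orthonormal_increments:
  fixes u :: "nat \<Rightarrow> 'h::real_inner"
  assumes S: "linear S" and eig: "\<And>i. S (u i) = l i *\<^sub>R u i" "inj l" and u0: "\<And>i. u i \<noteq> 0"
  obtains w where "\<And>i j. inner (w i) (w j) = (if i = j then 1 else 0 :: real)"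
    "\<And>i. inner (S (w i)) (w i) = l i"
proof -
  define E where "E m = span (u ` {..<m})" for m
  have notin: "u m \<notin> E m" for m
  proof
    assume "u m \<in> E m"
    then obtain k where k: "u m = (\<Sum>v\<in>u ` {..<m}. k v *\<^sub>R v)"
      unfolding E_def using span_finite[of "u ` {..<m}"] by auto
    have inj: "inj u"
    proof (rule injI)
      fix i j assume "u i = u j"
      then have "(l i - l j) *\<^sub>R u i = 0" using eig(1)[of i] eig(1)[of j] by (metis right_minus_eq scaleR_left_diff_distrib)
      then show "i = j" using u0[of i] eig(2) by (auto simp: inj_def)
    qed
    have um: "u m = (\<Sum>i<m. k (u i) *\<^sub>R u i)"
      unfolding k by (subst sum.reindex) (auto intro: inj_on_subset[OF inj])
    define k' where "k' i = (if i = m then - 1 else k (u i))" for i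
    have "(\<Sum>i\<in>{..m}. k' i *\<^sub>R u i) = (\<Sum>i<m. k' i *\<^sub>R u i) + k' m *\<^sub>R u m"
      by (simp add: lessThan_Suc_atMost[symmetric])
    also have "(\<Sum>i<m. k' i *\<^sub>R u i) = u m"
      by (subst um) (intro sum.cong, auto simp: k'_def)
    finally have "(\<Sum>i\<in>{..m}. k' i *\<^sub>R u i) = 0" by (simp add: k'_def)
    then have "k' m = 0"
      by (rule eigenvectors_independent[OF S _ eig(1) inj_on_subset[OF eig(2)] u0, rotated 2]) auto
    then show False by (simp add: k'_def)
  qed
  have "\<exists>p. p \<in> E m \<and> (\<forall>b\<in>E m. inner (u m - p) b = 0)" for m
    using orthogonal_decomposition_span[of "u ` {..<m}" "u m"] unfolding E_def by auto
  then obtain p where p: "\<And>m. p m \<in> E m" "\<And>m b. b \<in> E m \<Longrightarrow> inner (u m - p m) b = 0" by metis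
  define v where "v m = u m - p m" for m
  have v0: "v m \<noteq> 0" for m using notin[of m] p(1)[of m] by (auto simp: v_def)
  have Emono: "E i \<subseteq> E j" if "i \<le> j" for i j unfolding E_def using that by (intro span_mono) auto
  have vE: "v i \<in> E j" if "i < j" for i j
  proof -
    have "u i \<in> E j" using that unfolding E_def by (intro span_base) auto
    moreover have "p i \<in> E j" using p(1)[of i] Emono[of i j] that by auto
    ultimately show ?thesis unfolding v_def E_def by (rule span_diff)
  qed
  have SE: "S x \<in> E m" if "x \<in> E m" for x m
  proof -
    have "S ` E m = span (S ` u ` {..<m})" unfolding E_def by (rule linear_span_image[OF S, symmetric])
    also have "\<dots> \<subseteq> span (E m)"
    proof (rule span_mono)
      have "l i *\<^sub>R u i \<in> E m" if "i < m" for i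
        unfolding E_def using that by (intro span_scale span_base imageI) simp
      then show "S ` u ` {..<m} \<subseteq> E m" by (auto simp: eig(1))
    qed
    finally show ?thesis using that unfolding E_def by (simp add: image_subset_iff span_span)
  qed
  have vS: "inner (S (v m)) (v m) = l m * inner (v m) (v m)" for m
  proof -
    have "S (v m) = l m *\<^sub>R v m + (l m *\<^sub>R p m - S (p m))"
      by (simp add: v_def linear_diff[OF S] eig(1) algebra_simps)
    moreover have "l m *\<^sub>R p m - S (p m) \<in> E m"
      using p(1)[of m] SE[OF p(1)] unfolding E_def by (intro span_diff span_scale)
    then have "inner (v m) (l m *\<^sub>R p m - S (p m)) = 0" unfolding v_def by (rule p(2))
    then have "inner (l m *\<^sub>R p m - S (p m)) (v m) = 0" by (simp only: inner_commute)
    ultimately show ?thesis by (simp only: inner_add_left inner_scaleR_left add_0_right)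
  qed
  define w where "w m = (1 / norm (v m)) *\<^sub>R v m" for m
  have "inner (v i) (v j) = 0" if "i < j" for i j
    using p(2)[OF vE[OF that]] by (simp add: v_def inner_commute)
  then have "inner (v i) (v j) = 0" if "i \<noteq> j" for i j
    using that by (metis inner_commute linorder_neqE_nat)
  then have "inner (w i) (w j) = (if i = j then 1 else 0)" for i j
    using v0 by (simp add: w_def power2_norm_eq_inner[symmetric] power2_eq_square)
  moreover have "inner (S (w i)) (w i) = l i" for i
    using v0[of i] vS[of i] by (simp add: w_def linear_scale[OF S] power2_norm_eq_inner[symmetric] power2_eq_square)
  ultimately show ?thesis using that by blast
qed

section \<open>Spectrum of a form with a Garding inequality relative to a compact form\<close>

text \<open>\<open>t_compact\<close> expresses that the positive form \<open>t\<close> is represented by a compact operator.\<close>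

locale garding_pair =
  fixes b t :: "'h::{real_inner,complete_space} \<Rightarrow> 'h \<Rightarrow> real" and c C :: real
  assumes b: "bounded_bilinear b" and t: "bounded_bilinear t"
    and t_sym: "\<And>u v. t u v = t v u" and t_pos: "\<And>u. 0 \<le> t u u"
    and c: "c > 0" and C: "C \<ge> 0"
    and garding: "\<And>u. c * (norm u)\<^sup>2 - C * t u u \<le> b u u"
    and t_compact: "\<And>e. e > 0 \<Longrightarrow> \<exists>G. finite G \<and> (\<forall>u. t u u \<le> e * (norm u)\<^sup>2 + (\<Sum>g\<in>G. (inner g u)\<^sup>2))"
begin

definition L where "L \<sigma> u = (\<lambda>v. b u v + \<sigma> * t u v)"
definition L' where "L' \<sigma> u = (\<lambda>v. b v u + \<sigma> * t u v)"

lemma bounded_bilinear_L: "bounded_bilinear (L \<sigma>)"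
proof -
  interpret t: bounded_bilinear t by (rule t)
  obtain K where K: "\<And>u v. norm (t u v) \<le> norm u * norm v * K" using t.bounded by blast
  have "bounded_bilinear (\<lambda>u v. \<sigma> * t u v)"
  proof
    show "\<exists>K. \<forall>a b. norm (\<sigma> * t a b) \<le> norm a * norm b * K"
    proof (intro exI allI)
      fix a b show "norm (\<sigma> * t a b) \<le> norm a * norm b * (\<bar>\<sigma>\<bar> * K)"
        using mult_left_mono[OF K[of a b], of "\<bar>\<sigma>\<bar>"] by (simp add: abs_mult mult_ac)
    qed
  qed (simp_all add: t.add_left t.add_right t.scaleR_left t.scaleR_right algebra_simps)
  then show ?thesis unfolding L_def[abs_def] by (rule bounded_bilinear_sum[OF b])
qed

lemma garding_L: "\<exists>G. finite G \<and> (\<forall>u. c / 2 * (norm u)\<^sup>2 - (\<Sum>g\<in>G. (inner g u)\<^sup>2) \<le> L \<sigma> u u)"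
proof -
  \<comment> \<open>\<open>K\<close> is positive and dominates \<open>C - \<sigma>\<close>;
    compactness of \<open>t\<close> at level \<open>c / (2 * K)\<close> then costs half of the
    coercivity constant.\<close>
  define K where "K = C + \<bar>\<sigma>\<bar> + 1"
  have K: "K > 0" using C by (simp add: K_def)
  obtain G where G: "finite G" "\<And>u. t u u \<le> c / (2 * K) * (norm u)\<^sup>2 + (\<Sum>g\<in>G. (inner g u)\<^sup>2)"
    using t_compact[of "c / (2 * K)"] c K by auto
  \<comment> \<open>Scaling by \<open>sqrt K\<close> absorbs the factor \<open>K\<close> into the
    squared functionals.\<close>
  define G' where "G' = (\<lambda>g. sqrt K *\<^sub>R g) ` G"
  have "c / 2 * (norm u)\<^sup>2 - (\<Sum>g\<in>G'. (inner g u)\<^sup>2) \<le> L \<sigma> u u" for u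
  proof -
    have "(\<Sum>g\<in>G'. (inner g u)\<^sup>2) = K * (\<Sum>g\<in>G. (inner g u)\<^sup>2)"
      unfolding G'_def using K by (subst sum.reindex) (auto simp: inj_on_def power_mult_distrib sum_distrib_left)
    moreover have "K * t u u \<le> K * (c / (2 * K) * (norm u)\<^sup>2 + (\<Sum>g\<in>G. (inner g u)\<^sup>2))"
      using G(2)[of u] K by (intro mult_left_mono) auto
    moreover have "K * (c / (2 * K) * (norm u)\<^sup>2 + (\<Sum>g\<in>G. (inner g u)\<^sup>2))
        = c / 2 * (norm u)\<^sup>2 + K * (\<Sum>g\<in>G. (inner g u)\<^sup>2)" using K by (simp add: distrib_left)
    moreover have "K * t u u = C * t u u + \<bar>\<sigma>\<bar> * t u u + t u u" by (simp add: K_def algebra_simps)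
    moreover have "- \<sigma> * t u u \<le> \<bar>\<sigma>\<bar> * t u u" using t_pos[of u] by (intro mult_right_mono) auto
    ultimately show ?thesis
      using garding[of u] t_pos[of u] unfolding L_def by linarith
  qed
  then show ?thesis using G(1) unfolding G'_def by blast
qed

lemma fredholm_L:
  shows "finite_dim (op_kernel (L \<sigma>))" "finite_dim (op_kernel (L' \<sigma>))"
    "dim (op_kernel (L \<sigma>)) = dim (op_kernel (L' \<sigma>))"
    "T \<in> dual \<Longrightarrow> (\<exists>u. L \<sigma> u = T) \<longleftrightarrow> (\<forall>u'. L' \<sigma> u' = (\<lambda>v. 0) \<longrightarrow> T u' = 0)"
proof -
  obtain G where G: "finite G" "\<And>u. c / 2 * (norm u)\<^sup>2 - (\<Sum>g\<in>G. (inner g u)\<^sup>2) \<le> L \<sigma> u u"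
    using garding_L by metis
  have L': "L' \<sigma> u = (\<lambda>v. L \<sigma> v u)" for u by (simp add: fun_eq_iff L_def L'_def t_sym[of u])
  have L'': "L' \<sigma> = (\<lambda>u v. L \<sigma> v u)" by (simp add: fun_eq_iff L_def L'_def t_sym)
  have "c / 2 > 0" using c by simp
  note * = fredholm_alternative_form[OF bounded_bilinear_L this G, folded L'']
  show "finite_dim (op_kernel (L \<sigma>))" "finite_dim (op_kernel (L' \<sigma>))"
    "dim (op_kernel (L \<sigma>)) = dim (op_kernel (L' \<sigma>))"
    "T \<in> dual \<Longrightarrow> (\<exists>u. L \<sigma> u = T) \<longleftrightarrow> (\<forall>u'. L' \<sigma> u' = (\<lambda>v. 0) \<longrightarrow> T u' = 0)"
    using * by (simp_all add: dual_def L' )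
qed

lemma zero_in_kernel: "0 \<in> op_kernel (L \<sigma>)" "0 \<in> op_kernel (L' \<sigma>)"
  using bounded_bilinear.zero_left[OF b] bounded_bilinear.zero_left[OF t] bounded_bilinear.zero_right[OF b]
  by (auto simp: op_kernel_def L_def L'_def)

lemma L_diff: "L \<sigma> u = L \<sigma> v \<longleftrightarrow> u - v \<in> op_kernel (L \<sigma>)"
  using bounded_bilinear.diff_left[OF bounded_bilinear_L] by (auto simp: op_kernel_def fun_eq_iff)

definition \<Sigma> where "\<Sigma> = {\<sigma>. op_kernel (L \<sigma>) \<noteq> {0}}"

text \<open>From \<open>C\<close> upwards the Garding inequality makes \<open>L \<sigma>\<close>
  coercive, which excludes a nonzero kernel.\<close>

lemma \<Sigma>_less: "\<sigma> \<in> \<Sigma> \<Longrightarrow> \<sigma> < C"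
proof (rule ccontr)
  assume s: "\<sigma> \<in> \<Sigma>" "\<not> \<sigma> < C"
  then obtain u where u: "u \<noteq> 0" "L \<sigma> u = (\<lambda>v. 0)"
    using zero_in_kernel(1)[of \<sigma>] by (auto simp: \<Sigma>_def op_kernel_def)
  have "C * t u u \<le> \<sigma> * t u u" using s(2) t_pos[of u] by (intro mult_right_mono) auto
  moreover have "L \<sigma> u u = 0" using u(2) by simp
  ultimately have "c * (norm u)\<^sup>2 \<le> 0" using garding[of u] by (simp add: L_def)
  then show False using c u(1) by (simp add: mult_le_0_iff)
qed

text \<open>Orthonormalising eigenvectors for infinitely many eigenvalues above \<open>- M\<close> gives orthonormal
  vectors on which \<open>t\<close> is bounded below; by compactness of \<open>t\<close> this contradicts Bessel's inequality.\<close>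

lemma finite_\<Sigma>_above: "finite (\<Sigma> \<inter> {- M..})"
proof (rule ccontr)
  assume inf: "infinite (\<Sigma> \<inter> {- M..})"
  interpret t: bounded_bilinear t by (rule t)
  obtain \<sigma> :: "nat \<Rightarrow> real" where \<sigma>: "inj \<sigma>" "range \<sigma> \<subseteq> \<Sigma> \<inter> {- M..}"
    using infinite_countable_subset[OF inf] by blast
  \<comment> \<open>\<open>L (\<sigma> i)\<close> is \<open>L C\<close> minus
    \<open>\<tau> i\<close> times \<open>t\<close>. An eigenvector thus solves
    \<open>S u = (1 / \<tau> i) *\<^sub>R u\<close>, where \<open>S\<close> applies \<open>t\<close>
    and then inverts the coercive form \<open>L C\<close>.\<close>
  define \<tau> where "\<tau> i = C - \<sigma> i" for i
  have \<tau>: "0 < \<tau> i" "\<tau> i \<le> C + M" for i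
    using \<sigma>(2) \<Sigma>_less[of "\<sigma> i"] by (auto simp: \<tau>_def image_subset_iff minus_le_iff)
  define \<beta> where "\<beta> = L C"
  interpret \<beta>: bounded_bilinear \<beta> unfolding \<beta>_def by (rule bounded_bilinear_L)
  have coer: "c * (norm u)\<^sup>2 \<le> \<beta> u u" for u using garding[of u] by (simp add: \<beta>_def L_def)
  have ex: "\<exists>!u. \<forall>v. \<beta> u v = t z v" for z
    by (rule lax_milgram[OF \<beta>.bounded_bilinear_axioms c coer t.bounded_linear_right])
  then obtain S where S: "\<And>z v. \<beta> (S z) v = t z v" by metis
  have Su: "S z = u" if "\<And>v. \<beta> u v = t z v" for u z using ex S that by metis
  have linS: "linear S"
    by (rule linearI; rule Su) (simp_all add: \<beta>.add_left \<beta>.scaleR_left S t.add_left t.scaleR_left)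
  have "\<exists>u. u \<noteq> 0 \<and> L (\<sigma> i) u = (\<lambda>v. 0)" for i
  proof -
    have "\<sigma> i \<in> \<Sigma>" using \<sigma>(2) by auto
    then show ?thesis using zero_in_kernel(1)[of "\<sigma> i"] by (auto simp: \<Sigma>_def op_kernel_def)
  qed
  then obtain u where u: "\<And>i. u i \<noteq> 0" "\<And>i. L (\<sigma> i) (u i) = (\<lambda>v. 0)" by metis
  have eig: "S (u i) = (1 / \<tau> i) *\<^sub>R u i" for i
  proof (rule Su)
    fix v
    have "L (\<sigma> i) (u i) v = 0" using u(2) by simp
    then have "\<beta> (u i) v = \<tau> i * t (u i) v" by (simp add: L_def \<beta>_def \<tau>_def algebra_simps)
    then show "\<beta> ((1 / \<tau> i) *\<^sub>R u i) v = t (u i) v" using \<tau>(1)[of i] by (simp add: \<beta>.scaleR_left)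
  qed
  have injl: "inj (\<lambda>i. 1 / \<tau> i)"
  proof (rule injI)
    fix i j assume "1 / \<tau> i = 1 / \<tau> j"
    then have "\<sigma> i = \<sigma> j" by (simp add: \<tau>_def)
    then show "i = j" using \<sigma>(1) by (simp add: inj_def)
  qed
  obtain w where w: "\<And>i j. inner (w i) (w j) = (if i = j then 1 else 0 :: real)"
    "\<And>i. inner (S (w i)) (w i) = 1 / \<tau> i"
    using orthonormal_increments[OF linS eig injl u(1)] by blast
  obtain K where K: "\<And>u v. \<bar>t u v\<bar> \<le> norm u * norm v * K" "K > 0"
    using t.pos_bounded by auto
  define \<delta> where "\<delta> = c / K"
  have \<delta>: "\<delta> > 0" using c K by (simp add: \<delta>_def)
  \<comment> \<open>Nonnegativity of \<open>t\<close> at \<open>z - \<delta> *\<^sub>R S z\<close>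
    bounds \<open>t z z\<close> below by the cross term, and
    \<open>t z (S z) = \<beta> (S z) (S z)\<close> is coercive. With \<open>\<delta> = c / K\<close>
    the quadratic remainder costs only half of this gain.\<close>
  have Sn: "\<delta> * c * (norm (S z))\<^sup>2 \<le> t z z" for z
  proof -
    have "0 \<le> t (z - \<delta> *\<^sub>R S z) (z - \<delta> *\<^sub>R S z)" by (rule t_pos)
    also have "\<dots> = t z z - 2 * \<delta> * t z (S z) + \<delta>\<^sup>2 * t (S z) (S z)"
      using t_sym[of "S z" z]
      by (simp add: t.diff_left t.diff_right t.scaleR_left t.scaleR_right power2_eq_square algebra_simps)
    finally have 1: "2 * \<delta> * t z (S z) \<le> t z z + \<delta>\<^sup>2 * t (S z) (S z)" by simp
    have "\<delta>\<^sup>2 * t (S z) (S z) \<le> \<delta>\<^sup>2 * (K * (norm (S z))\<^sup>2)"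
      using K(1)[of "S z" "S z"] by (intro mult_left_mono) (auto simp: power2_eq_square mult_ac)
    also have "\<dots> = \<delta> * c * (norm (S z))\<^sup>2" using K(2) by (simp add: \<delta>_def power2_eq_square)
    finally have 2: "\<delta>\<^sup>2 * t (S z) (S z) \<le> \<delta> * c * (norm (S z))\<^sup>2" .
    have "2 * \<delta> * (c * (norm (S z))\<^sup>2) \<le> 2 * \<delta> * t z (S z)"
      using coer[of "S z"] S[of z "S z"] \<delta> by (intro mult_left_mono) auto
    with 1 2 show ?thesis by (simp add: algebra_simps)
  qed
  have CM: "C + M > 0" using \<tau>[of 0] by linarith
  \<comment> \<open>Every \<open>\<tau> i\<close> is at most \<open>C + M\<close>, so the diagonal
    entries \<open>1 / \<tau> i\<close> stay above \<open>1 / (C + M)\<close>; through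
    \<open>Sn\<close> this bounds \<open>t\<close> from below on the orthonormal vectors.\<close>
  define q where "q = \<delta> * c / (C + M)\<^sup>2"
  have q: "q > 0" using \<delta> c CM by (simp add: q_def)
  have tw: "q \<le> t (w i) (w i)" for i
  proof -
    have "norm (w i) = 1" using w(1)[of i i] by (simp add: norm_eq_sqrt_inner)
    have "1 / (C + M) \<le> 1 / \<tau> i" using \<tau>[of i] by (intro divide_left_mono) auto
    also have "\<dots> \<le> norm (S (w i))"
      using norm_cauchy_schwarz[of "S (w i)" "w i"] w(2)[of i] \<open>norm (w i) = 1\<close> by simp
    finally have "(1 / (C + M))\<^sup>2 \<le> (norm (S (w i)))\<^sup>2" using CM by (intro power_mono) auto
    then have "\<delta> * c * (1 / (C + M))\<^sup>2 \<le> \<delta> * c * (norm (S (w i)))\<^sup>2"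
      using \<delta> c by (intro mult_left_mono) auto
    then show ?thesis using Sn[of "w i"] by (simp add: q_def power_divide)
  qed
  obtain G where G: "finite G" "\<And>u. t u u \<le> q / 2 * (norm u)\<^sup>2 + (\<Sum>g\<in>G. (inner g u)\<^sup>2)"
    using t_compact[of "q / 2"] q by auto
  have lower: "q / 2 \<le> (\<Sum>g\<in>G. (inner g (w i))\<^sup>2)" for i
    using tw[of i] G(2)[of "w i"] w(1)[of i i] by (simp add: power2_norm_eq_inner)
  have "real N * (q / 2) \<le> (\<Sum>g\<in>G. (norm g)\<^sup>2)" for N
  proof -
    have "real N * (q / 2) \<le> (\<Sum>i<N. \<Sum>g\<in>G. (inner g (w i))\<^sup>2)"
      using sum_mono[of "{..<N}" "\<lambda>i. q / 2" "\<lambda>i. \<Sum>g\<in>G. (inner g (w i))\<^sup>2"] lower by simp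
    also have "\<dots> = (\<Sum>g\<in>G. \<Sum>i<N. (inner g (w i))\<^sup>2)" by (rule sum.swap)
    also have "\<dots> \<le> (\<Sum>g\<in>G. (norm g)\<^sup>2)"
      by (intro sum_mono bessel_inequality) (use w(1) in auto)
    finally show ?thesis .
  qed
  moreover obtain N :: nat where "(\<Sum>g\<in>G. (norm g)\<^sup>2) / (q / 2) < real N"
    using reals_Archimedean2 by blast
  ultimately show False using q by (simp add: divide_less_eq not_less[symmetric])
qed

lemma countable_\<Sigma>: "countable \<Sigma>"
proof -
  have "\<Sigma> = (\<Union>n::nat. \<Sigma> \<inter> {- real n..})"
  proof -
    have "\<exists>n::nat. - real n \<le> s" for s :: real
      using real_arch_simple[of "- s"] by (auto simp: minus_le_iff)
    then show ?thesis by auto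
  qed
  also have "countable \<dots>"
    by (intro countable_UN) (auto intro: countable_finite finite_\<Sigma>_above)
  finally show ?thesis .
qed

lemma isolated_\<Sigma>: assumes "\<sigma> \<in> \<Sigma>" shows "\<sigma> isolated_in \<Sigma>"
proof -
  \<comment> \<open>The lower end is \<open>\<sigma> - 1\<close>, written in the form treated by
    \<open>finite_\<Sigma>_above\<close>. Removing the finite set \<open>F\<close> from the
    half-line leaves a neighbourhood that isolates \<open>\<sigma>\<close>.\<close>
  define F where "F = (\<Sigma> \<inter> {- (1 - \<sigma>)..}) - {\<sigma>}"
  have "open ({\<sigma> - 1<..} - F)"
    unfolding F_def by (intro open_Diff finite_imp_closed finite_Diff finite_\<Sigma>_above open_greaterThan)
  moreover have "({\<sigma> - 1<..} - F) \<inter> \<Sigma> = {\<sigma>}" using assms by (auto simp: F_def)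
  ultimately show ?thesis using assms unfolding isolated_in_def by blast
qed

text \<open>Index zero: a trivial kernel of \<open>L \<sigma>\<close> forces a trivial kernel of
  \<open>L' \<sigma>\<close>, and then every functional meets the solvability condition.\<close>

lemma bij_L: assumes "\<sigma> \<notin> \<Sigma>" shows "bij_betw (L \<sigma>) UNIV dual" "T \<in> dual \<Longrightarrow> \<exists>!u. L \<sigma> u = T"
proof -
  have k: "op_kernel (L \<sigma>) = {0}" using assms by (simp add: \<Sigma>_def)
  have "dim (op_kernel (L' \<sigma>)) = 0"
    using fredholm_L(3)[of \<sigma>] finite_dim_dim_eq_0[OF fredholm_L(1), of \<sigma>] k by metis
  then have k': "op_kernel (L' \<sigma>) = {0}" using finite_dim_dim_eq_0[OF fredholm_L(2)] by simp
  have "\<exists>u. L \<sigma> u = T" if "T \<in> dual" for T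
    unfolding fredholm_L(4)[OF that]
  proof (intro allI impI)
    fix u' assume "L' \<sigma> u' = (\<lambda>v. 0)"
    then have "u' = 0" using k' by (auto simp: op_kernel_def)
    then show "T u' = 0" using that by (simp add: dual_def linear_0 bounded_linear.linear)
  qed
  moreover have inj: "inj (L \<sigma>)" 
  proof (rule injI)
    fix u v assume "L \<sigma> u = L \<sigma> v"
    then have "u - v \<in> op_kernel (L \<sigma>)" by (rule L_diff[THEN iffD1])
    then show "u = v" using k by simp
  qed
  moreover have "L \<sigma> u \<in> dual" for u
    using bounded_bilinear.bounded_linear_right[OF bounded_bilinear_L, of \<sigma> u] by (simp add: dual_def)
  ultimately show "bij_betw (L \<sigma>) UNIV dual" unfolding bij_betw_def by (metis image_subset_iff subsetI subset_antisym rangeI)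
  show "\<exists>!u. L \<sigma> u = T" if "T \<in> dual"
    using \<open>\<And>T. T \<in> dual \<Longrightarrow> \<exists>u. L \<sigma> u = T\<close>[OF that] inj by (metis injD)
qed

lemma infinite_solutions:
  assumes "\<sigma> \<in> \<Sigma>"
  shows "{u. L \<sigma> u = T} = {} \<or> infinite {u. L \<sigma> u = T}"
proof (cases "{u. L \<sigma> u = T} = {}")
  case False
  then obtain u where u: "L \<sigma> u = T" by auto
  obtain k where k: "k \<noteq> 0" "k \<in> op_kernel (L \<sigma>)" using assms zero_in_kernel by (auto simp: \<Sigma>_def)
  have "range (\<lambda>r::real. u + r *\<^sub>R k) \<subseteq> {u. L \<sigma> u = T}"
  proof safe
    fix r :: real
    have "r *\<^sub>R k \<in> op_kernel (L \<sigma>)"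
      using k(2) bounded_bilinear.scaleR_left[OF bounded_bilinear_L] by (auto simp: op_kernel_def fun_eq_iff)
    then show "L \<sigma> (u + r *\<^sub>R k) = T" using L_diff[of \<sigma> "u + r *\<^sub>R k" u] u by simp
  qed
  moreover have "inj (\<lambda>r::real. u + r *\<^sub>R k)" using k(1) by (auto intro!: injI)
  then have "infinite (range (\<lambda>r::real. u + r *\<^sub>R k))"
    using finite_imageD infinite_UNIV_char_0 by blast
  ultimately show ?thesis using finite_subset by blast
qed simp

text \<open>The kernels of \<open>L \<sigma>\<close> and \<open>L' \<sigma>\<close> are compared
  through their dimensions: for a nonsymmetric \<open>b\<close> they are in general different
  subspaces, and index zero speaks of dimensions only. The Garding constant \<open>C\<close> serves
  as the upper bound of the spectrum.\<close>

lemma spectrum: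
  "(\<exists>\<sigma>\<^sub>0 :: real. \<exists>\<Sigma> :: real set.
       \<Sigma> \<subseteq> {..<\<sigma>\<^sub>0} \<and> countable \<Sigma> \<and> (\<forall>\<sigma>\<in>\<Sigma>. \<sigma> isolated_in \<Sigma>) \<and>
       (\<forall>\<sigma>. \<sigma> \<notin> \<Sigma> \<longrightarrow>
          bij_betw (L \<sigma>) UNIV dual \<and> (\<forall>T\<in>dual. \<exists>!u. L \<sigma> u = T)) \<and>
       (\<forall>\<sigma>\<in>\<Sigma>. op_kernel (L \<sigma>) \<noteq> {0}) \<and>
       (\<forall>\<sigma>\<in>\<Sigma>.
          finite_dim (op_kernel (L \<sigma>)) \<and> finite_dim (op_kernel (L' \<sigma>)) \<and>
          dim (op_kernel (L \<sigma>)) = dim (op_kernel (L' \<sigma>)) \<and> 0 < dim (op_kernel (L \<sigma>)) \<and>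
          (\<forall>T\<in>dual. {u. L \<sigma> u = T} = {} \<or> infinite {u. L \<sigma> u = T}))) \<and>
    (\<forall>\<sigma>. \<forall>T\<in>dual. (\<exists>u. L \<sigma> u = T) \<longleftrightarrow> (\<forall>u'. L' \<sigma> u' = (\<lambda>v. 0) \<longrightarrow> T u' = 0))"
proof (intro conjI exI[of _ C] exI[of _ \<Sigma>] allI ballI impI)
  fix \<sigma> assume "\<sigma> \<in> \<Sigma>"
  then show "op_kernel (L \<sigma>) \<noteq> {0}" by (simp add: \<Sigma>_def)
  then show "0 < dim (op_kernel (L \<sigma>))" using finite_dim_dim_eq_0[OF fredholm_L(1)] by auto
qed (use \<Sigma>_less countable_\<Sigma> isolated_\<Sigma> bij_L infinite_solutions fredholm_L in auto)

end


section \<open>The fractional gradient of a test function\<close>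

definition gradient :: "(real^'n::finite \<Rightarrow> real) \<Rightarrow> real^'n \<Rightarrow> real^'n" where
  "gradient \<phi> x = (\<chi> i. partial_deriv i \<phi> x)"

lemma frac_grad_1: "frac_grad 1 \<phi> = gradient \<phi>"
  by (simp add: frac_grad_def gradient_def fun_eq_iff)

lemma partial_deriv_linear_combination:
  assumes "\<And>x. \<phi> differentiable (at x)" "\<And>x. \<psi> differentiable (at x)"
  shows "partial_deriv i (\<lambda>x. c * \<phi> x + d * \<psi> x) = (\<lambda>x. c * partial_deriv i \<phi> x + d * partial_deriv i \<psi> x)"
proof
  fix x
  have "((\<lambda>x. c * \<phi> x + d * \<psi> x) has_derivative
      (\<lambda>h. c * frechet_derivative \<phi> (at x) h + d * frechet_derivative \<psi> (at x) h)) (at x)"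
    using assms[of x, unfolded frechet_derivative_works]
    by (rule has_derivative_add[OF has_derivative_mult_right has_derivative_mult_right])
  from fun_cong[OF frechet_derivative_at[OF this], of "axis i 1"]
  show "partial_deriv i (\<lambda>x. c * \<phi> x + d * \<psi> x) x = c * partial_deriv i \<phi> x + d * partial_deriv i \<psi> x"
    unfolding partial_deriv_def by simp
qed

lemma C_k_linear_combination: "C_k k \<phi> \<Longrightarrow> C_k k \<psi> \<Longrightarrow> C_k k (\<lambda>x. c * \<phi> x + d * \<psi> x)"
proof (induction k arbitrary: \<phi> \<psi>)
  case 0 then show ?case by (auto intro!: continuous_intros)
next
  case (Suc k)
  then have d: "\<phi> differentiable (at x)" "\<psi> differentiable (at x)" for x by auto
  have "(\<lambda>x. c * \<phi> x + d * \<psi> x) differentiable (at x)" for x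
    using d[of x] by (intro derivative_intros) auto
  moreover have "C_k k (partial_deriv i (\<lambda>x. c * \<phi> x + d * \<psi> x))" for i
    unfolding partial_deriv_linear_combination[OF d] by (rule Suc.IH) (use Suc.prems in auto)
  ultimately show ?case by auto
qed

lemma test_functions_linear_combination:
  assumes "\<phi> \<in> test_functions S" "\<psi> \<in> test_functions S"
  shows "(\<lambda>x. c * \<phi> x + d * \<psi> x) \<in> test_functions S"
proof -
  let ?K = "closure {x. \<phi> x \<noteq> 0} \<union> closure {x. \<psi> x \<noteq> 0}"
  have K: "compact ?K" "?K \<subseteq> S" using assms by (auto simp: test_functions_def)
  have "{x. c * \<phi> x + d * \<psi> x \<noteq> 0} \<subseteq> ?K"
    using closure_subset[of "{x. \<phi> x \<noteq> 0}"] closure_subset[of "{x. \<psi> x \<noteq> 0}"] by force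
  then have sub: "closure {x. c * \<phi> x + d * \<psi> x \<noteq> 0} \<subseteq> ?K"
    by (rule closure_minimal) (rule compact_imp_closed[OF K(1)])
  then have "?K \<inter> closure {x. c * \<phi> x + d * \<psi> x \<noteq> 0} = closure {x. c * \<phi> x + d * \<psi> x \<noteq> 0}"
    by (rule inf.absorb2)
  then have "compact (closure {x. c * \<phi> x + d * \<psi> x \<noteq> 0})"
    using compact_Int_closed[OF K(1) closed_closure[of "{x. c * \<phi> x + d * \<psi> x \<noteq> 0}"]] by (simp only:)
  moreover have "\<And>k. C_k k (\<lambda>x. c * \<phi> x + d * \<psi> x)"
    using assms by (auto simp: test_functions_def intro: C_k_linear_combination)
  ultimately show ?thesis using sub K(2) by (auto simp: test_functions_def)
qed

lemma test_functions_diff: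
  assumes "\<phi> \<in> test_functions S" "\<psi> \<in> test_functions S"
  shows "(\<lambda>x. \<phi> x - \<psi> x) \<in> test_functions S"
  using test_functions_linear_combination[OF assms, of 1 "-1"] by simp

context
  fixes \<phi> :: "real^'n::finite \<Rightarrow> real" and S
  assumes test: "\<phi> \<in> test_functions S"
begin

lemma test_continuous: "continuous_on UNIV \<phi>"
  using test by (auto simp: test_functions_def dest: spec[of _ 0])

lemma borel_measurable_test: "\<phi> \<in> borel_measurable borel"
  using test_continuous by (rule borel_measurable_continuous_onI)

lemma test_differentiable: "\<phi> differentiable (at x)"
proof -
  have "C_k (Suc 0) \<phi>" using test unfolding test_functions_def by blast
  then show ?thesis by simp
qed

lemma test_has_derivative: "(\<phi> has_derivative (\<lambda>h. gradient \<phi> x \<bullet> h)) (at x)"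
proof -
  let ?f = "frechet_derivative \<phi> (at x)"
  have d: "(\<phi> has_derivative ?f) (at x)"
    using test_differentiable by (simp add: frechet_derivative_works)
  then have lin: "linear ?f" by (rule has_derivative_linear)
  have "?f h = gradient \<phi> x \<bullet> h" for h
  proof -
    have "?f h = ?f (\<Sum>i\<in>UNIV. h $ i *\<^sub>R axis i 1)"
      using basis_expansion[of h] by (simp add: scalar_mult_eq_scaleR)
    also have "\<dots> = (\<Sum>i\<in>UNIV. h $ i * ?f (axis i 1))"
      by (simp add: linear_sum[OF lin] linear_scale[OF lin])
    also have "\<dots> = gradient \<phi> x \<bullet> h"
      by (simp add: gradient_def inner_vec_def partial_deriv_def mult.commute)
    finally show ?thesis .
  qed
  then have "?f = (\<lambda>h. gradient \<phi> x \<bullet> h)" by auto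
  with d show ?thesis by simp
qed

lemma gradient_continuous: "continuous_on UNIV (gradient \<phi>)"
proof -
  have "C_k (Suc 0) \<phi>" using test unfolding test_functions_def by blast
  then have "\<And>i. continuous_on UNIV (partial_deriv i \<phi>)" by simp
  then show ?thesis unfolding gradient_def[abs_def] by (intro continuous_intros) auto
qed

lemma test_outside: "x \<notin> S \<Longrightarrow> \<phi> x = 0"
  using test closure_subset[of "{x. \<phi> x \<noteq> 0}"] by (auto simp: test_functions_def)

lemma gradient_zero_outside:
  assumes "x \<notin> closure {x. \<phi> x \<noteq> 0}" shows "gradient \<phi> x = 0"
proof -
  let ?U = "- closure {x. \<phi> x \<noteq> 0}"
  have "\<phi> y = 0" if "y \<in> ?U" for y using that closure_subset[of "{x. \<phi> x \<noteq> 0}"] by auto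
  note zero = this
  have "((\<lambda>x. 0) has_derivative (\<lambda>h. gradient \<phi> x \<bullet> h)) (at x)"
  proof (rule has_derivative_transform_within_open[OF test_has_derivative])
    show "open ?U" by (rule open_Compl) (rule closed_closure)
    show "x \<in> ?U" using assms by simp
  qed (rule zero)
  then have "(\<lambda>h. gradient \<phi> x \<bullet> h) = (\<lambda>h. 0)"
    by (rule has_derivative_unique) (rule has_derivative_const)
  then have "gradient \<phi> x \<bullet> gradient \<phi> x = 0" by (rule fun_cong)
  then show ?thesis by simp
qed

lemma gradient_outside: "x \<notin> S \<Longrightarrow> gradient \<phi> x = 0"
  using gradient_zero_outside test by (auto simp: test_functions_def)

text \<open>The Lipschitz constant \<open>L\<close> tames the fractional kernel at the origin, the
  radius \<open>R\<close> at infinity, and \<open>M\<close> bounds the truncated integrals.\<close>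

lemma test_bounds:
  obtains R L M where "R > 0" "L > 0" "M > 0" "\<And>x. R \<le> norm x \<Longrightarrow> \<phi> x = 0" "\<And>x. R \<le> norm x \<Longrightarrow> gradient \<phi> x = 0"
    "\<And>x. norm (gradient \<phi> x) \<le> L" "\<And>x y. \<bar>\<phi> x - \<phi> y\<bar> \<le> L * norm (x - y)" "\<And>x. \<bar>\<phi> x\<bar> \<le> M"
proof -
  let ?K = "closure {x. \<phi> x \<noteq> 0}"
  have K: "compact ?K" using test by (auto simp: test_functions_def)
  obtain R where R: "R > 0" "\<And>x. x \<in> ?K \<Longrightarrow> norm x < R"
    using compact_imp_bounded[OF K] unfolding bounded_pos_less by blast
  have z: "\<phi> x = 0" "gradient \<phi> x = 0" if "x \<notin> ?K" for x
    using gradient_zero_outside[OF that] that closure_subset[of "{x. \<phi> x \<noteq> 0}"] by auto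
  have "bounded (gradient \<phi> ` ?K)" "bounded (\<phi> ` ?K)"
    using K gradient_continuous test_continuous
    by (auto intro!: compact_imp_bounded compact_continuous_image intro: continuous_on_subset)
  then obtain L M where L: "L > 0" "\<And>x. x \<in> ?K \<Longrightarrow> norm (gradient \<phi> x) \<le> L"
    and M: "M > 0" "\<And>x. x \<in> ?K \<Longrightarrow> norm (\<phi> x) \<le> M"
    unfolding bounded_pos by (metis imageI)
  have L': "norm (gradient \<phi> x) \<le> L" for x using L z[of x] by (cases "x \<in> ?K") auto
  have M': "\<bar>\<phi> x\<bar> \<le> M" for x using M z[of x] by (cases "x \<in> ?K") auto
  have "\<bar>\<phi> x - \<phi> y\<bar> \<le> L * norm (x - y)" for x y
  proof -
    have "onorm (\<lambda>h. gradient \<phi> x \<bullet> h) \<le> L" for x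
    proof (rule onorm_le)
      fix h show "norm (gradient \<phi> x \<bullet> h) \<le> L * norm h"
        using order_trans[OF Cauchy_Schwarz_ineq2 mult_right_mono[OF L' norm_ge_zero]] by simp
    qed
    then show ?thesis
      using differentiable_bound[of UNIV \<phi> "\<lambda>x h. gradient \<phi> x \<bullet> h" L x y] test_has_derivative by simp
  qed
  then show ?thesis using that[OF R(1) L(1) M(1)] z R(2) L' M' by (metis not_less)
qed

end

section \<open>The principal value as an absolutely convergent integral\<close>

lemma lborel_distr_uminus_euclidean: "distr lborel borel uminus = (lborel :: 'a::euclidean_space measure)"
  by (subst (2) lborel_affine[of "-1" 0]) (auto simp: density_1)

lemma lborel_integral_uminus:
  fixes f :: "'a::euclidean_space \<Rightarrow> 'b::{banach, second_countable_topology}"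
  assumes [measurable]: "f \<in> borel_measurable borel"
  shows "(LINT x|lborel. f (- x)) = (LINT x|lborel. f x)"
    "integrable lborel (\<lambda>x. f (- x)) \<longleftrightarrow> integrable lborel f"
proof -
  have m: "uminus \<in> lborel \<rightarrow>\<^sub>M (borel :: 'a measure)" by simp
  show "(LINT x|lborel. f (- x)) = (LINT x|lborel. f x)"
    using integral_distr[OF m, of f] by (simp add: lborel_distr_uminus_euclidean)
  show "integrable lborel (\<lambda>x. f (- x)) \<longleftrightarrow> integrable lborel f"
    using integrable_distr_eq[OF m, of f] by (simp add: lborel_distr_uminus_euclidean)
qed

text \<open>Dyadic shells: the shell of radius \<open>2\<^sup>-\<^sup>k \<rho>\<close> contributes at most a multiple of \<open>2 powr (- k (n - a))\<close>.\<close>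

lemma integrable_norm_powr_ball:
  fixes a \<rho> :: real
  assumes a: "0 \<le> a" "a < real DIM('a)" and \<rho>: "\<rho> > 0"
  shows "integrable lborel (\<lambda>z::'a::euclidean_space. indicator (ball 0 \<rho>) z * norm z powr (- a))"
proof (rule integrableI_bounded)
  let ?n = "real DIM('a)"
  define r where "r k = \<rho> * (1/2) ^ k" for k
  have r: "r k > 0" for k using \<rho> by (simp add: r_def)
  have le: "ennreal (norm (indicator (ball 0 \<rho>) z * norm z powr (- a)))
      \<le> (\<Sum>k. ennreal (r (Suc k) powr (- a)) * indicator (ball 0 (r k)) z)" for z :: 'a
  \<comment> \<open>At the origin \<open>0 powr (- a)\<close> is 0, so only the punctured ball has
    to be covered by shells.\<close>
  proof (cases "z \<in> ball 0 \<rho> \<and> z \<noteq> 0")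
    case True
    then have z: "0 < norm z" "norm z < \<rho>" by auto
    obtain k where "(1/2) ^ k < norm z / \<rho>"
      using real_arch_pow_inv[of "norm z / \<rho>" "1/2"] z(1) \<rho> by auto
    then have ex: "\<exists>k. r k \<le> norm z"
      using \<rho> by (intro exI[of _ k]) (simp add: r_def field_simps)
    \<comment> \<open>\<open>r 0\<close> is \<open>\<rho>\<close>, hence \<open>m\<close> is
      positive and \<open>z\<close> lies in the shell between \<open>r m\<close> and
      \<open>r (m - 1)\<close>.\<close>
    define m where "m = (LEAST k. r k \<le> norm z)"
    have m: "r m \<le> norm z" unfolding m_def by (rule LeastI_ex[OF ex])
    have "m \<noteq> 0" using m z(2) by (auto simp: r_def intro: ccontr)
    then obtain k where k: "m = Suc k" using not0_implies_Suc by blast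
    have "norm z < r k" using not_less_Least[of k "\<lambda>k. r k \<le> norm z"] k by (simp add: m_def[symmetric])
    have "norm z powr (- a) \<le> r (Suc k) powr (- a)"
      using m k a r[of "Suc k"] by (intro powr_mono2') auto
    then have "ennreal (norm (indicator (ball 0 \<rho>) z * norm z powr (- a)))
        \<le> ennreal (r (Suc k) powr (- a)) * indicator (ball 0 (r k)) z"
      using z \<open>norm z < r k\<close> by (simp add: ennreal_leI)
    also have "\<dots> \<le> (\<Sum>k. ennreal (r (Suc k) powr (- a)) * indicator (ball 0 (r k)) z)"
      using sum_le_suminf[OF summableI, of "{k}" "\<lambda>k. ennreal (r (Suc k) powr (- a)) * indicator (ball 0 (r k)) z"]
      by (simp only: sum.insert sum.empty finite.intros empty_iff add_0_right not_False_eq_True zero_le subset_UNIV)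
    finally show ?thesis .
  qed auto
  let ?V = "unit_ball_vol ?n"
  define q where "q = (1/2::real) powr (?n - a)"
  have q: "0 < q" "q < 1" using a by (auto simp: q_def powr_def mult_pos_neg)
  define K where "K = (\<rho>/2) powr (- a) * ?V * \<rho> ^ DIM('a)"
  have K: "K \<ge> 0" using \<rho> by (simp add: K_def)
  have eq: "r (Suc k) powr (- a) * (?V * r k ^ DIM('a)) = K * q ^ k" for k
  proof -
    have 1: "r (Suc k) powr (- a) = (\<rho>/2) powr (- a) * ((1/2) ^ k) powr (- a)"
      unfolding r_def using \<rho> by (subst powr_mult[symmetric]) (auto simp: mult_ac)
    have 2: "q ^ k = ((1/2) ^ k) powr (- a) * ((1/2) ^ k) ^ DIM('a)"
    proof -
      have "q ^ k = q powr real k" using q by (simp add: powr_realpow)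
      also have "\<dots> = (1/2) powr (real k * ?n + real k * (- a))"
        unfolding q_def powr_powr by (simp add: algebra_simps)
      also have "\<dots> = ((1/2) powr real k) powr ?n * ((1/2) powr real k) powr (- a)"
        unfolding powr_powr by (rule powr_add)
      also have "\<dots> = ((1/2) ^ k) powr ?n * ((1/2) ^ k) powr (- a)"
        by (simp only: powr_realpow zero_less_divide_1_iff zero_less_numeral)
      also have "((1/2::real) ^ k) powr ?n = ((1/2) ^ k) ^ DIM('a)" by (rule powr_realpow) simp
      finally show ?thesis by (simp add: mult.commute)
    qed
    show ?thesis unfolding 1 2 K_def by (simp add: r_def power_mult_distrib mult_ac)
  qed
  have "(\<integral>\<^sup>+z. ennreal (norm (indicator (ball 0 \<rho>) z * norm z powr (- a))) \<partial>(lborel :: 'a measure))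
      \<le> (\<integral>\<^sup>+z. (\<Sum>k. ennreal (r (Suc k) powr (- a)) * indicator (ball 0 (r k)) z) \<partial>(lborel :: 'a measure))"
    by (rule nn_integral_mono) (rule le)
  also have "\<dots> = (\<Sum>k. \<integral>\<^sup>+z. ennreal (r (Suc k) powr (- a)) * indicator (ball 0 (r k)) z \<partial>(lborel :: 'a measure))"
  proof (rule nn_integral_suminf)
    show "(\<lambda>z::'a. ennreal (r (Suc k) powr (- a)) * indicator (ball 0 (r k)) z) \<in> borel_measurable lborel" for k
      by (intro borel_measurable_times_ennreal borel_measurable_const borel_measurable_indicator, simp)
  qed
  also have "\<dots> = (\<Sum>k. ennreal (K * q ^ k))"
  proof (intro suminf_cong)
    fix k
    have "(\<integral>\<^sup>+z. ennreal (r (Suc k) powr (- a)) * indicator (ball 0 (r k)) z \<partial>(lborel :: 'a measure))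
      = ennreal (r (Suc k) powr (- a)) * emeasure lborel (ball (0::'a) (r k))"
      by (simp add: nn_integral_cmult_indicator)
    also have "\<dots> = ennreal (r (Suc k) powr (- a) * (?V * r k ^ DIM('a)))"
      using r[of k] by (subst emeasure_ball) (auto simp: ennreal_mult)
    finally show "(\<integral>\<^sup>+z. ennreal (r (Suc k) powr (- a)) * indicator (ball 0 (r k)) z \<partial>(lborel :: 'a measure))
      = ennreal (K * q ^ k)" by (simp only: eq)
  qed
  also have "\<dots> = ennreal (\<Sum>k. K * q ^ k)"
    using K q by (intro suminf_ennreal2 summable_mult summable_geometric) auto
  also have "\<dots> < \<infinity>" by simp
  finally show "(\<integral>\<^sup>+z. ennreal (norm (indicator (ball 0 \<rho>) z * norm z powr (- a))) \<partial>(lborel :: 'a measure)) < \<infinity>" .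
  have [measurable]: "(\<lambda>z::'a. indicator (ball 0 \<rho>) z :: real) \<in> borel_measurable lborel"
    by (rule borel_measurable_indicator) simp
  show "(\<lambda>z::'a. indicator (ball 0 \<rho>) z * norm z powr (- a)) \<in> borel_measurable lborel"
    by measurable
qed

text \<open>Symmetrising in \<open>z\<close> removes the principal value: for a Lipschitz function the singularity of
  this integrand is integrable.\<close>

definition sym_integrand :: "real \<Rightarrow> (real^'n::finite \<Rightarrow> real) \<Rightarrow> real^'n \<Rightarrow> real^'n \<Rightarrow> real^'n" where
  "sym_integrand s \<phi> x z = ((\<phi> (x + z) - \<phi> (x - z)) / 2 / norm z powr (real CARD('n) + s + 1)) *\<^sub>R z"

context
  fixes \<phi> :: "real^'n::finite \<Rightarrow> real" and S and s :: real
  assumes test: "\<phi> \<in> test_functions S" and s: "0 < s" "s < 1"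
begin

text \<open>The Lipschitz bound yields one power of \<open>norm z\<close> and the factor
  \<open>z\<close> another. What remains has order \<open>- (n + s - 1)\<close> in dimension n,
  which is integrable at the origin because \<open>s < 1\<close>; compact support takes care of
  infinity.\<close>

lemma integrable_sym_integrand: "integrable lborel (sym_integrand s \<phi> x)"
proof -
  note [measurable] = borel_measurable_test[OF test]
  obtain R L M where R: "R > 0" "\<And>x. R \<le> norm x \<Longrightarrow> \<phi> x = 0"
    and L: "L > 0" "\<And>x y. \<bar>\<phi> x - \<phi> y\<bar> \<le> L * norm (x - y)"
    using test_bounds[OF test] by metis
  let ?n = "real CARD('n)"
  \<comment> \<open>For \<open>norm z\<close> beyond this radius, \<open>\<phi>\<close> vanishes at
    both \<open>x + z\<close> and \<open>x - z\<close>.\<close>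
  define \<rho> where "\<rho> = R + norm x"
  have "\<rho> > 0" using R norm_ge_zero[of x] by (simp add: \<rho>_def add_pos_nonneg)
  have "integrable lborel (\<lambda>z::real^'n. indicator (ball 0 \<rho>) z * norm z powr (- (?n + s - 1)))"
    using s \<open>\<rho> > 0\<close> by (intro integrable_norm_powr_ball) (auto simp: Suc_leI add_increasing2)
  then have "integrable lborel (\<lambda>z::real^'n. L * (indicator (ball 0 \<rho>) z * norm z powr (- (?n + s - 1))))"
    by (rule integrable_mult_right)
  then show ?thesis
  proof (rule Bochner_Integration.integrable_bound)
    show "sym_integrand s \<phi> x \<in> borel_measurable lborel" unfolding sym_integrand_def by measurable
    show "AE z in lborel. norm (sym_integrand s \<phi> x z)
        \<le> norm (L * (indicator (ball 0 \<rho>) z * norm z powr (- (?n + s - 1))))"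
    proof (intro AE_I2)
      fix z :: "real^'n"
      show "norm (sym_integrand s \<phi> x z) \<le> norm (L * (indicator (ball 0 \<rho>) z * norm z powr (- (?n + s - 1))))"
      proof (cases "z \<in> ball 0 \<rho> \<and> z \<noteq> 0")
        case False
        then have "z = 0 \<or> \<rho> \<le> norm z" by auto
        then have "\<phi> (x + z) - \<phi> (x - z) = 0"
        proof
          assume "\<rho> \<le> norm z"
          moreover have "norm z \<le> norm (x + z) + norm x" "norm z \<le> norm (x - z) + norm x"
            using norm_triangle_ineq4[of "x + z" x] norm_triangle_ineq4[of x "x - z"] by auto
          ultimately show ?thesis using R(2)[of "x + z"] R(2)[of "x - z"] by (simp add: \<rho>_def)
        qed simp
        then show ?thesis by (simp add: sym_integrand_def)
      next
        case True
        then have z: "norm z > 0" "norm z < \<rho>" by auto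
        have "\<bar>\<phi> (x + z) - \<phi> (x - z)\<bar> \<le> L * norm ((x + z) - (x - z))" by (rule L(2))
        also have "(x + z) - (x - z) = 2 *\<^sub>R z" by (simp add: scaleR_2)
        finally have "\<bar>\<phi> (x + z) - \<phi> (x - z)\<bar> / 2 \<le> L * norm z" by simp
        then have "\<bar>\<phi> (x + z) - \<phi> (x - z)\<bar> / 2 * norm z / norm z powr (?n + s + 1)
            \<le> L * norm z * norm z / norm z powr (?n + s + 1)"
          by (intro divide_right_mono mult_right_mono) auto
        moreover have "norm (sym_integrand s \<phi> x z)
            = \<bar>\<phi> (x + z) - \<phi> (x - z)\<bar> / 2 * norm z / norm z powr (?n + s + 1)"
          by (simp add: sym_integrand_def)
        moreover have "norm z powr (- (?n + s - 1)) = norm z * norm z / norm z powr (?n + s + 1)"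
        proof -
          have "- (?n + s - 1) = 2 - (?n + s + 1)" by simp
          then have "norm z powr (- (?n + s - 1)) = norm z powr (2 - (?n + s + 1))" by (simp only:)
          also have "\<dots> = norm z powr 2 / norm z powr (?n + s + 1)" by (rule powr_diff)
          finally show ?thesis using z by (simp add: power2_eq_square)
        qed
        ultimately show ?thesis
          using z L(1) by (simp add: mult.assoc)
      qed
    qed
  qed
qed

text \<open>The truncated domain is invariant under reflection, so the integrand may be averaged
  with its reflected copy. Cutting off the origin makes the two halves integrable
  separately.\<close>

lemma truncated_integral:
  assumes "\<epsilon> > 0"
  shows "(LINT z:{z. \<epsilon> \<le> norm z}|lebesgue. (\<phi> (x + z) / norm z powr (real CARD('n) + s + 1)) *\<^sub>R z)
    = (LINT z:{z. \<epsilon> \<le> norm z}|lborel. sym_integrand s \<phi> x z)"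
proof -
  note [measurable] = borel_measurable_test[OF test]
  let ?p = "real CARD('n) + s + 1"
  define F where "F z = indicator {z. \<epsilon> \<le> norm z} z *\<^sub>R ((\<phi> (x + z) / norm z powr ?p) *\<^sub>R z)" for z
  have F[measurable]: "F \<in> borel_measurable borel" unfolding F_def by measurable
  obtain R L M where R: "R > 0" "\<And>x. R \<le> norm x \<Longrightarrow> \<phi> x = 0" and M: "M > 0" "\<And>x. \<bar>\<phi> x\<bar> \<le> M"
    using test_bounds[OF test] by metis
  define \<rho> where "\<rho> = R + norm x"
  have "\<rho> > 0" using R norm_ge_zero[of x] by (simp add: \<rho>_def add_pos_nonneg)
  have int: "integrable lborel F"
  proof (rule Bochner_Integration.integrable_bound)
    show "integrable lborel (\<lambda>z::real^'n. indicator (ball 0 \<rho>) z * (M / \<epsilon> powr ?p * \<rho>))"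
      by (intro integrable_mult_left integrable_real_indicator)
         (use emeasure_bounded_finite[OF bounded_ball[of "0 :: real^'n" \<rho>]] in simp_all)
    show "AE z in lborel. norm (F z) \<le> norm (indicator (ball 0 \<rho>) z * (M / \<epsilon> powr ?p * \<rho>))"
    proof (intro AE_I2)
      fix z :: "real^'n"
      show "norm (F z) \<le> norm (indicator (ball 0 \<rho>) z * (M / \<epsilon> powr ?p * \<rho>))"
      proof (cases "\<epsilon> \<le> norm z \<and> norm z < \<rho>")
        case False
        have "F z = 0"
        proof (cases "\<epsilon> \<le> norm z")
          case True
          then have "\<rho> \<le> norm z" using False by auto
          moreover have "norm z \<le> norm (x + z) + norm x"
            using norm_triangle_ineq4[of "x + z" x] by auto
          ultimately show ?thesis using R(2)[of "x + z"] by (simp add: \<rho>_def F_def)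
        qed (simp add: F_def)
        then show ?thesis by simp
      next
        case True
        then have "norm (F z) = \<bar>\<phi> (x + z)\<bar> / norm z powr ?p * norm z" by (simp add: F_def)
        also have "\<dots> \<le> M / \<epsilon> powr ?p * \<rho>"
          using True assms s M by (intro mult_mono frac_le powr_mono2) auto
        finally show ?thesis using True assms M(1) \<open>\<rho> > 0\<close> by (simp add: abs_mult)
      qed
    qed
  qed simp
  have "(LINT z:{z. \<epsilon> \<le> norm z}|lebesgue. (\<phi> (x + z) / norm z powr ?p) *\<^sub>R z) = (LINT z|lebesgue. F z)"
    by (simp add: set_lebesgue_integral_def F_def)
  also have "\<dots> = (LINT z|lborel. F z)" by (rule integral_completion) simp
  also have "\<dots> = (1/2) *\<^sub>R ((LINT z|lborel. F z) + (LINT z|lborel. F (- z)))"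
    unfolding lborel_integral_uminus(1)[OF F] by (simp add: scaleR_2[symmetric])
  also have "(LINT z|lborel. F z) + (LINT z|lborel. F (- z)) = (LINT z|lborel. F z + F (- z))"
    using int lborel_integral_uminus(2)[OF F] by simp
  also have "(1/2) *\<^sub>R (LINT z|lborel. F z + F (- z)) = (LINT z|lborel. (1/2) *\<^sub>R (F z + F (- z)))"
    by simp
  also have "\<dots> = (LINT z:{z. \<epsilon> \<le> norm z}|lborel. sym_integrand s \<phi> x z)"
    unfolding set_lebesgue_integral_def
    by (intro Bochner_Integration.integral_cong)
       (auto simp: F_def sym_integrand_def indicator_def diff_divide_distrib scaleR_left_diff_distrib scaleR_diff_right)
  finally show ?thesis .
qed

lemma truncated_integral_tendsto:
  "((\<lambda>\<epsilon>. LINT z:{z. \<epsilon> \<le> norm z}|lebesgue. (\<phi> (x + z) / norm z powr (real CARD('n) + s + 1)) *\<^sub>R z)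
    \<longlongrightarrow> (LINT z|lborel. sym_integrand s \<phi> x z)) (at_right 0)"
  unfolding tendsto_at_iff_sequentially comp_def
proof (intro allI impI)
  fix X :: "nat \<Rightarrow> real" assume X: "\<forall>i. X i \<in> {0<..} - {0}" "X \<longlonglongrightarrow> 0"
  note [measurable] = borel_measurable_test[OF test]
  have m: "sym_integrand s \<phi> x \<in> borel_measurable lborel" unfolding sym_integrand_def by measurable
  have "(\<lambda>i. LINT z|lborel. indicator {z. X i \<le> norm z} z *\<^sub>R sym_integrand s \<phi> x z)
      \<longlonglongrightarrow> (LINT z|lborel. sym_integrand s \<phi> x z)"
  proof (rule integral_dominated_convergence[where w="\<lambda>z. norm (sym_integrand s \<phi> x z)"])
    show "integrable lborel (\<lambda>z. norm (sym_integrand s \<phi> x z))"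
      by (intro integrable_norm integrable_sym_integrand)
    show "AE z in lborel. (\<lambda>i. indicator {z. X i \<le> norm z} z *\<^sub>R sym_integrand s \<phi> x z) \<longlonglongrightarrow> sym_integrand s \<phi> x z"
    proof (intro AE_I2)
      fix z :: "real^'n"
      show "(\<lambda>i. indicator {z. X i \<le> norm z} z *\<^sub>R sym_integrand s \<phi> x z) \<longlonglongrightarrow> sym_integrand s \<phi> x z"
      proof (cases "z = 0")
        case False
        then have "eventually (\<lambda>i. X i < norm z) sequentially"
          using X(2) by (intro order_tendstoD) auto
        then have "eventually (\<lambda>i. indicator {z. X i \<le> norm z} z *\<^sub>R sym_integrand s \<phi> x z = sym_integrand s \<phi> x z) sequentially"
          by eventually_elim auto
        then show ?thesis by (rule tendsto_eventually)
      qed (simp add: sym_integrand_def)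
    qed
  qed (use m in \<open>auto simp: indicator_def\<close>)
  then show "(\<lambda>i. LINT z:{z. X i \<le> norm z}|lebesgue. (\<phi> (x + z) / norm z powr (real CARD('n) + s + 1)) *\<^sub>R z)
      \<longlonglongrightarrow> (LINT z|lborel. sym_integrand s \<phi> x z)"
    using X(1) by (subst truncated_integral) (auto simp: set_lebesgue_integral_def)
qed

lemma frac_grad_eq: "frac_grad s \<phi> x = frac_const TYPE('n) s *\<^sub>R (LINT z|lborel. sym_integrand s \<phi> x z)"
  using s tendsto_Lim[OF _ truncated_integral_tendsto[of x]] by (simp add: frac_grad_def)

end

section \<open>Linearity and joint measurability of the fractional gradient\<close>

lemma gradient_linear_combination:
  assumes "\<phi> \<in> test_functions S" "\<psi> \<in> test_functions S"
  shows "gradient (\<lambda>x. c * \<phi> x + d * \<psi> x) x = c *\<^sub>R gradient \<phi> x + d *\<^sub>R gradient \<psi> x"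
  by (simp add: gradient_def vec_eq_iff partial_deriv_linear_combination[OF test_differentiable[OF assms(1)] test_differentiable[OF assms(2)]])

lemma frac_grad_linear_combination:
  assumes "\<phi> \<in> test_functions S" "\<psi> \<in> test_functions S" "s \<in> {0<..1}"
  shows "frac_grad s (\<lambda>x. c * \<phi> x + d * \<psi> x) x = c *\<^sub>R frac_grad s \<phi> x + d *\<^sub>R frac_grad s \<psi> x"
proof (cases "s = 1")
  case True then show ?thesis by (simp add: frac_grad_1 gradient_linear_combination[OF assms(1,2)])
next
  case False
  then have s: "0 < s" "s < 1" using assms(3) by auto
  have "sym_integrand s (\<lambda>x. c * \<phi> x + d * \<psi> x) x = (\<lambda>z. c *\<^sub>R sym_integrand s \<phi> x z + d *\<^sub>R sym_integrand s \<psi> x z)"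
    unfolding sym_integrand_def scaleR_scaleR scaleR_left_distrib[symmetric]
    by (simp add: diff_divide_distrib add_divide_distrib algebra_simps fun_eq_iff)
  then show ?thesis
    unfolding frac_grad_eq[OF assms(1) s] frac_grad_eq[OF assms(2) s]
      frac_grad_eq[OF test_functions_linear_combination[OF assms(1,2)] s]
    using integrable_sym_integrand[OF assms(1) s, of x] integrable_sym_integrand[OF assms(2) s, of x]
    by (simp add: scaleR_add_right mult.commute)
qed

lemma frac_grad_diff:
  assumes "\<phi> \<in> test_functions S" "\<psi> \<in> test_functions S" "s \<in> {0<..1}"
  shows "frac_grad s (\<lambda>x. \<phi> x - \<psi> x) x = frac_grad s \<phi> x - frac_grad s \<psi> x"
  using frac_grad_linear_combination[OF assms, of 1 "-1"] by simp

text \<open>The cut-off keeps the arguments of \<open>Gamma\<close> positive; \<open>s = 1\<close>,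
  where the denominator has a pole, is a separate case of \<open>frac_grad\<close>.\<close>

lemma borel_measurable_frac_const:
  "(\<lambda>s. indicator {0<..<1} s * frac_const TYPE('n::finite) s) \<in> borel_measurable borel"
proof -
  have "continuous_on {0<..<1} (frac_const TYPE('n))"
    unfolding frac_const_def[abs_def]
  proof (intro continuous_intros continuous_on_compose2[OF continuous_on_Gamma[where A="{0<..}"]])
    show "{0<..} \<inter> \<int>\<^sub>\<le>\<^sub>0 = ({} :: real set)" by (auto elim!: nonpos_Ints_cases)
    show "\<forall>x\<in>{0<..<1}. Gamma ((1 - x) / 2) \<noteq> (0::real)"
    proof
      fix x :: real assume "x \<in> {0<..<1}"
      then have "Gamma ((1 - x) / 2) > 0" by (intro Gamma_real_pos) auto
      then show "Gamma ((1 - x) / 2) \<noteq> 0" by simp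
    qed
  qed (auto intro: add_pos_pos)
  from borel_measurable_continuous_on_indicator[OF _ this] show ?thesis by simp
qed

text \<open>The principal value in the definition is a pointwise limit for fixed \<open>s\<close>
  and \<open>x\<close>. Joint measurability comes from its form as a parameter integral for
  \<open>s < 1\<close>, to which the slice \<open>s = 1\<close> is added.\<close>

lemma borel_measurable_frac_grad:
  fixes \<phi> :: "real^'n::finite \<Rightarrow> real"
  assumes test: "\<phi> \<in> test_functions S"
  shows "(\<lambda>(s, x). indicator {0<..1} s *\<^sub>R frac_grad s \<phi> x) \<in> borel_measurable (borel \<Otimes>\<^sub>M borel)"
proof -
  note [measurable] = borel_measurable_test[OF test] borel_measurable_continuous_onI[OF gradient_continuous[OF test]]
    borel_measurable_frac_const[where 'n='n]
  have [measurable]: "(\<lambda>p. LINT z|lborel. sym_integrand (fst p) \<phi> (snd p) z) \<in> borel_measurable (borel \<Otimes>\<^sub>M borel)"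
    unfolding sym_integrand_def by measurable
  have "(\<lambda>p. indicator {1} (fst p) *\<^sub>R gradient \<phi> (snd p) +
      (indicator {0<..<1} (fst p) * frac_const TYPE('n) (fst p)) *\<^sub>R (LINT z|lborel. sym_integrand (fst p) \<phi> (snd p) z))
      \<in> borel_measurable (borel \<Otimes>\<^sub>M borel)" (is "?f \<in> _") by measurable
  moreover have "?f = (\<lambda>(s, x). indicator {0<..1} s *\<^sub>R frac_grad s \<phi> x)"
  proof (intro ext, clarify)
    fix s :: real and x :: "real^'n"
    show "?f (s, x) = indicator {0<..1} s *\<^sub>R frac_grad s \<phi> x"
      by (auto simp: indicator_def frac_grad_1 frac_grad_eq[OF test])
  qed
  ultimately show ?thesis by simp
qed


section \<open>A lower bound for the fractional gradients of a bump function\<close>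

text \<open>The powers of \<open>1 / u\<close> are the factors that differentiation of the flat
  function \<open>exp (- (1 / u))\<close> produces, so derivatives remain in the span of this
  family.\<close>

definition bump :: "nat \<Rightarrow> real \<Rightarrow> real" where
  "bump m u = (if u > 0 then (1 / u) ^ m * exp (- (1 / u)) else 0)"

lemma bump_tendsto_0: "(bump m \<longlongrightarrow> 0) (at 0)"
proof (rule filterlim_split_at)
  have "eventually (\<lambda>u. bump m u = 0) (at_left 0)"
    by (auto simp: bump_def eventually_at_left_field intro!: exI[of _ "-1"])
  then show "(bump m \<longlongrightarrow> 0) (at_left 0)" by (rule tendsto_eventually)
  have "((\<lambda>u::real. (inverse u) ^ m / exp (inverse u)) \<longlongrightarrow> 0) (at_right 0)"
    by (rule filterlim_compose[OF tendsto_power_div_exp_0 filterlim_inverse_at_top_right])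
  moreover have "eventually (\<lambda>u. (inverse u) ^ m / exp (inverse u) = bump m u) (at_right 0)"
    by (auto simp: bump_def eventually_at_right_field exp_minus divide_inverse intro!: exI[of _ 1])
  ultimately show "(bump m \<longlongrightarrow> 0) (at_right 0)" by (rule Lim_transform_eventually)
qed

lemma bump_has_derivative:
  "(bump m has_real_derivative (bump (m + 2) u - real m * bump (m + 1) u)) (at u)"
proof -
  consider "u > 0" | "u < 0" | "u = 0" by linarith
  then show ?thesis
  proof cases
    case 1
    have "((\<lambda>u. (1 / u) ^ m * exp (- (1 / u))) has_real_derivative
        (bump (m + 2) u - real m * bump (m + 1) u)) (at u)"
      using 1 by (auto intro!: derivative_eq_intros simp: bump_def power2_eq_square)
        (cases m; simp add: field_simps)
    then show ?thesis
      by (rule has_field_derivative_transform_within_open[where S="{0<..}"]) (use 1 in \<open>auto simp: bump_def\<close>)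
  next
    case 2
    have "((\<lambda>u. 0) has_real_derivative (bump (m + 2) u - real m * bump (m + 1) u)) (at u)"
      using 2 by (auto simp: bump_def)
    then show ?thesis
      by (rule has_field_derivative_transform_within_open[where S="{..<0}"]) (use 2 in \<open>auto simp: bump_def\<close>)
  next
    case 3
    \<comment> \<open>At the origin the difference quotient of a bump is the bump with the next
      power, which tends to 0.\<close>
    have "(\<lambda>h. (bump m (0 + h) - bump m 0) / h) = bump (m + 1)"
      by (auto simp: fun_eq_iff bump_def)
    then show ?thesis unfolding DERIV_def 3 using bump_tendsto_0[of "m + 1"] by (simp add: bump_def)
  qed
qed

lemma partial_deriv_eq: "(g has_derivative g') (at x) \<Longrightarrow> partial_deriv i g x = g' (axis i 1)"
  using frechet_derivative_at[of g g' x] by (simp add: partial_deriv_def)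

text \<open>Polynomials times radial bumps. The class is stable under partial derivatives, so
  smoothness of all orders follows from one induction.\<close>

inductive_set bump_class :: "real^'n::finite \<Rightarrow> real \<Rightarrow> (real^'n \<Rightarrow> real) set" for x0 r where
  base: "(\<lambda>x. bump m (r\<^sup>2 - (norm (x - x0))\<^sup>2)) \<in> bump_class x0 r"
| coord: "g \<in> bump_class x0 r \<Longrightarrow> (\<lambda>x. (x - x0) $ i * g x) \<in> bump_class x0 r"
| lin: "g \<in> bump_class x0 r \<Longrightarrow> h \<in> bump_class x0 r \<Longrightarrow> (\<lambda>x. c * g x + d * h x) \<in> bump_class x0 r"

lemma has_derivative_bump_norm:
  "((\<lambda>x. bump m (r\<^sup>2 - (norm (x - x0))\<^sup>2)) has_derivative
    (\<lambda>h. (bump (m + 2) (r\<^sup>2 - (norm (x - x0))\<^sup>2) - real m * bump (m + 1) (r\<^sup>2 - (norm (x - x0))\<^sup>2)) * (- 2 * ((x - x0) \<bullet> h)))) (at x)"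
  for x x0 :: "'a::real_inner"
proof -
  have 1: "((\<lambda>x. r\<^sup>2 - (norm (x - x0))\<^sup>2) has_derivative (\<lambda>h. - 2 * ((x - x0) \<bullet> h))) (at x)"
    unfolding power2_norm_eq_inner
    by (auto intro!: derivative_eq_intros simp: inner_commute)
  have "(bump m has_derivative (\<lambda>h. (bump (m + 2) u - real m * bump (m + 1) u) * h)) (at u)" for u
    using bump_has_derivative[of m u] by (simp add: has_field_derivative_def)
  from diff_chain_at[OF 1 this] show ?thesis by (simp add: o_def)
qed

lemma bump_class_derivative:
  assumes "g \<in> bump_class x0 r"
  shows "(\<forall>x. g differentiable (at x)) \<and> (\<forall>i. partial_deriv i g \<in> bump_class x0 r)"
  using assms
proof induction
  case (base m)
  have eq: "partial_deriv i (\<lambda>x. bump m (r\<^sup>2 - (norm (x - x0))\<^sup>2))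
    = (\<lambda>x. (x - x0) $ i * ((- 2) * bump (m + 2) (r\<^sup>2 - (norm (x - x0))\<^sup>2) + (2 * real m) * bump (m + 1) (r\<^sup>2 - (norm (x - x0))\<^sup>2)))" for i
    by (intro ext) (simp add: partial_deriv_eq[OF has_derivative_bump_norm] inner_axis algebra_simps)
  then show ?case
  proof (intro conjI allI)
    show "(\<lambda>x. bump m (r\<^sup>2 - (norm (x - x0))\<^sup>2)) differentiable at x" for x
      using has_derivative_bump_norm unfolding differentiable_def by blast
    show "partial_deriv i (\<lambda>x. bump m (r\<^sup>2 - (norm (x - x0))\<^sup>2)) \<in> bump_class x0 r" for i
      unfolding eq by (intro bump_class.coord bump_class.lin bump_class.base)
  qed
next
  case (coord g i)
  have d: "((\<lambda>x. (x - x0) $ i * g x) has_derivative (\<lambda>h. (x - x0) $ i * frechet_derivative g (at x) h + h $ i * g x)) (at x)" for x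
  proof -
    have "(g has_derivative frechet_derivative g (at x)) (at x)"
      using coord.IH by (simp add: frechet_derivative_works)
    moreover have "((\<lambda>x. x $ i - x0 $ i) has_derivative (\<lambda>h. h $ i - 0)) (at x)"
      by (intro has_derivative_diff has_derivative_const bounded_linear_imp_has_derivative bounded_linear_vec_nth)
    then have "((\<lambda>x. (x - x0) $ i) has_derivative (\<lambda>h. h $ i)) (at x)" by simp
    ultimately show ?thesis by (rule has_derivative_mult[rotated])
  qed
  have "partial_deriv j (\<lambda>x. (x - x0) $ i * g x)
      = (\<lambda>x. 1 * ((x - x0) $ i * partial_deriv j g x) + (if j = i then 1 else 0) * g x)" for j
    unfolding partial_deriv_eq[OF d, abs_def] by (intro ext) (simp add: partial_deriv_def axis_def)
  then have "partial_deriv j (\<lambda>x. (x - x0) $ i * g x) \<in> bump_class x0 r" for j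
    using bump_class.lin[OF bump_class.coord[of "partial_deriv j g" x0 r i] coord.hyps, of 1 "if j = i then 1 else 0"] coord.IH
    by simp
  then show ?case using d by (auto simp: differentiable_def)
next
  case (lin g h c d)
  have gd: "g differentiable (at x)" "h differentiable (at x)" for x using lin.IH by auto
  have "(\<lambda>x. c * g x + d * h x) differentiable (at x)" for x
    using differentiable_add[OF differentiable_mult[OF differentiable_const gd(1)] differentiable_mult[OF differentiable_const gd(2)]] by simp
  moreover have "partial_deriv i (\<lambda>x. c * g x + d * h x) \<in> bump_class x0 r" for i
    unfolding partial_deriv_linear_combination[OF gd] using lin.IH by (intro bump_class.lin) auto
  ultimately show ?case by auto
qed

lemma bump_class_C_k: "g \<in> bump_class x0 r \<Longrightarrow> C_k k g"
proof (induction k arbitrary: g)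
  case 0
  then have "g differentiable (at x)" for x using bump_class_derivative by blast
  then show ?case by (auto intro!: continuous_at_imp_continuous_on differentiable_imp_continuous_within)
next
  case (Suc k)
  then show ?case using bump_class_derivative[OF Suc.prems] by auto
qed

lemma bump_test_function:
  assumes "0 < r" "cball x0 r \<subseteq> S"
  shows "(\<lambda>x. bump 0 (r\<^sup>2 - (norm (x - x0))\<^sup>2)) \<in> test_functions S"
proof -
  let ?X = "{x. bump 0 (r\<^sup>2 - (norm (x - x0))\<^sup>2) \<noteq> 0}"
  have "?X \<subseteq> cball x0 r"
  proof
    fix x assume "x \<in> ?X"
    then have "(norm (x - x0))\<^sup>2 < r\<^sup>2" by (auto simp: bump_def split: if_splits)
    then have "norm (x - x0) < r" using assms(1) by (simp add: power_less_imp_less_base)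
    then show "x \<in> cball x0 r" by (simp add: dist_norm norm_minus_commute)
  qed
  then have sub: "closure ?X \<subseteq> cball x0 r" by (rule closure_minimal) simp
  then have "compact (closure ?X)"
    using bounded_subset[OF bounded_cball sub] by (simp only: compact_eq_bounded_closed closed_closure)
  then show ?thesis
    using order_trans[OF sub assms(2)] bump_class_C_k[OF bump_class.base[of 0 r x0]]
    by (simp add: test_functions_def)
qed

section \<open>Lower bounds uniform in the order of the gradient\<close>

lemma frac_const_lower_bound:
  obtains c where "c > 0" "\<And>s. 0 < s \<Longrightarrow> s < 1 \<Longrightarrow> c * (1 - s) \<le> frac_const TYPE('n::finite) s"
proof -
  \<comment> \<open>The functional equation of \<open>Gamma\<close> turns the pole of the
    denominator at \<open>s = 1\<close> into the factor \<open>1 - s\<close>; the remaining quotient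
    \<open>F\<close> is continuous and positive up to the endpoints.\<close>
  define F where "F s = 2 powr s * pi powr (- real CARD('n) / 2) * Gamma ((real CARD('n) + s + 1) / 2)
       / (2 * Gamma ((1 - s) / 2 + 1))" for s :: real
  have G: "{0<..} \<inter> \<int>\<^sub>\<le>\<^sub>0 = ({} :: real set)" by (auto elim!: nonpos_Ints_cases)
  have pos: "Gamma ((1 - s) / 2 + 1) > 0" "F s > 0" if "s \<in> {0..1}" for s :: real
  proof -
    show *: "Gamma ((1 - s) / 2 + 1) > 0" using that by (intro Gamma_real_pos add_nonneg_pos) auto
    have "Gamma ((real CARD('n) + s + 1) / 2) > 0" using that by (intro Gamma_real_pos) auto
    then show "F s > 0" using * unfolding F_def by (intro divide_pos_pos mult_pos_pos) auto
  qed
  have "continuous_on {0..1} F"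
    unfolding F_def
  proof (intro continuous_intros continuous_on_compose2[OF continuous_on_Gamma[OF G]])
    show "\<forall>x\<in>{0..1}. 2 * Gamma ((1 - x) / 2 + 1) \<noteq> (0::real)" using pos by (auto simp: less_le)
  qed (auto intro: add_pos_nonneg add_nonneg_pos)
  then obtain s0 where s0: "s0 \<in> {0..1}" "\<And>s. s \<in> {0..1} \<Longrightarrow> F s0 \<le> F s"
    using continuous_attains_inf[of "{0..1::real}" F] by auto
  have "F s0 * (1 - s) \<le> frac_const TYPE('n) s" if "0 < s" "s < 1" for s
  proof -
    have "Gamma ((1 - s) / 2 + 1) = (1 - s) / 2 * Gamma ((1 - s) / 2)"
      using that by (intro Gamma_plus1) (auto elim!: nonpos_Ints_cases)
    moreover have "Gamma ((1 - s) / 2) > 0" using that by (intro Gamma_real_pos) auto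
    moreover have "N / G = N / (2 * ((1 - s) / 2 * G)) * (1 - s)" if "G > 0" for N G :: real
      using that \<open>s < 1\<close> by simp
    ultimately have "frac_const TYPE('n) s = F s * (1 - s)"
      unfolding F_def frac_const_def by metis
    then show ?thesis using s0(2)[of s] that by (simp add: mult_right_mono)
  qed
  then show ?thesis using that pos(2)[OF s0(1)] by blast
qed

text \<open>The bounds below blow up like \<open>1 / (1 - s)\<close>, which compensates the decay of the constant in
  the fractional gradient.\<close>

lemma dyadic_lower_bound:
  fixes y :: "'a::euclidean_space" and F :: "'a \<Rightarrow> real"
  assumes y: "y \<noteq> 0" and \<rho>: "0 < \<rho>" "\<rho> \<le> 1" and s: "0 < s" "s < 1" and k0: "k0 \<ge> 0"
    and int: "integrable lborel F" and F0: "\<And>z. 0 \<le> F z"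
    and F: "\<And>z. z \<noteq> 0 \<Longrightarrow> norm z < \<rho> \<Longrightarrow> k0 * (y \<bullet> z)\<^sup>2 / norm z powr (real DIM('a) + s + 1) \<le> F z"
  shows "k0 * (25/64) * unit_ball_vol (real DIM('a)) * (1/8) ^ DIM('a) * \<rho> * (norm y)\<^sup>2 \<le> (1 - s) * (LINT z|lborel. F z)"
proof -
  let ?n = "DIM('a)" and ?p = "real DIM('a) + s + 1" and ?V = "unit_ball_vol (real DIM('a))"
  define r where "r k = \<rho> * (1/2) ^ k" for k :: nat
  have r: "0 < r k" "r k \<le> \<rho>" for k using \<rho> by (auto simp: r_def power_le_one)
  \<comment> \<open>Balls around the point at distance \<open>3/4 * r k\<close> in direction
    \<open>y\<close>: they fit between the radii \<open>5/8 * r k\<close> and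
    \<open>7/8 * r k\<close>, are disjoint for different \<open>k\<close>, and keep
    \<open>y \<bullet> z\<close> comparable to \<open>norm y * r k\<close>.\<close>
  define W where "W k = ball ((3/4 * r k / norm y) *\<^sub>R y) (r k / 8)" for k
  have ny: "norm y > 0" using y by simp
  have W: "5/8 * r k < norm z" "norm z < 7/8 * r k" "norm y * (5/8 * r k) \<le> y \<bullet> z" if "z \<in> W k" for z k
  proof -
    define e where "e = z - (3/4 * r k / norm y) *\<^sub>R y"
    have e: "norm e < r k / 8" using that by (simp add: W_def e_def dist_norm norm_minus_commute)
    have z: "z = (3/4 * r k / norm y) *\<^sub>R y + e" by (simp add: e_def)
    have n: "norm ((3/4 * r k / norm y) *\<^sub>R y) = 3/4 * r k" using r(1)[of k] ny by simp
    show "5/8 * r k < norm z" using norm_diff_ineq[of "(3/4 * r k / norm y) *\<^sub>R y" e] e n unfolding z[symmetric] by linarith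
    show "norm z < 7/8 * r k" using norm_triangle_ineq[of "(3/4 * r k / norm y) *\<^sub>R y" e] e n unfolding z[symmetric] by linarith
    have "\<bar>y \<bullet> e\<bar> \<le> norm y * norm e" by (rule Cauchy_Schwarz_ineq2)
    also have "\<dots> \<le> norm y * (r k / 8)" using e by (intro mult_left_mono) auto
    finally have "- (norm y * (r k / 8)) \<le> y \<bullet> e" by linarith
    moreover have "y \<bullet> z = norm y * (3/4 * r k) + y \<bullet> e"
      using ny by (simp add: z inner_add_right power2_norm_eq_inner[symmetric] power2_eq_square)
    ultimately show "norm y * (5/8 * r k) \<le> y \<bullet> z" by (simp add: algebra_simps)
  qed
  have disj: "W i \<inter> W j = {}" if "i < j" for i j
  proof -
    have "r j \<le> r (Suc i)" unfolding r_def using that \<rho> by (intro mult_left_mono power_decreasing) auto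
    then have "r j \<le> r i / 2" by (simp add: r_def)
    then show ?thesis using W(1,2)[of _ i] W(1,2)[of _ j] r(1)[of i] by fastforce
  qed
  define q where "q = (1/2::real) powr (1 - s)"
  have q: "0 < q" "q < 1" using s by (auto simp: q_def powr_def mult_pos_neg)
  \<comment> \<open>25/64 is the square of the factor 5/8 in the lower bound of
    \<open>y \<bullet> z\<close>; the power of 1/8 comes from the radius of the balls
    \<open>W k\<close>.\<close>
  define K where "K = k0 * (25/64) * ?V * (1/8) ^ ?n * \<rho> * (norm y)\<^sup>2"
  have K: "K \<ge> 0" using k0 \<rho> by (simp add: K_def)
  define h where "h k = k0 * (norm y * (5/8 * r k))\<^sup>2 / r k powr ?p" for k
  have Fh: "h k \<le> F z" if z: "z \<in> W k" for k z
  proof -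
    have nz: "norm z < r k" "norm z > 0" using W[OF z] r(1)[of k] by linarith+
    have "h k \<le> k0 * (y \<bullet> z)\<^sup>2 / norm z powr ?p"
      unfolding h_def using nz W(3)[OF z] k0 ny r(1)[of k] s
      by (intro frac_le mult_left_mono power_mono powr_mono2) auto
    also have "\<dots> \<le> F z" using nz r(2)[of k] by (intro F) auto
    finally show ?thesis .
  qed
  have hm: "K * q ^ k \<le> h k * measure lborel (W k)" for k
  proof -
    have 1: "measure lborel (W k) = ?V * (r k / 8) ^ ?n"
      unfolding W_def using r(1)[of k] by (simp add: content_ball)
    have 2: "r k powr (1 - s) = (r k)\<^sup>2 * (r k) ^ ?n / r k powr ?p"
    proof -
      have "1 - s = 2 + real ?n - ?p" by simp
      then have "r k powr (1 - s) = r k powr (2 + real ?n - ?p)" by (simp only:)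
      also have "\<dots> = r k powr 2 * r k powr real ?n / r k powr ?p" by (simp only: powr_diff powr_add)
      finally show ?thesis using r(1)[of k] by (simp add: powr_realpow)
    qed
    have 3: "\<rho> * q ^ k \<le> r k powr (1 - s)"
    proof -
      have "\<rho> powr 1 \<le> \<rho> powr (1 - s)" using \<rho> s by (intro powr_mono') auto
      then have "\<rho> \<le> \<rho> powr (1 - s)" using \<rho> by simp
      moreover have "q ^ k = ((1/2) ^ k) powr (1 - s)"
      proof -
        have "q ^ k = q powr real k" using q by (simp add: powr_realpow)
        also have "\<dots> = ((1/2) powr real k) powr (1 - s)" unfolding q_def powr_powr by (simp add: mult.commute)
        also have "(1/2::real) powr real k = (1/2) ^ k" by (rule powr_realpow) simp
        finally show ?thesis .
      qed
      moreover have "r k powr (1 - s) = \<rho> powr (1 - s) * ((1/2) ^ k) powr (1 - s)"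
        unfolding r_def using \<rho> by (simp add: powr_mult)
      ultimately show ?thesis by (simp add: mult_right_mono)
    qed
    have "K * q ^ k = (k0 * (25/64) * ?V * (1/8) ^ ?n * (norm y)\<^sup>2) * (\<rho> * q ^ k)" by (simp add: K_def)
    also have "\<dots> \<le> (k0 * (25/64) * ?V * (1/8) ^ ?n * (norm y)\<^sup>2) * r k powr (1 - s)"
      using 3 k0 by (intro mult_left_mono) auto
    also have "\<dots> = h k * measure lborel (W k)"
      unfolding 1 2 h_def by (simp add: power_mult_distrib power_divide field_simps)
    finally show ?thesis .
  qed
  have mW: "emeasure lborel (W k) < \<infinity>" for k unfolding W_def by (intro emeasure_bounded_finite bounded_ball)
  have part: "(\<Sum>k<N. K * q ^ k) \<le> (LINT z|lborel. F z)" for N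
  proof -
    have "(\<Sum>k<N. K * q ^ k) \<le> (\<Sum>k<N. h k * measure lborel (W k))" by (intro sum_mono hm)
    also have "\<dots> = (\<Sum>k<N. LINT z|lborel. h k * indicator (W k) z)"
      using mW by (intro sum.cong) (auto simp: W_def)
    also have "\<dots> = (LINT z|lborel. (\<Sum>k<N. h k * indicator (W k) z))"
      using mW by (intro Bochner_Integration.integral_sum[symmetric] integrable_mult_right integrable_real_indicator) (auto simp: W_def)
    also have "\<dots> \<le> (LINT z|lborel. F z)"
    proof (rule integral_mono)
      show "integrable lborel (\<lambda>z. \<Sum>k<N. h k * indicator (W k) z)"
        using mW by (intro Bochner_Integration.integrable_sum integrable_mult_right integrable_real_indicator) (auto simp: W_def)
      show "integrable lborel F" by fact
      fix z :: 'a
      show "(\<Sum>k<N. h k * indicator (W k) z) \<le> F z"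
      proof (cases "\<exists>k<N. z \<in> W k")
        case True
        then obtain k where k: "k < N" "z \<in> W k" by auto
        have "z \<notin> W j" if "j \<noteq> k" for j using k(2) disj[of j k] disj[of k j] that by (cases "j < k") auto
        then have "(\<Sum>j<N. h j * indicator (W j) z) = (\<Sum>j<N. if j = k then h k else 0)"
          using k by (intro sum.cong) auto
        then show ?thesis using Fh[OF k(2)] k(1) by simp
      next
        case False
        then have "(\<Sum>k<N. h k * indicator (W k) z) = 0" by (intro sum.neutral) auto
        then show ?thesis using F0 by simp
      qed
    qed
    finally show ?thesis .
  qed
  have "(\<lambda>k. K * q ^ k) sums (K * (1 / (1 - q)))" using q by (intro sums_mult geometric_sums) auto
  then have "(\<lambda>N. \<Sum>k<N. K * q ^ k) \<longlonglongrightarrow> K * (1 / (1 - q))" by (simp add: sums_def)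
  then have lim: "K / (1 - q) \<le> (LINT z|lborel. F z)" using part by (auto intro: LIMSEQ_le_const2)
  \<comment> \<open>\<open>q\<close> is \<open>2 powr (- (1 - s))\<close> and
    \<open>ln 2 < 1\<close>. The geometric sum \<open>1 / (1 - q)\<close> is therefore at least
    \<open>1 / (1 - s)\<close>, which is the source of the blow-up.\<close>
  have "1 - q \<le> 1 - s"
  proof -
    define l where "l = ln (1/2::real)"
    have "1 + (1 - s) * l \<le> q" unfolding q_def powr_def l_def using exp_ge_add_one_self[of "(1 - s) * ln (1/2)"] by simp
    moreover have "l \<ge> - 1" using ln_2_less_1 by (simp add: ln_div l_def)
    then have "(1 - s) * l \<ge> (1 - s) * (- 1)" using s by (intro mult_left_mono) auto
    ultimately show ?thesis by simp
  qed
  then have "(1 - q) * (LINT z|lborel. F z) \<le> (1 - s) * (LINT z|lborel. F z)"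
    using F0 by (intro mult_right_mono) auto
  moreover have "K \<le> (1 - q) * (LINT z|lborel. F z)" using lim q by (simp add: field_simps)
  ultimately show ?thesis unfolding K_def by linarith
qed


lemma bump_0_mono: "u \<le> v \<Longrightarrow> bump 0 u \<le> bump 0 v"
  by (auto simp: bump_def frac_le)

text \<open>Mean value theorem with derivative \<open>bump 2\<close>. That function is not monotone,
  so its factors are estimated at different ends: the power at \<open>w\<close>, the exponential at
  \<open>u0\<close>.\<close>

lemma bump_0_growth:
  assumes "0 < u0" "u0 \<le> u" "u \<le> v" "v \<le> w"
  shows "bump 2 u0 * (u0 / w)\<^sup>2 * (v - u) \<le> bump 0 v - bump 0 u"
proof (cases "u = v")
  case False
  then have "u < v" using assms by simp
  then obtain z where z: "u < z" "z < v" "bump 0 v - bump 0 u = (v - u) * bump 2 z"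
    using MVT2[of u v "bump 0" "\<lambda>u. bump 2 u"] bump_has_derivative[of 0] by (auto simp: numeral_2_eq_2)
  have "bump 2 u0 * (u0 / w)\<^sup>2 = (1 / w)\<^sup>2 * exp (- (1 / u0))"
    using assms by (simp add: bump_def power_divide)
  also have "\<dots> \<le> (1 / z)\<^sup>2 * exp (- (1 / z))"
    using assms z by (intro mult_mono power_mono) (auto simp: frac_le)
  also have "\<dots> = bump 2 z" using assms z by (simp add: bump_def)
  finally show ?thesis using \<open>u < v\<close> by (simp add: z mult.commute)
qed simp

text \<open>As the bump function is radially decreasing, the integrand of \<open>- (x - x0) \<bullet> D\<^sup>s \<phi> x\<close> is
  nonnegative, so that no cancellation occurs in the integral.\<close>

lemma frac_grad_bump_lower_bound:
  fixes x0 :: "real^'n::finite"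
  assumes r: "0 < r" "r \<le> 1"
  obtains \<kappa> where "\<kappa> > 0"
    "\<And>s x. s \<in> {0<..1} \<Longrightarrow> norm (x - x0) \<le> r / 2
      \<Longrightarrow> \<kappa> * norm (x - x0) \<le> norm (frac_grad s (\<lambda>x. bump 0 (r\<^sup>2 - (norm (x - x0))\<^sup>2)) x)"
proof -
  define \<phi> where "\<phi> x = bump 0 (r\<^sup>2 - (norm (x - x0))\<^sup>2)" for x
  have test: "\<phi> \<in> test_functions UNIV" unfolding \<phi>_def by (rule bump_test_function[OF r(1)]) simp
  \<comment> \<open>If \<open>norm (x - x0) \<le> r / 2\<close> and \<open>norm z < r / 4\<close>,
    the displaced points lie within \<open>3/4 * r\<close> of \<open>x0\<close>, and
    \<open>r\<^sup>2 - (3/4 * r)\<^sup>2\<close> is this value.\<close>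
  define u0 where "u0 = 7 / 16 * r\<^sup>2"
  have u0: "u0 > 0" using r by (simp add: u0_def)
  define k0 where "k0 = bump 2 u0 * (u0 / r\<^sup>2)\<^sup>2"
  have k0: "k0 > 0" using u0 r by (simp add: k0_def bump_def)
  define \<rho> where "\<rho> = r / 4"
  have \<rho>: "0 < \<rho>" "\<rho> \<le> 1" using r by (auto simp: \<rho>_def)
  have expand: "(norm (y + z))\<^sup>2 = (norm y)\<^sup>2 + 2 * (y \<bullet> z) + (norm z)\<^sup>2"
    "(norm (y - z))\<^sup>2 = (norm y)\<^sup>2 - 2 * (y \<bullet> z) + (norm z)\<^sup>2" for y z :: "real^'n"
    by (simp_all add: power2_norm_eq_inner inner_add_left inner_add_right inner_diff_left inner_diff_right inner_commute[of z y])
  have phi: "\<phi> (x + z) = bump 0 (r\<^sup>2 - (norm (x - x0 + z))\<^sup>2)" "\<phi> (x - z) = bump 0 (r\<^sup>2 - (norm (x - x0 - z))\<^sup>2)" for x z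
    by (simp_all add: \<phi>_def algebra_simps)
  have sign: "0 \<le> ((x - x0) \<bullet> z) * (\<phi> (x - z) - \<phi> (x + z))" for x z
  proof (cases "(x - x0) \<bullet> z \<ge> 0")
    case True
    then have "\<phi> (x + z) \<le> \<phi> (x - z)" unfolding phi by (intro bump_0_mono) (simp add: expand)
    with True show ?thesis by simp
  next
    case False
    then have "\<phi> (x - z) \<le> \<phi> (x + z)" unfolding phi by (intro bump_0_mono) (simp add: expand)
    with False show ?thesis by (intro mult_nonpos_nonpos) auto
  qed
  have near: "4 * k0 * ((x - x0) \<bullet> z)\<^sup>2 \<le> ((x - x0) \<bullet> z) * (\<phi> (x - z) - \<phi> (x + z))"
    if x: "norm (x - x0) \<le> r / 2" and z: "norm z < \<rho>" for x z
  proof -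
    have *: "u0 \<le> r\<^sup>2 - (norm (x - x0 + w))\<^sup>2" if "norm w < \<rho>" for w
    proof -
      have "norm (x - x0 + w) \<le> 3 / 4 * r"
        using norm_triangle_ineq[of "x - x0" w] x that by (simp add: \<rho>_def)
      then have "(norm (x - x0 + w))\<^sup>2 \<le> (3 / 4 * r)\<^sup>2" by (intro power_mono) auto
      then show ?thesis by (simp add: u0_def power_mult_distrib power2_eq_square)
    qed
    have lo: "u0 \<le> r\<^sup>2 - (norm (x - x0 + z))\<^sup>2" "u0 \<le> r\<^sup>2 - (norm (x - x0 - z))\<^sup>2"
      using *[of z] *[of "- z"] z by auto
    have d: "(r\<^sup>2 - (norm (x - x0 - z))\<^sup>2) - (r\<^sup>2 - (norm (x - x0 + z))\<^sup>2) = 4 * ((x - x0) \<bullet> z)"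
      by (simp add: expand)
    show ?thesis
    proof (cases "(x - x0) \<bullet> z \<ge> 0")
      case True
      have "k0 * (4 * ((x - x0) \<bullet> z)) \<le> \<phi> (x - z) - \<phi> (x + z)"
        unfolding phi k0_def d[symmetric] by (rule bump_0_growth[OF u0 lo(1)]) (use True d in linarith, simp)
      from mult_left_mono[OF this True] show ?thesis by (simp add: power2_eq_square mult_ac)
    next
      case False
      have d': "(r\<^sup>2 - (norm (x - x0 + z))\<^sup>2) - (r\<^sup>2 - (norm (x - x0 - z))\<^sup>2) = 4 * - ((x - x0) \<bullet> z)"
        using d by linarith
      have "k0 * (4 * - ((x - x0) \<bullet> z)) \<le> \<phi> (x + z) - \<phi> (x - z)"
        unfolding phi k0_def d'[symmetric] by (rule bump_0_growth[OF u0 lo(2)]) (use False d in linarith, simp)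
      from mult_left_mono[OF this, of "- ((x - x0) \<bullet> z)"] False show ?thesis
        by (simp add: power2_eq_square algebra_simps)
    qed
  qed
  obtain c where c: "c > 0" "\<And>s. 0 < s \<Longrightarrow> s < 1 \<Longrightarrow> c * (1 - s) \<le> frac_const TYPE('n) s"
    using frac_const_lower_bound[where 'n='n] by blast
  define K where "K = 2 * k0 * (25/64) * unit_ball_vol (real CARD('n)) * (1/8) ^ CARD('n) * \<rho>"
  have K: "K > 0" using k0 \<rho> by (simp add: K_def)
  \<comment> \<open>The first entry serves the fractional orders, where the factor
    \<open>1 - s\<close> of the constant cancels against the dyadic bound; the second serves the
    classical gradient.\<close>
  define \<kappa> where "\<kappa> = min (c * K) (2 * k0)"
  have \<kappa>: "\<kappa> > 0" using c(1) K k0 by (simp add: \<kappa>_def)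
  have "\<kappa> * norm (x - x0) \<le> norm (frac_grad s \<phi> x)"
    if s: "s \<in> {0<..1}" and x: "norm (x - x0) \<le> r / 2" for s x
  proof (cases "x = x0")
    case False
    define y where "y = x - x0"
    have y: "y \<noteq> 0" using False by (simp add: y_def)
    have main: "\<kappa> * (norm y)\<^sup>2 \<le> - (y \<bullet> frac_grad s \<phi> x)"
    proof (cases "s = 1")
      case True
      have "((\<lambda>x. \<phi> x) has_derivative
        (\<lambda>h. (bump 2 (r\<^sup>2 - (norm (x - x0))\<^sup>2) - real 0 * bump 1 (r\<^sup>2 - (norm (x - x0))\<^sup>2)) * (- 2 * ((x - x0) \<bullet> h)))) (at x)"
        unfolding \<phi>_def using has_derivative_bump_norm[of 0 r x0 x] by (simp add: numeral_2_eq_2)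
      from has_derivative_unique[OF this test_has_derivative[OF test]]
      have "gradient \<phi> x \<bullet> y = - 2 * bump 2 (r\<^sup>2 - (norm y)\<^sup>2) * (norm y)\<^sup>2"
        by (auto dest: fun_cong[of _ _ y] simp: y_def power2_norm_eq_inner)
      moreover have "k0 \<le> bump 2 (r\<^sup>2 - (norm y)\<^sup>2)"
      proof -
        have "(norm y)\<^sup>2 \<le> (r / 2)\<^sup>2" using x by (intro power_mono) (auto simp: y_def)
        also have "(r / 2)\<^sup>2 = r\<^sup>2 / 4" by (simp add: power_divide)
        finally have v: "u0 \<le> r\<^sup>2 - (norm y)\<^sup>2" using zero_le_power2[of r] unfolding u0_def by linarith
        have "k0 = (1 / r\<^sup>2)\<^sup>2 * exp (- (1 / u0))"
          using u0 r by (simp add: k0_def bump_def power_divide)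
        also have "\<dots> \<le> (1 / (r\<^sup>2 - (norm y)\<^sup>2))\<^sup>2 * exp (- (1 / (r\<^sup>2 - (norm y)\<^sup>2)))"
          using u0 v by (intro mult_mono power_mono) (auto simp: frac_le)
        also have "\<dots> = bump 2 (r\<^sup>2 - (norm y)\<^sup>2)" using u0 v by (simp add: bump_def)
        finally show ?thesis .
      qed
      then have "2 * k0 * (norm y)\<^sup>2 \<le> 2 * bump 2 (r\<^sup>2 - (norm y)\<^sup>2) * (norm y)\<^sup>2"
        by (intro mult_right_mono) auto
      moreover have "\<kappa> * (norm y)\<^sup>2 \<le> 2 * k0 * (norm y)\<^sup>2" by (intro mult_right_mono) (auto simp: \<kappa>_def)
      ultimately show ?thesis using True by (simp add: frac_grad_1 inner_commute)
    next
      case False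
      then have s': "0 < s" "s < 1" using s by auto
      define F where "F z = - (y \<bullet> sym_integrand s \<phi> x z)" for z
      have F: "F z = (y \<bullet> z) * (\<phi> (x - z) - \<phi> (x + z)) / 2 / norm z powr (real CARD('n) + s + 1)" for z
        by (simp add: F_def sym_integrand_def diff_divide_distrib algebra_simps)
      have int: "integrable lborel F"
        unfolding F_def by (intro integrable_minus integrable_inner_right integrable_sym_integrand[OF test s'])
      have "2 * k0 * (25/64) * unit_ball_vol (real DIM(real^'n)) * (1/8) ^ DIM(real^'n) * \<rho> * (norm y)\<^sup>2
          \<le> (1 - s) * (LINT z|lborel. F z)"
      proof (rule dyadic_lower_bound[OF y \<rho> s' _ int])
        show "0 \<le> F z" for z unfolding F y_def using sign[of x z] by simp
        show "2 * k0 * (y \<bullet> z)\<^sup>2 / norm z powr (real DIM(real^'n) + s + 1) \<le> F z" if "norm z < \<rho>" for z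
        proof -
          have "2 * k0 * (y \<bullet> z)\<^sup>2 \<le> (y \<bullet> z) * (\<phi> (x - z) - \<phi> (x + z)) / 2"
            unfolding y_def using near[OF x that] by simp
          then show ?thesis unfolding F by (simp only: DIM_cart DIM_real mult_1_right) (rule divide_right_mono, auto)
        qed
      qed (use k0 in simp)
      then have 1: "K * (norm y)\<^sup>2 \<le> (1 - s) * (LINT z|lborel. F z)" by (simp add: K_def)
      have F0: "0 \<le> (LINT z|lborel. F z)"
        by (intro Bochner_Integration.integral_nonneg) (use sign[of x] in \<open>simp add: F y_def\<close>)
      have "- (y \<bullet> frac_grad s \<phi> x) = frac_const TYPE('n) s * (LINT z|lborel. F z)"
        unfolding frac_grad_eq[OF test s'] F_def
        using integral_inner_right[OF integrable_sym_integrand[OF test s', of x], of y] by simp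
      also have "\<dots> \<ge> c * (1 - s) * (LINT z|lborel. F z)"
        using c(2)[OF s'] F0 by (intro mult_right_mono) auto
      finally have "c * (1 - s) * (LINT z|lborel. F z) \<le> - (y \<bullet> frac_grad s \<phi> x)" .
      moreover have "c * (K * (norm y)\<^sup>2) \<le> c * ((1 - s) * (LINT z|lborel. F z))"
        using 1 c(1) by (intro mult_left_mono) auto
      moreover have "\<kappa> * (norm y)\<^sup>2 \<le> c * K * (norm y)\<^sup>2" by (intro mult_right_mono) (auto simp: \<kappa>_def)
      ultimately show ?thesis by (simp add: mult.assoc)
    qed
    also have "\<dots> \<le> norm y * norm (frac_grad s \<phi> x)"
      using Cauchy_Schwarz_ineq2[of y "frac_grad s \<phi> x"] by linarith
    finally have "norm y * (\<kappa> * norm y) \<le> norm y * norm (frac_grad s \<phi> x)"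
      by (simp add: power2_eq_square mult_ac)
    then show ?thesis using y by (simp add: y_def[symmetric])
  qed simp
  then show ?thesis using that \<kappa> unfolding \<phi>_def by blast
qed


section \<open>Poincare and Rellich inequalities\<close>

lemma nn_integral_lborel_shift:
  fixes f :: "'a::euclidean_space \<Rightarrow> ennreal"
  assumes [measurable]: "f \<in> borel_measurable borel"
  shows "(\<integral>\<^sup>+x. f (c + x) \<partial>lborel) = (\<integral>\<^sup>+x. f x \<partial>lborel)"
proof -
  have "(\<integral>\<^sup>+x. f x \<partial>lborel) = (\<integral>\<^sup>+x. f x \<partial>(distr lborel borel ((+) c)))"
    by (simp add: lborel_distr_plus)
  also have "\<dots> = (\<integral>\<^sup>+x. f (c + x) \<partial>lborel)" by (rule nn_integral_distr) simp_all
  finally show ?thesis by simp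
qed

context
  fixes \<phi> :: "real^'n::finite \<Rightarrow> real" and S
  assumes test: "\<phi> \<in> test_functions S"
begin

lemma borel_measurable_gradient: "gradient \<phi> \<in> borel_measurable borel"
  using gradient_continuous[OF test] by (rule borel_measurable_continuous_onI)

lemma integrable_test: "integrable lborel \<phi>" "integrable lborel (\<lambda>x. norm (gradient \<phi> x))"
proof -
  note [measurable] = borel_measurable_test[OF test] borel_measurable_gradient
  obtain R L M where R: "\<And>x. R \<le> norm x \<Longrightarrow> \<phi> x = 0" "\<And>x. R \<le> norm x \<Longrightarrow> gradient \<phi> x = 0"
    and L: "\<And>x. norm (gradient \<phi> x) \<le> L" and M: "\<And>x. \<bar>\<phi> x\<bar> \<le> M"
    using test_bounds[OF test] by metis
  have fin: "emeasure lborel (ball (0::real^'n) R) < \<infinity>" by (intro emeasure_bounded_finite bounded_ball)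
  have c: "integrable lborel (\<lambda>x::real^'n. indicator (ball 0 R) x * K)" for K :: real
    using fin by (intro integrable_mult_left integrable_real_indicator) simp_all
  show "integrable lborel \<phi>"
  proof (rule Bochner_Integration.integrable_bound[OF c[of M]])
    show "AE x in lborel. norm (\<phi> x) \<le> norm (indicator (ball 0 R) x * M)"
      using R(1) M by (intro AE_I2) (auto simp: indicator_def not_less intro: order_trans[OF _ abs_ge_self])
  qed measurable
  show "integrable lborel (\<lambda>x. norm (gradient \<phi> x))"
  proof (rule Bochner_Integration.integrable_bound[OF c[of L]])
    show "AE x in lborel. norm (norm (gradient \<phi> x)) \<le> norm (indicator (ball 0 R) x * L)"
      using R(2) L by (intro AE_I2) (auto simp: indicator_def not_less intro: order_trans[OF _ abs_ge_self])
  qed measurable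
qed

text \<open>The increment is the integral of the derivative along the segment from \<open>x\<close>
  to \<open>x + z\<close>; exchanging integrals and shifting in \<open>x\<close> removes the
  position on the segment.\<close>

lemma translation_estimate:
  "(\<integral>\<^sup>+x. ennreal \<bar>\<phi> (x + z) - \<phi> x\<bar> \<partial>lborel) \<le> ennreal (norm z) * (\<integral>\<^sup>+x. ennreal (norm (gradient \<phi> x)) \<partial>lborel)"
proof -
  note [measurable] = borel_measurable_test[OF test] borel_measurable_gradient
  have pw: "ennreal \<bar>\<phi> (x + z) - \<phi> x\<bar>
      \<le> (\<integral>\<^sup>+t. ennreal (norm z) * (indicator {0..1} t * ennreal (norm (gradient \<phi> (t *\<^sub>R z + x)))) \<partial>lborel)" for x
  proof -
    let ?f = "\<lambda>t. gradient \<phi> (x + t *\<^sub>R z) \<bullet> z"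
    have d: "((\<lambda>t. \<phi> (x + t *\<^sub>R z)) has_real_derivative ?f t) (at t within {0..1})" for t
    proof -
      have "((\<lambda>t. x + t *\<^sub>R z) has_derivative (\<lambda>h. h *\<^sub>R z)) (at t)"
        by (auto intro!: derivative_eq_intros)
      from diff_chain_at[OF this test_has_derivative[OF test]]
      have "((\<lambda>t. \<phi> (x + t *\<^sub>R z)) has_derivative (\<lambda>h. ?f t * h)) (at t)"
        by (simp add: o_def mult.commute)
      then show ?thesis by (simp add: has_field_derivative_def has_derivative_at_withinI)
    qed
    have c: "continuous_on {0..1} ?f"
      by (intro continuous_intros continuous_on_compose2[OF gradient_continuous[OF test]]) auto
    have "has_bochner_integral lborel (\<lambda>t. indicator {0..1} t *\<^sub>R ?f t) (\<phi> (x + 1 *\<^sub>R z) - \<phi> (x + 0 *\<^sub>R z))"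
      by (rule has_bochner_integral_FTC_Icc[OF _ _ c])
         (use d in \<open>auto simp: has_real_derivative_iff_has_vector_derivative\<close>)
    then have int: "integrable lborel (\<lambda>t. indicator {0..1} t *\<^sub>R ?f t)"
      and eq: "(LINT t|lborel. indicator {0..1} t *\<^sub>R ?f t) = \<phi> (x + z) - \<phi> x"
      by (auto simp: has_bochner_integral_iff)
    have "ennreal \<bar>\<phi> (x + z) - \<phi> x\<bar> \<le> (\<integral>\<^sup>+t. ennreal (norm (indicator {0..1} t *\<^sub>R ?f t)) \<partial>lborel)"
      using integral_norm_bound_ennreal[OF int] by (simp only: eq real_norm_def)
    also have "\<dots> \<le> (\<integral>\<^sup>+t. ennreal (norm z) * (indicator {0..1} t * ennreal (norm (gradient \<phi> (t *\<^sub>R z + x)))) \<partial>lborel)"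
    proof (rule nn_integral_mono)
      fix t :: real
      have "\<bar>?f t\<bar> \<le> norm z * norm (gradient \<phi> (t *\<^sub>R z + x))"
        using Cauchy_Schwarz_ineq2[of "gradient \<phi> (x + t *\<^sub>R z)" z] by (simp add: mult.commute add.commute)
      then have "ennreal \<bar>?f t\<bar> \<le> ennreal (norm z) * ennreal (norm (gradient \<phi> (t *\<^sub>R z + x)))"
        by (simp add: ennreal_mult[symmetric] ennreal_leI)
      then show "ennreal (norm (indicator {0..1} t *\<^sub>R ?f t))
          \<le> ennreal (norm z) * (indicator {0..1} t * ennreal (norm (gradient \<phi> (t *\<^sub>R z + x))))"
        by (cases "t \<in> {0..1}") auto
    qed
    finally show ?thesis .
  qed
  have [measurable]: "(\<lambda>t. indicator {0..1} t :: ennreal) \<in> borel_measurable (borel :: real measure)"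
    by (rule borel_measurable_indicator) simp
  let ?D = "\<integral>\<^sup>+x. ennreal (norm (gradient \<phi> x)) \<partial>lborel"
  have "(\<integral>\<^sup>+x. ennreal \<bar>\<phi> (x + z) - \<phi> x\<bar> \<partial>lborel)
    \<le> (\<integral>\<^sup>+x. \<integral>\<^sup>+t. ennreal (norm z) * (indicator {0..1} t * ennreal (norm (gradient \<phi> (t *\<^sub>R z + x)))) \<partial>lborel \<partial>lborel)"
    by (rule nn_integral_mono) (rule pw)
  also have "\<dots> = (\<integral>\<^sup>+t. \<integral>\<^sup>+x. ennreal (norm z) * (indicator {0..1} t * ennreal (norm (gradient \<phi> (t *\<^sub>R z + x)))) \<partial>lborel \<partial>lborel)"
    by (rule lborel_pair.Fubini') measurable
  also have "\<dots> = (\<integral>\<^sup>+t. ennreal (norm z) * (indicator {0..1::real} t * ?D) \<partial>lborel)"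
  proof (rule nn_integral_cong)
    fix t :: real
    have "(\<integral>\<^sup>+x. ennreal (norm z) * (indicator {0..1} t * ennreal (norm (gradient \<phi> (t *\<^sub>R z + x)))) \<partial>lborel)
      = ennreal (norm z) * (indicator {0..1} t * (\<integral>\<^sup>+x. ennreal (norm (gradient \<phi> (t *\<^sub>R z + x))) \<partial>lborel))"
      by (simp add: nn_integral_cmult)
    also have "(\<integral>\<^sup>+x. ennreal (norm (gradient \<phi> (t *\<^sub>R z + x))) \<partial>lborel) = ?D"
      by (rule nn_integral_lborel_shift) measurable
    finally show "(\<integral>\<^sup>+x. ennreal (norm z) * (indicator {0..1} t * ennreal (norm (gradient \<phi> (t *\<^sub>R z + x)))) \<partial>lborel)
      = ennreal (norm z) * (indicator {0..1} t * ?D)" .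
  qed
  also have "\<dots> = ennreal (norm z) * ?D"
    by (simp add: nn_integral_cmult nn_integral_multc)
  finally show ?thesis .
qed

text \<open>A translation of length \<open>2 * R\<close> moves the support off itself, so the
  increment contains two disjoint copies of the function; the translation estimate then bounds twice
  the norm.\<close>

lemma poincare_inequality:
  assumes S: "S \<subseteq> ball 0 R" and R: "R > 0"
  shows "(LINT x|lborel. \<bar>\<phi> x\<bar>) \<le> R * (LINT x|lborel. norm (gradient \<phi> x))"
proof -
  note [measurable] = borel_measurable_test[OF test] borel_measurable_gradient
  let ?D = "LINT x|lborel. norm (gradient \<phi> x)"
  have D: "(\<integral>\<^sup>+x. ennreal (norm (gradient \<phi> x)) \<partial>lborel) = ennreal ?D"
    by (rule nn_integral_eq_integral[OF integrable_test(2)]) simp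
  obtain z :: "real^'n" where z: "norm z = 2 * R" using vector_choose_size[of "2 * R"] R by auto
  have "\<phi> x = 0 \<or> \<phi> (x + z) = 0" for x
  proof (rule ccontr)
    assume "\<not> ?thesis"
    then have "x \<in> S" "x + z \<in> S" using test_outside[OF test] by auto
    then have "norm x < R" "norm (x + z) < R" using S by auto
    then show False using norm_triangle_ineq4[of "x + z" x] z by simp
  qed
  then have "\<bar>\<phi> (x + z) - \<phi> x\<bar> = \<bar>\<phi> (x + z)\<bar> + \<bar>\<phi> x\<bar>" for x by (metis abs_minus_cancel add_0 add.right_neutral abs_zero diff_0 diff_0_right)
  then have "(\<integral>\<^sup>+x. ennreal \<bar>\<phi> (x + z) - \<phi> x\<bar> \<partial>lborel) = (\<integral>\<^sup>+x. ennreal \<bar>\<phi> (x + z)\<bar> + ennreal \<bar>\<phi> x\<bar> \<partial>lborel)"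
    by simp
  also have "\<dots> = (\<integral>\<^sup>+x. ennreal \<bar>\<phi> (x + z)\<bar> \<partial>lborel) + (\<integral>\<^sup>+x. ennreal \<bar>\<phi> x\<bar> \<partial>lborel)"
    by (rule nn_integral_add) measurable
  also have "(\<integral>\<^sup>+x. ennreal \<bar>\<phi> (x + z)\<bar> \<partial>lborel) = (\<integral>\<^sup>+x. ennreal \<bar>\<phi> x\<bar> \<partial>lborel)"
    using nn_integral_lborel_shift[of "\<lambda>x. ennreal \<bar>\<phi> x\<bar>" z] by (simp add: add.commute)
  also have "(\<integral>\<^sup>+x. ennreal \<bar>\<phi> x\<bar> \<partial>lborel) = ennreal (LINT x|lborel. \<bar>\<phi> x\<bar>)"
    by (rule nn_integral_eq_integral[OF integrable_abs[OF integrable_test(1)]]) simp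
  finally have "ennreal (LINT x|lborel. \<bar>\<phi> x\<bar>) + ennreal (LINT x|lborel. \<bar>\<phi> x\<bar>) \<le> ennreal (2 * R) * ennreal ?D"
    using translation_estimate[of z] by (simp add: D z)
  then have "ennreal (2 * (LINT x|lborel. \<bar>\<phi> x\<bar>)) \<le> ennreal (2 * R * ?D)"
    using R by (simp add: ennreal_plus[symmetric] ennreal_mult[symmetric] del: ennreal_plus)
  then show ?thesis using R by (simp add: ennreal_le_iff)
qed

end

section \<open>Rellich inequality on a grid of cubes\<close>

definition cube :: "real \<Rightarrow> ('n::finite \<Rightarrow> int) \<Rightarrow> (real^'n) set" where
  "cube h k = {x. \<forall>i. \<lfloor>x $ i / h\<rfloor> = k i}"

lemma cube_measurable: "cube h k \<in> sets (borel :: (real^'n::finite) measure)"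
proof -
  have "cube h k = (\<Inter>i. {x. \<lfloor>x $ i / h\<rfloor> = k i})" by (auto simp: cube_def)
  also have "\<dots> \<in> sets (borel :: (real^'n) measure)"
    by (intro sets.countable_INT) (auto intro: measurable_sets)
  finally show ?thesis .
qed

text \<open>The floor makes the cubes half-open, so they partition the space exactly, with no
  overlapping faces to discard.\<close>

lemma cube_disjoint: "x \<in> cube h k \<Longrightarrow> x \<in> cube h l \<Longrightarrow> k = l"
  by (auto simp: cube_def)

lemma cube_diameter:
  fixes x y :: "real^'n::finite"
  assumes "h > 0" "x \<in> cube h k" "y \<in> cube h k"
  shows "norm (y - x) \<le> real CARD('n) * h"
proof -
  have "\<bar>(y - x) $ i\<bar> \<le> h" for i
  proof -
    have "\<lfloor>x $ i / h\<rfloor> = \<lfloor>y $ i / h\<rfloor>" using assms by (simp add: cube_def)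
    then have "\<bar>y $ i / h - x $ i / h\<bar> < 1" by linarith
    then have "\<bar>(y $ i - x $ i) / h\<bar> < 1" by (simp add: diff_divide_distrib)
    then show ?thesis using assms(1) by (simp add: abs_divide divide_less_eq)
  qed
  then have "(\<Sum>i\<in>UNIV. \<bar>(y - x) $ i\<bar>) \<le> (\<Sum>i\<in>(UNIV::'n set). h)" by (intro sum_mono) auto
  then show ?thesis using norm_le_l1_cart[of "y - x"] by simp
qed

lemma emeasure_cube:
  fixes k :: "'n::finite \<Rightarrow> int"
  assumes "h > 0"
  shows "ennreal (h ^ CARD('n)) \<le> emeasure lborel (cube h k)" "emeasure lborel (cube h k) < \<infinity>"
proof -
  define l :: "real^'n" where "l = (\<chi> i. h * real_of_int (k i))"
  define u :: "real^'n" where "u = (\<chi> i. h * (real_of_int (k i) + 1))"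
  have ul: "(u - l) \<bullet> b = h" if "b \<in> Basis" for b
  proof -
    obtain i where "b = axis i 1" using \<open>b \<in> Basis\<close> by (auto simp: Basis_vec_def)
    then show ?thesis by (simp add: inner_axis l_def u_def algebra_simps)
  qed
  have "emeasure lborel (box l u) = (\<Prod>b\<in>Basis. (u - l) \<bullet> b)"
  proof (rule emeasure_lborel_box)
    show "l \<bullet> b \<le> u \<bullet> b" if "b \<in> Basis" for b
      using ul[OF that] assms by (simp add: inner_diff_left)
  qed
  also have "(\<Prod>b\<in>Basis. (u - l) \<bullet> b) = (\<Prod>b\<in>(Basis :: (real^'n) set). h)" by (rule prod.cong) (use ul in auto)
  finally have "ennreal (h ^ CARD('n)) = emeasure lborel (box l u)" by simp
  also have "\<dots> \<le> emeasure lborel (cube h k)"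
  proof (rule emeasure_mono)
    show "box l u \<subseteq> cube h k"
    proof
      fix x assume "x \<in> box l u"
      then have "l $ i < x $ i \<and> x $ i < u $ i" for i by (simp add: mem_box_cart)
      then have "real_of_int (k i) \<le> x $ i / h \<and> x $ i / h < real_of_int (k i) + 1" for i
        using assms less_imp_le by (auto simp: l_def u_def pos_le_divide_eq pos_divide_less_eq mult.commute)
      then show "x \<in> cube h k" by (simp add: cube_def floor_eq_iff)
    qed
  qed (simp add: cube_measurable)
  finally show "ennreal (h ^ CARD('n)) \<le> emeasure lborel (cube h k)" .
  have "bounded (cube h k)"
  proof (cases "cube h k = {}")
    case False
    then obtain x where "x \<in> cube h k" by blast
    then have "cube h k \<subseteq> cball x (real CARD('n) * h)"
      using cube_diameter[OF assms, of x k] by (auto simp: dist_norm norm_minus_commute)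
    then show ?thesis by (rule bounded_subset[OF bounded_cball])
  qed simp
  then show "emeasure lborel (cube h k) < \<infinity>" by (rule emeasure_bounded_finite)
qed

lemma finite_cubes:
  assumes "bounded (S :: (real^'n::finite) set)" "h > 0"
  shows "finite {k. cube h k \<inter> S \<noteq> {}}"
proof -
  obtain R where R: "\<And>x. x \<in> S \<Longrightarrow> norm x \<le> R" using assms(1) unfolding bounded_iff by blast
  define M where "M = \<lceil>R / h\<rceil> + 1"
  have "{k. cube h k \<inter> S \<noteq> {}} \<subseteq> PiE UNIV (\<lambda>i::'n. {- M..M})"
  proof
    fix k assume "k \<in> {k. cube h k \<inter> S \<noteq> {}}"
    then obtain x where x: "x \<in> cube h k" "x \<in> S" by blast
    have "k i \<in> {- M..M}" for i
    proof -
    have "\<bar>x $ i\<bar> \<le> R" using component_le_norm_cart[of x i] R[OF x(2)] by linarith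
    then have "\<bar>x $ i / h\<bar> \<le> R / h" using assms(2) by (simp add: abs_divide divide_right_mono)
    moreover have "k i = \<lfloor>x $ i / h\<rfloor>" using x(1) by (simp add: cube_def)
    ultimately show ?thesis unfolding M_def by (auto; linarith)
    qed
    then show "k \<in> PiE UNIV (\<lambda>i::'n. {- M..M})" by (auto simp: PiE_UNIV_domain)
  qed
  then show ?thesis by (rule finite_subset) (simp add: finite_PiE)
qed

text \<open>With the volume \<open>m\<close> of the cube, \<open>m * \<phi> x\<close> is the
  integral of \<open>\<phi>\<close> over the cube plus that of \<open>\<phi> x - \<phi> y\<close> in
  \<open>y\<close>. Integrating in \<open>x\<close> over the cube and dividing by \<open>m\<close>
  leaves the mean term with factor 1.\<close>

lemma cube_poincare:
  fixes \<phi> :: "real^'n::finite \<Rightarrow> real" and k :: "'n \<Rightarrow> int"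
  assumes test: "\<phi> \<in> test_functions S" and h: "h > 0"
  shows "(\<integral>\<^sup>+x. ennreal \<bar>\<phi> x\<bar> * indicator (cube h k) x \<partial>lborel) \<le> ennreal \<bar>LINT y:cube h k|lborel. \<phi> y\<bar>
    + ennreal (1 / h ^ CARD('n)) * (\<integral>\<^sup>+x. \<integral>\<^sup>+y. ennreal \<bar>\<phi> x - \<phi> y\<bar> * indicator (cube h k) x * indicator (cube h k) y \<partial>lborel \<partial>lborel)"
proof -
  let ?Q = "cube h k"
  define m where "m = measure lborel ?Q"
  have em: "emeasure lborel ?Q = ennreal m"
    unfolding m_def by (rule emeasure_eq_ennreal_measure) (use emeasure_cube(2)[OF h, of k] in auto)
  have m: "m \<ge> h ^ CARD('n)" using emeasure_cube(1)[OF h, of k] by (simp add: em m_def)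
  have m0: "m > 0" using m h zero_less_power[OF h, of "CARD('n)"] by linarith
  note [measurable] = borel_measurable_test[OF test] cube_measurable[of h k]
  have int: "integrable lborel (\<lambda>y. indicator ?Q y *\<^sub>R \<phi> y)"
    by (rule integrable_mult_indicator[OF _ integrable_test(1)[OF test]]) simp
  have intc: "integrable lborel (\<lambda>y. indicator ?Q y *\<^sub>R c)" for c :: real
    using emeasure_cube(2)[OF h, of k] by (intro integrable_scaleR_left integrable_real_indicator) simp_all
  let ?I = "\<bar>LINT y:?Q|lborel. \<phi> y\<bar>"
  have pw: "ennreal m * ennreal \<bar>\<phi> x\<bar> \<le> ennreal ?I + (\<integral>\<^sup>+y. ennreal \<bar>\<phi> x - \<phi> y\<bar> * indicator ?Q y \<partial>lborel)" for x
  proof -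
    let ?g = "\<lambda>y. indicator ?Q y *\<^sub>R \<phi> x - indicator ?Q y *\<^sub>R \<phi> y"
    have ig: "integrable lborel ?g" by (rule Bochner_Integration.integrable_diff[OF intc int])
    have "m * \<phi> x = (LINT y|lborel. indicator ?Q y *\<^sub>R \<phi> x)" by (simp add: m_def)
    also have "\<dots> = (LINT y:?Q|lborel. \<phi> y) + (LINT y|lborel. ?g y)"
      unfolding set_lebesgue_integral_def by (subst Bochner_Integration.integral_diff[OF intc int]) simp
    finally have "\<bar>m * \<phi> x\<bar> \<le> ?I + \<bar>LINT y|lborel. ?g y\<bar>" by linarith
    then have "m * \<bar>\<phi> x\<bar> \<le> ?I + \<bar>LINT y|lborel. ?g y\<bar>" using m0 by (simp add: abs_mult)
    then have "ennreal (m * \<bar>\<phi> x\<bar>) \<le> ennreal (?I + \<bar>LINT y|lborel. ?g y\<bar>)" by (rule ennreal_leI)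
    also have "\<dots> = ennreal ?I + ennreal \<bar>LINT y|lborel. ?g y\<bar>" by simp
    also have "ennreal \<bar>LINT y|lborel. ?g y\<bar> \<le> (\<integral>\<^sup>+y. ennreal (norm (?g y)) \<partial>lborel)"
      using integral_norm_bound_ennreal[OF ig] by simp
    also have "(\<integral>\<^sup>+y. ennreal (norm (?g y)) \<partial>lborel) = (\<integral>\<^sup>+y. ennreal \<bar>\<phi> x - \<phi> y\<bar> * indicator ?Q y \<partial>lborel)"
      by (intro nn_integral_cong) (auto simp: indicator_def)
    finally show ?thesis using m0 by (simp add: ennreal_mult add_left_mono)
  qed
  let ?J = "\<integral>\<^sup>+x. \<integral>\<^sup>+y. ennreal \<bar>\<phi> x - \<phi> y\<bar> * indicator ?Q x * indicator ?Q y \<partial>lborel \<partial>lborel"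
  let ?P = "\<integral>\<^sup>+x. ennreal \<bar>\<phi> x\<bar> * indicator ?Q x \<partial>lborel"
  have "ennreal m * ?P = (\<integral>\<^sup>+x. ennreal m * (ennreal \<bar>\<phi> x\<bar> * indicator ?Q x) \<partial>lborel)"
    by (rule nn_integral_cmult[symmetric]) measurable
  also have "\<dots> \<le> (\<integral>\<^sup>+x. ennreal ?I * indicator ?Q x
      + (\<integral>\<^sup>+y. ennreal \<bar>\<phi> x - \<phi> y\<bar> * indicator ?Q x * indicator ?Q y \<partial>lborel) \<partial>lborel)"
  proof (rule nn_integral_mono)
    fix x
    show "ennreal m * (ennreal \<bar>\<phi> x\<bar> * indicator ?Q x) \<le> ennreal ?I * indicator ?Q x
      + (\<integral>\<^sup>+y. ennreal \<bar>\<phi> x - \<phi> y\<bar> * indicator ?Q x * indicator ?Q y \<partial>lborel)"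
      using pw[of x] by (cases "x \<in> ?Q") auto
  qed
  also have "\<dots> = ennreal ?I * ennreal m + ?J"
    by (subst nn_integral_add) (simp_all add: nn_integral_cmult em)
  finally have *: "ennreal m * ?P \<le> ennreal ?I * ennreal m + ?J" .
  have "?P = ennreal (1 / m) * (ennreal m * ?P)"
    using m0 by (simp add: mult.assoc[symmetric] ennreal_mult[symmetric])
  also have "\<dots> \<le> ennreal (1 / m) * (ennreal ?I * ennreal m + ?J)" by (rule mult_left_mono[OF *]) simp
  also have "\<dots> = ennreal ?I + ennreal (1 / m) * ?J"
    using m0 by (simp add: distrib_left ennreal_mult[symmetric])
  also have "\<dots> \<le> ennreal ?I + ennreal (1 / h ^ CARD('n)) * ?J"
    using m m0 h by (intro add_left_mono mult_right_mono ennreal_leI) (auto intro: frac_le)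
  finally show ?thesis .
qed

text \<open>A quantitative Rellich theorem: up to a small multiple of the gradient norm, the \<open>L\<^sup>1\<close> norm is
  controlled by the means over finitely many cubes.\<close>

lemma rellich_cubes:
  fixes S :: "(real^'n::finite) set"
  assumes "bounded S" "\<epsilon> > 0"
  obtains \<Q> where "finite \<Q>" "\<Q> \<subseteq> sets borel"
    "\<And>\<phi>. \<phi> \<in> test_functions S \<Longrightarrow>
      (LINT x|lborel. \<bar>\<phi> x\<bar>) \<le> (\<Sum>Q\<in>\<Q>. \<bar>LINT x:Q|lborel. \<phi> x\<bar>) + \<epsilon> * (LINT x|lborel. norm (gradient \<phi> x))"
proof -
  let ?n = "CARD('n)"
  define V where "V = unit_ball_vol (real ?n)"
  have V: "V > 0" by (simp add: V_def)
  \<comment> \<open>The ball of radius \<open>d\<close> has volume \<open>V * d ^ ?n\<close>; times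
    the displacement \<open>d\<close> and divided by the cube volume \<open>h ^ ?n\<close> it
    becomes \<open>c * h\<close>, which \<open>h\<close> is chosen to make equal to
    \<open>\<epsilon>\<close>.\<close>
  define c where "c = V * real ?n ^ ?n * real ?n"
  have c: "c > 0" using V by (simp add: c_def)
  define h where "h = \<epsilon> / c"
  have h: "h > 0" using assms(2) c by (simp add: h_def)
  define d where "d = real ?n * h"
  have d: "d > 0" using h by (simp add: d_def)
  define K where "K = {k. cube h k \<inter> S \<noteq> {}}"
  have finK: "finite K" unfolding K_def by (rule finite_cubes[OF assms(1) h])
  define \<Q> where "\<Q> = cube h ` K"
  have est: "(LINT x|lborel. \<bar>\<phi> x\<bar>) \<le> (\<Sum>Q\<in>\<Q>. \<bar>LINT x:Q|lborel. \<phi> x\<bar>) + \<epsilon> * (LINT x|lborel. norm (gradient \<phi> x))"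
    if test: "\<phi> \<in> test_functions S" for \<phi>
  proof -
    note [measurable] = borel_measurable_test[OF test] cube_measurable
    let ?D = "LINT x|lborel. norm (gradient \<phi> x)"
    have D: "(\<integral>\<^sup>+x. ennreal (norm (gradient \<phi> x)) \<partial>lborel) = ennreal ?D"
      by (rule nn_integral_eq_integral[OF integrable_test(2)[OF test]]) simp
    have D0: "?D \<ge> 0" by simp
    let ?G = "\<lambda>k x y. ennreal \<bar>\<phi> x - \<phi> y\<bar> * indicator (cube h k) x * indicator (cube h k) y"
    have "ennreal (LINT x|lborel. \<bar>\<phi> x\<bar>) = (\<integral>\<^sup>+x. ennreal \<bar>\<phi> x\<bar> \<partial>lborel)"
      by (rule nn_integral_eq_integral[OF integrable_abs[OF integrable_test(1)[OF test]], symmetric]) simp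
    also have "\<dots> \<le> (\<integral>\<^sup>+x. (\<Sum>k\<in>K. ennreal \<bar>\<phi> x\<bar> * indicator (cube h k) x) \<partial>lborel)"
    proof (rule nn_integral_mono)
      fix x
      show "ennreal \<bar>\<phi> x\<bar> \<le> (\<Sum>k\<in>K. ennreal \<bar>\<phi> x\<bar> * indicator (cube h k) x)"
      proof (cases "\<phi> x = 0")
        case False
        then have "x \<in> S" using test_outside[OF test] by blast
        then have k: "(\<lambda>i. \<lfloor>x $ i / h\<rfloor>) \<in> K" "x \<in> cube h (\<lambda>i. \<lfloor>x $ i / h\<rfloor>)"
          by (auto simp: K_def cube_def)
        then have "ennreal \<bar>\<phi> x\<bar> = ennreal \<bar>\<phi> x\<bar> * indicator (cube h (\<lambda>i. \<lfloor>x $ i / h\<rfloor>)) x" by simp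
        also have "\<dots> \<le> (\<Sum>k\<in>K. ennreal \<bar>\<phi> x\<bar> * indicator (cube h k) x)"
          using member_le_sum[OF k(1), of "\<lambda>k. ennreal \<bar>\<phi> x\<bar> * indicator (cube h k) x"] finK by simp
        finally show ?thesis .
      qed simp
    qed
    also have "\<dots> = (\<Sum>k\<in>K. \<integral>\<^sup>+x. ennreal \<bar>\<phi> x\<bar> * indicator (cube h k) x \<partial>lborel)"
      by (rule nn_integral_sum) measurable
    also have "\<dots> \<le> (\<Sum>k\<in>K. ennreal \<bar>LINT y:cube h k|lborel. \<phi> y\<bar>
        + ennreal (1 / h ^ ?n) * (\<integral>\<^sup>+x. \<integral>\<^sup>+y. ?G k x y \<partial>lborel \<partial>lborel))"
      by (intro sum_mono cube_poincare[OF test h])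
    also have "\<dots> = ennreal (\<Sum>k\<in>K. \<bar>LINT y:cube h k|lborel. \<phi> y\<bar>)
        + ennreal (1 / h ^ ?n) * (\<Sum>k\<in>K. \<integral>\<^sup>+x. \<integral>\<^sup>+y. ?G k x y \<partial>lborel \<partial>lborel)"
      by (simp add: sum.distrib sum_distrib_left)
    also have "(\<Sum>k\<in>K. \<integral>\<^sup>+x. \<integral>\<^sup>+y. ?G k x y \<partial>lborel \<partial>lborel)
        = (\<integral>\<^sup>+x. \<integral>\<^sup>+y. (\<Sum>k\<in>K. ?G k x y) \<partial>lborel \<partial>lborel)"
      by (simp add: nn_integral_sum)
    \<comment> \<open>Two points of one cube differ by at most \<open>d\<close>, and a pair lies in
      at most one common cube. Passing to all pairs at distance at most \<open>d\<close> makes the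
      integral accessible to the translation estimate.\<close>
    also have "\<dots> \<le> (\<integral>\<^sup>+x. \<integral>\<^sup>+y. indicator (cball 0 d) (y - x) * ennreal \<bar>\<phi> y - \<phi> x\<bar> \<partial>lborel \<partial>lborel)"
    proof (intro nn_integral_mono)
      fix x y
      show "(\<Sum>k\<in>K. ?G k x y) \<le> indicator (cball 0 d) (y - x) * ennreal \<bar>\<phi> y - \<phi> x\<bar>"
      proof (cases "\<exists>k\<in>K. x \<in> cube h k \<and> y \<in> cube h k")
        case True
        then obtain k where k: "k \<in> K" "x \<in> cube h k" "y \<in> cube h k" by blast
        have "(\<Sum>l\<in>K. ?G l x y) = (\<Sum>l\<in>K. if l = k then ennreal \<bar>\<phi> y - \<phi> x\<bar> else 0)"
          using k cube_disjoint by (intro sum.cong) (auto simp: indicator_def abs_minus_commute)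
        also have "\<dots> = ennreal \<bar>\<phi> y - \<phi> x\<bar>" using k(1) finK by simp
        finally show ?thesis using cube_diameter[OF h k(2,3)] by (simp add: d_def)
      next
        case False
        then have "(\<Sum>k\<in>K. ?G k x y) = 0" by (intro sum.neutral) (auto simp: indicator_def)
        then show ?thesis by simp
      qed
    qed
    also have "\<dots> = (\<integral>\<^sup>+x. \<integral>\<^sup>+z. indicator (cball 0 d) z * ennreal \<bar>\<phi> (x + z) - \<phi> x\<bar> \<partial>lborel \<partial>lborel)"
    proof (rule nn_integral_cong)
      fix x :: "real^'n"
      have [measurable]: "(\<lambda>z::real^'n. indicator (cball 0 d) z :: ennreal) \<in> borel_measurable borel"
        by (rule borel_measurable_indicator) simp
      have "(\<lambda>y. indicator (cball 0 d) (y - x) * ennreal \<bar>\<phi> y - \<phi> x\<bar>) \<in> borel_measurable borel" by measurable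
      from nn_integral_lborel_shift[OF this, of x]
      show "(\<integral>\<^sup>+y. indicator (cball 0 d) (y - x) * ennreal \<bar>\<phi> y - \<phi> x\<bar> \<partial>lborel)
          = (\<integral>\<^sup>+z. indicator (cball 0 d) z * ennreal \<bar>\<phi> (x + z) - \<phi> x\<bar> \<partial>lborel)" by simp
    qed
    also have "\<dots> = (\<integral>\<^sup>+z. \<integral>\<^sup>+x. indicator (cball 0 d) z * ennreal \<bar>\<phi> (x + z) - \<phi> x\<bar> \<partial>lborel \<partial>lborel)"
    proof (rule lborel_pair.Fubini')
      have [measurable]: "(\<lambda>z::real^'n. indicator (cball 0 d) z :: ennreal) \<in> borel_measurable borel"
        by (rule borel_measurable_indicator) simp
      show "(\<lambda>(z, x). indicator (cball 0 d) z * ennreal \<bar>\<phi> (x + z) - \<phi> x\<bar>) \<in> borel_measurable (lborel \<Otimes>\<^sub>M lborel)"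
        by measurable
    qed
    also have "\<dots> \<le> (\<integral>\<^sup>+z. indicator (cball (0::real^'n) d) z * ennreal (d * ?D) \<partial>lborel)"
    proof (rule nn_integral_mono)
      fix z :: "real^'n"
      have "(\<integral>\<^sup>+x. indicator (cball 0 d) z * ennreal \<bar>\<phi> (x + z) - \<phi> x\<bar> \<partial>lborel)
          = indicator (cball 0 d) z * (\<integral>\<^sup>+x. ennreal \<bar>\<phi> (x + z) - \<phi> x\<bar> \<partial>lborel)"
        by (rule nn_integral_cmult) measurable
      also have "\<dots> \<le> indicator (cball 0 d) z * ennreal (d * ?D)"
      proof (cases "z \<in> cball 0 d")
        case True
        have "(\<integral>\<^sup>+x. ennreal \<bar>\<phi> (x + z) - \<phi> x\<bar> \<partial>lborel) \<le> ennreal (norm z) * ennreal ?D"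
          using translation_estimate[OF test, of z] by (simp add: D)
        also have "\<dots> \<le> ennreal (d * ?D)"
          using True D0 by (simp add: ennreal_mult[symmetric] ennreal_leI mult_right_mono)
        finally show ?thesis using True by simp
      qed simp
      finally show "(\<integral>\<^sup>+x. indicator (cball 0 d) z * ennreal \<bar>\<phi> (x + z) - \<phi> x\<bar> \<partial>lborel)
          \<le> indicator (cball 0 d) z * ennreal (d * ?D)" .
    qed
    also have "\<dots> = emeasure lborel (cball (0::real^'n) d) * ennreal (d * ?D)"
      by (subst nn_integral_multc) (auto intro: borel_measurable_indicator)
    also have "\<dots> = ennreal (V * d ^ ?n) * ennreal (d * ?D)"
      using d by (simp add: emeasure_cball V_def)
    finally have "ennreal (LINT x|lborel. \<bar>\<phi> x\<bar>) \<le> ennreal (\<Sum>k\<in>K. \<bar>LINT y:cube h k|lborel. \<phi> y\<bar>)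
        + ennreal (1 / h ^ ?n) * (ennreal (V * d ^ ?n) * ennreal (d * ?D))"
      by (simp add: add_left_mono mult_left_mono)
    also have "ennreal (1 / h ^ ?n) * (ennreal (V * d ^ ?n) * ennreal (d * ?D)) = ennreal (1 / h ^ ?n * (V * d ^ ?n * (d * ?D)))"
      using h d V D0 by (simp add: ennreal_mult[symmetric])
    also have "1 / h ^ ?n * (V * d ^ ?n * (d * ?D)) = \<epsilon> * ?D"
    proof -
      have "1 / h ^ ?n * (V * d ^ ?n * (d * ?D)) = c * h * ?D"
        using h by (simp add: d_def c_def power_mult_distrib)
      also have "c * h = \<epsilon>" using c by (simp add: h_def)
      finally show ?thesis .
    qed
    also have "ennreal (\<Sum>k\<in>K. \<bar>LINT y:cube h k|lborel. \<phi> y\<bar>) + ennreal (\<epsilon> * ?D)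
        = ennreal ((\<Sum>k\<in>K. \<bar>LINT y:cube h k|lborel. \<phi> y\<bar>) + \<epsilon> * ?D)"
      using assms(2) D0 by (intro ennreal_plus[symmetric] sum_nonneg) auto
    finally have *: "(LINT x|lborel. \<bar>\<phi> x\<bar>) \<le> (\<Sum>k\<in>K. \<bar>LINT y:cube h k|lborel. \<phi> y\<bar>) + \<epsilon> * ?D"
      using assms(2) D0 by (subst (asm) ennreal_le_iff) (auto intro!: add_nonneg_nonneg sum_nonneg)
    have "inj_on (cube h) K"
    proof (rule inj_onI)
      fix k l assume kl: "k \<in> K" "l \<in> K" "cube h k = cube h l"
      then obtain x where "x \<in> cube h k" unfolding K_def by blast
      with kl(3) show "k = l" using cube_disjoint[of x h k l] by simp
    qed
    then have "(\<Sum>Q\<in>\<Q>. \<bar>LINT x:Q|lborel. \<phi> x\<bar>) = (\<Sum>k\<in>K. \<bar>LINT y:cube h k|lborel. \<phi> y\<bar>)"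
      unfolding \<Q>_def by (simp add: sum.reindex)
    with * show ?thesis by simp
  qed
  show ?thesis
    by (rule that[of \<Q>]) (use est finK cube_measurable in \<open>auto simp: \<Q>_def\<close>)
qed


section \<open>Elements of the completion as functions\<close>

lemma sigma_finite_lebesgue: "sigma_finite_measure (lebesgue :: 'a::euclidean_space measure)"
proof -
  obtain \<A> :: "'a set set" where "countable \<A>" "\<A> \<subseteq> sets lborel" "\<Union>\<A> = space lborel" "\<forall>a\<in>\<A>. emeasure lborel a \<noteq> \<infinity>"
    using lborel.sigma_finite_countable by blast
  then show ?thesis by (intro sigma_finite_measure.intro exI[of _ \<A>]) auto
qed

lemma borel_measurable_component:
  fixes f :: "'a \<Rightarrow> ('b::{topological_space})^'n::finite"
  assumes "f \<in> borel_measurable M"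
  shows "(\<lambda>x. f x $ i) \<in> borel_measurable M"
proof -
  have "(\<lambda>v::'b^'n. v $ i) \<in> borel_measurable borel"
    by (rule borel_measurable_continuous_onI) (auto intro!: continuous_intros)
  from measurable_compose[OF assms this] show ?thesis .
qed

lemma borel_measurable_quadratic:
  fixes M :: "'a \<Rightarrow> real^'n::finite^'n" and X Y :: "'a \<Rightarrow> real^'n"
  assumes "M \<in> borel_measurable N" "X \<in> borel_measurable N" "Y \<in> borel_measurable N"
  shows "(\<lambda>p. X p \<bullet> (M p *v Y p)) \<in> borel_measurable N"
proof -
  note [measurable] = borel_measurable_component[OF borel_measurable_component[OF assms(1)]]
    borel_measurable_component[OF assms(2)] borel_measurable_component[OF assms(3)]
  have "(\<lambda>p. X p \<bullet> (M p *v Y p)) = (\<lambda>p. \<Sum>i\<in>UNIV. X p $ i * (\<Sum>j\<in>UNIV. M p $ i $ j * Y p $ j))"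
    by (simp add: inner_vec_def matrix_vector_mult_def)
  also have "\<dots> \<in> borel_measurable N" by measurable
  finally show ?thesis .
qed

lemma quadratic_sum: "X \<bullet> (M *v Y) = (\<Sum>i\<in>UNIV. \<Sum>j\<in>UNIV. M $ i $ j * Y $ j * X $ i)"
  for M :: "real^'n::finite^'n"
  by (simp add: inner_vec_def matrix_vector_mult_def sum_distrib_left mult_ac)

lemma energy_density_eq: "energy_density A G H s x = (G s x \<bullet> (A s x *v H s x) + H s x \<bullet> (A s x *v G s x)) / 2"
proof -
  have "energy_density A G H s x
      = (\<Sum>i\<in>UNIV. \<Sum>j\<in>UNIV. (A s x $ i $ j * H s x $ j * G s x $ i + A s x $ j $ i * G s x $ i * H s x $ j) / 2)"
    by (simp add: energy_density_def sym_part_def transpose_def algebra_simps add_divide_distrib)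
  also have "\<dots> = ((\<Sum>i\<in>UNIV. \<Sum>j\<in>UNIV. A s x $ i $ j * H s x $ j * G s x $ i)
      + (\<Sum>i\<in>UNIV. \<Sum>j\<in>UNIV. A s x $ j $ i * G s x $ i * H s x $ j)) / 2"
    by (simp add: sum.distrib sum_divide_distrib[symmetric])
  also have "(\<Sum>i\<in>UNIV. \<Sum>j\<in>UNIV. A s x $ j $ i * G s x $ i * H s x $ j)
      = (\<Sum>j\<in>UNIV. \<Sum>i\<in>UNIV. A s x $ j $ i * G s x $ i * H s x $ j)" by (rule sum.swap)
  finally show ?thesis by (simp only: quadratic_sum)
qed

text \<open>The Riesz-Fischer argument. At almost every point the weights force \<open>d k p\<close>
  to decay like \<open>(1/4) ^ k\<close>, hence the increments like \<open>(1/2) ^ k\<close>, also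
  after a square root when \<open>m = 2\<close>. The constant \<open>c\<close> may depend on the
  point, which admits degenerate coefficients.\<close>

lemma AE_convergent_of_summable_powers:
  fixes v :: "nat \<Rightarrow> 'p \<Rightarrow> 'b::banach" and d :: "nat \<Rightarrow> 'p \<Rightarrow> ennreal"
  assumes [measurable]: "\<And>k. d k \<in> borel_measurable M"
    and fin: "(\<Sum>k. 4 ^ k * (\<integral>\<^sup>+p. d k p \<partial>M)) < \<infinity>"
    and lower: "\<And>p. p \<in> space M \<Longrightarrow> \<exists>c>0. \<forall>k. ennreal (c * norm (v (Suc k) p - v k p) ^ m) \<le> d k p"
    and m: "m = 1 \<or> m = 2"
  shows "AE p in M. convergent (\<lambda>k. v k p)"
proof -
  have "(\<integral>\<^sup>+p. (\<Sum>k. 4 ^ k * d k p) \<partial>M) = (\<Sum>k. 4 ^ k * (\<integral>\<^sup>+p. d k p \<partial>M))"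
    by (simp add: nn_integral_suminf nn_integral_cmult)
  then have "AE p in M. (\<Sum>k. 4 ^ k * d k p) \<noteq> \<infinity>"
    using fin by (intro nn_integral_PInf_AE) auto
  then show ?thesis
  proof (rule AE_mp, intro AE_I2 impI)
    fix p assume p: "p \<in> space M" and S: "(\<Sum>k. 4 ^ k * d k p) \<noteq> \<infinity>"
    obtain c where c: "c > 0" "\<And>k. ennreal (c * norm (v (Suc k) p - v k p) ^ m) \<le> d k p"
      using lower[OF p] by blast
    define B where "B = enn2real (\<Sum>k. 4 ^ k * d k p)"
    have B: "(\<Sum>k. 4 ^ k * d k p) = ennreal B" "B \<ge> 0"
      using S by (auto simp: B_def less_top)
    have bd: "norm (v (Suc k) p - v k p) ^ m \<le> B / c * (1/4) ^ k" for k
    proof -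
      have "ennreal (4 ^ k * (c * norm (v (Suc k) p - v k p) ^ m)) = 4 ^ k * ennreal (c * norm (v (Suc k) p - v k p) ^ m)"
        using c(1) by (simp add: ennreal_mult ennreal_power[symmetric])
      also have "\<dots> \<le> 4 ^ k * d k p" by (intro mult_left_mono c(2)) simp
      also have "\<dots> \<le> (\<Sum>k. 4 ^ k * d k p)"
        using sum_le_suminf[OF summableI, of "{k}" "\<lambda>k. 4 ^ k * d k p"] by simp
      finally have "4 ^ k * (c * norm (v (Suc k) p - v k p) ^ m) \<le> B"
        unfolding B(1) using B(2) by (simp add: ennreal_le_iff)
      then show ?thesis using c(1) by (simp add: field_simps power_one_over)
    qed
    define D where "D = (if m = 1 then B / c else sqrt (B / c))"
    have "norm (v (Suc k) p - v k p) \<le> D * (1/2) ^ k" for k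
    proof (cases "m = 1")
      case True
      have "B / c * (1/4) ^ k \<le> B / c * (1/2) ^ k"
        using B(2) c(1) by (intro mult_left_mono power_mono) auto
      then show ?thesis using bd[of k] True by (simp add: D_def)
    next
      case False
      then have "(norm (v (Suc k) p - v k p))\<^sup>2 \<le> (D * (1/2) ^ k)\<^sup>2"
      proof -
        have h: "((1/2::real) ^ k)\<^sup>2 = (1/4) ^ k" by (induction k) (auto simp: power2_eq_square)
        have m2: "m = 2" using m False by blast
        have "D\<^sup>2 = B / c" using False B(2) c(1) unfolding D_def by simp
        then have D2: "(D * (1/2) ^ k)\<^sup>2 = B / c * (1/4) ^ k" unfolding power_mult_distrib h by (rule arg_cong)
        show ?thesis unfolding D2 using bd[of k] unfolding m2 .
      qed
      then show ?thesis by (rule power2_le_imp_le) (use B(2) c(1) False in \<open>auto simp: D_def\<close>)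
    qed
    moreover have "summable (\<lambda>k. D * (1/2) ^ k)" by (intro summable_mult summable_geometric) simp
    ultimately have "summable (\<lambda>k. v (Suc k) p - v k p)"
      using summable_comparison_test'[of "\<lambda>k. D * (1/2) ^ k" 0 "\<lambda>k. v (Suc k) p - v k p"] by simp
    then have "convergent (\<lambda>n. \<Sum>k<n. v (Suc k) p - v k p)" by (simp add: summable_iff_convergent)
    then have "convergent (\<lambda>n. v n p - v 0 p)" by (simp only: sum_lessThan_telescope[of "\<lambda>k. v k p"])
    then show "convergent (\<lambda>k. v k p)"
      using convergent_add[OF _ convergent_const[of "v 0 p"]] by fastforce
  qed
qed

section \<open>The quadratic form of the energy\<close>

locale fractional_setting =
  fixes \<Omega> :: "(real^'n::finite) set" and \<mu> :: "real measure" and A :: "real \<Rightarrow> real^'n \<Rightarrow> real^'n^'n"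
    and lam :: "real^'n \<Rightarrow> real" and \<iota> :: "(real^'n \<Rightarrow> real) \<Rightarrow> 'h::{real_inner, complete_space}"
  assumes dom: "open \<Omega>" "\<Omega> \<noteq> {}" "bounded \<Omega>"
    and mu: "sets \<mu> = sets (restrict_space borel {0..1})" "sigma_finite_measure \<mu>"
    and mu1: "emeasure \<mu> {1} > 0"
    and A_meas: "(\<lambda>(s, x). A s x) \<in> borel_measurable (\<mu> \<Otimes>\<^sub>M lebesgue)"
    and posdef: "\<And>s x \<xi>. s \<in> {0<..1} \<Longrightarrow> \<xi> \<noteq> 0 \<Longrightarrow> 0 < \<xi> \<bullet> (A s x *v \<xi>)"
    and lam_nonneg: "\<And>x. 0 \<le> lam x"
    and ellipt: "\<And>s x \<xi>. s \<in> {0<..1} \<Longrightarrow> lam x * (norm \<xi>)\<^sup>2 \<le> \<xi> \<bullet> (A s x *v \<xi>)"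
    and lam_meas: "lam \<in> borel_measurable lebesgue"
    and lam_int: "\<And>K. compact K \<Longrightarrow> (\<integral>\<^sup>+x\<in>K. inverse (ennreal (lam x)) \<partial>lebesgue) < \<infinity>"
    and H0: "is_H0_completion \<Omega> \<mu> A \<iota>"
begin

abbreviation "P \<equiv> \<mu> \<Otimes>\<^sub>M (lebesgue :: (real^'n) measure)"

definition q :: "real \<Rightarrow> real^'n \<Rightarrow> real^'n \<Rightarrow> real" where "q s x \<xi> = \<xi> \<bullet> (A s x *v \<xi>)"

text \<open>An extended nonnegative integral makes sense for every \<open>G\<close>, before any
  bound is known. The indicator removes \<open>s = 0\<close>, where positivity of \<open>A\<close>
  is not assumed.\<close>

definition En :: "(real \<Rightarrow> real^'n \<Rightarrow> real^'n) \<Rightarrow> ennreal" where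
  "En G = (\<integral>\<^sup>+p. ennreal (q (fst p) (snd p) (G (fst p) (snd p))) * indicator ({0<..1} \<times> UNIV) p \<partial>P)"

sublocale mu: sigma_finite_measure \<mu> by (rule mu(2))
sublocale leb: sigma_finite_measure "lebesgue :: (real^'n) measure" by (rule sigma_finite_lebesgue)
sublocale pair: pair_sigma_finite \<mu> "lebesgue :: (real^'n) measure" ..

lemma sets_mu: "B \<in> sets borel \<Longrightarrow> B \<subseteq> {0..1} \<Longrightarrow> B \<in> sets \<mu>"
  unfolding mu(1) by (auto simp: sets_restrict_space image_iff intro!: bexI[of _ B])

lemma sets_E [measurable]: "{0<..1} \<times> UNIV \<in> sets P"
  by (intro pair_measureI sets_mu) auto

lemma measurable_mu_borel: "(\<lambda>s. s) \<in> \<mu> \<rightarrow>\<^sub>M borel"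
proof -
  have "(\<lambda>s. s) \<in> restrict_space borel {0..1} \<rightarrow>\<^sub>M (borel :: real measure)"
    by (rule measurable_restrict_space1) simp
  then show ?thesis using measurable_cong_sets[OF mu(1) refl] by blast
qed

lemma measurable_P_borel: "(\<lambda>p. p) \<in> P \<rightarrow>\<^sub>M (borel \<Otimes>\<^sub>M borel)"
proof -
  have "(\<lambda>x. x) \<in> lebesgue \<rightarrow>\<^sub>M (borel :: (real^'n) measure)"
    by (rule measurable_completion) simp
  then have "(\<lambda>p. (fst p, snd p)) \<in> P \<rightarrow>\<^sub>M (borel \<Otimes>\<^sub>M borel)"
    using measurable_compose[OF measurable_fst measurable_mu_borel]
      measurable_compose[OF measurable_snd]
    by (intro measurable_Pair) auto
  then show ?thesis by simp
qed

lemma measurable_A: "(\<lambda>p. A (fst p) (snd p)) \<in> borel_measurable P"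
  using A_meas by (simp add: case_prod_beta')

lemma measurable_q:
  assumes "(\<lambda>p. G (fst p) (snd p)) \<in> borel_measurable P"
  shows "(\<lambda>p. q (fst p) (snd p) (G (fst p) (snd p))) \<in> borel_measurable P"
  unfolding q_def by (rule borel_measurable_quadratic[OF measurable_A assms assms])

lemma q_nonneg: "s \<in> {0<..1} \<Longrightarrow> 0 \<le> q s x \<xi>"
  using posdef[of s \<xi> x] by (cases "\<xi> = 0") (auto simp: q_def)

lemma q_eq_0: "s \<in> {0<..1} \<Longrightarrow> q s x \<xi> = 0 \<Longrightarrow> \<xi> = 0"
  using posdef[of s \<xi> x] by (auto simp: q_def)

lemma q_scale: "q s x (c *\<^sub>R \<xi>) = c\<^sup>2 * q s x \<xi>"
  by (simp add: q_def matrix_vector_mult_scaleR power2_eq_square)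

text \<open>Nonnegativity at \<open>\<xi> - \<eta>\<close> bounds the mixed terms by the pure
  ones.\<close>

lemma q_add: "s \<in> {0<..1} \<Longrightarrow> q s x (\<xi> + \<eta>) \<le> 2 * q s x \<xi> + 2 * q s x \<eta>"
  using q_nonneg[of s x "\<xi> - \<eta>"]
  by (simp add: q_def matrix_vector_right_distrib matrix_vector_mult_diff_distrib inner_add_left
      inner_add_right inner_diff_left inner_diff_right)

lemma q_minus: "q s x (- \<xi>) = q s x \<xi>"
  using q_scale[of s x "-1" \<xi>] by simp

lemma q_tendsto: "v \<longlonglongrightarrow> l \<Longrightarrow> (\<lambda>k. q s x (v k)) \<longlonglongrightarrow> q s x l"
  unfolding q_def
  by (intro tendsto_inner) (auto intro: linear_continuous_on continuous_on_tendsto_compose[of UNIV "\<lambda>v. A s x *v v"] matrix_vector_mult_linear_continuous_on)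

text \<open>Compactness of the unit sphere gives a positive constant at each \<open>s\<close> and
  \<open>x\<close>, even where \<open>lam x\<close> is 0. Its dependence on the point is compatible
  with pointwise convergence.\<close>

lemma q_lower: assumes "s \<in> {0<..1}" shows "\<exists>c>0. \<forall>\<xi>. c * (norm \<xi>)\<^sup>2 \<le> q s x \<xi>"
proof -
  have cont: "continuous_on (sphere 0 1) (q s x)"
    unfolding q_def by (intro continuous_on_inner continuous_on_id matrix_vector_mult_linear_continuous_on)
  obtain e :: "real^'n" where "norm e = 1" using vector_choose_size[of 1] by auto
  then have "sphere (0::real^'n) 1 \<noteq> {}" by auto
  then obtain e where e: "norm e = 1" "\<And>\<xi>. norm \<xi> = 1 \<Longrightarrow> q s x e \<le> q s x \<xi>"
    using continuous_attains_inf[OF compact_sphere _ cont] by (auto simp: dist_norm)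
  have "q s x e * (norm \<xi>)\<^sup>2 \<le> q s x \<xi>" for \<xi>
  proof (cases "\<xi> = 0")
    case False
    have "q s x e \<le> q s x ((1 / norm \<xi>) *\<^sub>R \<xi>)" using False by (intro e(2)) simp
    also have "\<dots> = q s x \<xi> / (norm \<xi>)\<^sup>2" by (simp add: q_scale power_divide)
    finally show ?thesis using False by (simp add: pos_le_divide_eq)
  qed (simp add: q_def)
  moreover have "e \<noteq> 0" using e(1) by auto
  then have "q s x e > 0" using posdef[OF assms] by (simp add: q_def)
  ultimately show ?thesis by blast
qed

text \<open>The cut-off in \<open>s\<close> gives joint measurability on the whole product space and
  does not affect the energy, which only sees \<open>s\<close> in \<open>{0<..1}\<close>.\<close>

definition Dg :: "(real^'n \<Rightarrow> real) \<Rightarrow> real \<Rightarrow> real^'n \<Rightarrow> real^'n" where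
  "Dg \<phi> s x = indicator {0<..1} s *\<^sub>R frac_grad s \<phi> x"

lemma measurable_Dg:
  assumes "\<phi> \<in> test_functions \<Omega>" shows "(\<lambda>p. Dg \<phi> (fst p) (snd p)) \<in> borel_measurable P"
  using measurable_compose[OF measurable_P_borel borel_measurable_frac_grad[OF assms]]
  by (simp add: Dg_def case_prod_beta')

lemma En_cong: "(\<And>s x. s \<in> {0<..1} \<Longrightarrow> q s x (G s x) = q s x (H s x)) \<Longrightarrow> En G = En H"
  unfolding En_def by (intro nn_integral_cong) (auto simp: indicator_def)

lemma En_eq_set_nn_integral:
  "(\<integral>\<^sup>+(s, x)\<in>{0<..1} \<times> UNIV. ennreal (energy_density A G G s x) \<partial>P) = En G"
  unfolding En_def by (intro nn_integral_cong) (simp add: energy_density_eq q_def case_prod_beta')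

lemma \<iota>_lin: "\<phi> \<in> test_functions \<Omega> \<Longrightarrow> \<psi> \<in> test_functions \<Omega> \<Longrightarrow> \<iota> (\<lambda>x. c * \<phi> x + d * \<psi> x) = c *\<^sub>R \<iota> \<phi> + d *\<^sub>R \<iota> \<psi>"
  using H0 by (simp add: is_H0_completion_def)

lemma \<iota>_diff: "\<phi> \<in> test_functions \<Omega> \<Longrightarrow> \<psi> \<in> test_functions \<Omega> \<Longrightarrow> \<iota> (\<lambda>x. \<phi> x - \<psi> x) = \<iota> \<phi> - \<iota> \<psi>"
  using \<iota>_lin[of \<phi> \<psi> 1 "-1"] by simp

text \<open>\<open>H0_inner\<close> is an iterated integral; the integrability contained in
  \<open>is_H0_completion\<close> allows Fubini and thus identifies it with the energy on the
  product space.\<close>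

lemma En_test:
  assumes "\<phi> \<in> test_functions \<Omega>"
  shows "En (\<lambda>s. frac_grad s \<phi>) = ennreal ((norm (\<iota> \<phi>))\<^sup>2)"
proof -
  let ?e = "\<lambda>s x. energy_density A (\<lambda>s. frac_grad s \<phi>) (\<lambda>s. frac_grad s \<phi>) s x"
  have e: "?e s x = q s x (frac_grad s \<phi> x)" for s x by (simp add: energy_density_eq q_def)
  let ?f = "\<lambda>s x. indicator {0<..1} s *\<^sub>R ?e s x"
  have "set_integrable P ({0<..1} \<times> UNIV) (\<lambda>(s, x). ?e s x)"
    using H0 assms by (simp add: is_H0_completion_def)
  then have int: "integrable P (case_prod ?f)"
    unfolding set_integrable_def by (rule Bochner_Integration.integrable_cong[THEN iffD1, rotated 2]) (auto simp: indicator_def)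
  have "(norm (\<iota> \<phi>))\<^sup>2 = H0_inner \<mu> A \<phi> \<phi>"
    using H0 assms by (simp add: is_H0_completion_def power2_norm_eq_inner)
  also have "\<dots> = (LINT x|lebesgue. LINT s|\<mu>. ?f s x)" by (simp add: H0_inner_def set_lebesgue_integral_def)
  also have "\<dots> = integral\<^sup>L P (case_prod ?f)" by (rule pair.integral_snd[OF int])
  finally have "ennreal ((norm (\<iota> \<phi>))\<^sup>2) = ennreal (integral\<^sup>L P (case_prod ?f))" by simp
  also have "\<dots> = (\<integral>\<^sup>+p. ennreal (case_prod ?f p) \<partial>P)"
    by (rule nn_integral_eq_integral[symmetric, OF int])
       (auto simp: e indicator_def intro!: AE_I2 q_nonneg)
  also have "\<dots> = En (\<lambda>s. frac_grad s \<phi>)"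
    unfolding En_def by (intro nn_integral_cong) (simp add: e indicator_def case_prod_beta' mem_Times_iff)
  finally show ?thesis by simp
qed

lemma En_test_diff:
  assumes "\<phi> \<in> test_functions \<Omega>" "\<psi> \<in> test_functions \<Omega>"
  shows "En (\<lambda>s x. frac_grad s \<phi> x - frac_grad s \<psi> x) = ennreal ((norm (\<iota> \<phi> - \<iota> \<psi>))\<^sup>2)"
proof -
  have "En (\<lambda>s x. frac_grad s \<phi> x - frac_grad s \<psi> x) = En (\<lambda>s. frac_grad s (\<lambda>x. \<phi> x - \<psi> x))"
    by (intro En_cong) (simp add: frac_grad_diff[OF assms])
  then show ?thesis using En_test[OF test_functions_diff[OF assms]] \<iota>_diff[OF assms] by simp
qed

text \<open>A lower bound independent of \<open>s\<close> factorises by Tonelli. With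
  \<open>B = {0<..1}\<close> it yields finiteness of \<open>\<mu>\<close> there, with
  \<open>B = {1}\<close> control of the classical gradient.\<close>

lemma En_lower_product:
  assumes test: "\<phi> \<in> test_functions \<Omega>" and B: "B \<in> sets \<mu>" "B \<subseteq> {0<..1}"
    and g[measurable]: "g \<in> borel_measurable lebesgue"
    and le: "\<And>s x. s \<in> B \<Longrightarrow> g x \<le> ennreal (q s x (frac_grad s \<phi> x))"
  shows "emeasure \<mu> B * (\<integral>\<^sup>+x. g x \<partial>lebesgue) \<le> ennreal ((norm (\<iota> \<phi>))\<^sup>2)"
proof -
  have [measurable]: "(\<lambda>s. indicator B s :: ennreal) \<in> borel_measurable \<mu>" using B(1) by simp
  have "emeasure \<mu> B * (\<integral>\<^sup>+x. g x \<partial>lebesgue) = (\<integral>\<^sup>+s. indicator B s * (\<integral>\<^sup>+x. g x \<partial>lebesgue) \<partial>\<mu>)"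
    using B(1) by (simp add: nn_integral_multc)
  also have "\<dots> = (\<integral>\<^sup>+s. \<integral>\<^sup>+x. indicator B (fst (s, x)) * g (snd (s, x)) \<partial>lebesgue \<partial>\<mu>)"
    by (simp add: nn_integral_cmult)
  also have "\<dots> = (\<integral>\<^sup>+p. indicator B (fst p) * g (snd p) \<partial>P)"
    by (rule leb.nn_integral_fst) measurable
  also have "\<dots> \<le> En (\<lambda>s. frac_grad s \<phi>)"
    unfolding En_def using B(2) le by (intro nn_integral_mono) (auto simp: indicator_def)
  finally show ?thesis using En_test[OF test] by simp
qed

text \<open>\<open>inverse (ennreal 0)\<close> is infinite, so a finite integral forbids zeros of
  \<open>lam\<close> on a set of positive measure.\<close>

lemma AE_lam_pos: assumes "compact K" shows "AE x in lebesgue. x \<in> K \<longrightarrow> 0 < lam x"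
proof -
  have K: "K \<in> sets lebesgue" using compact_imp_closed[OF assms] by (simp add: borel_closed)
  note [measurable] = lam_meas K
  have "AE x in lebesgue. inverse (ennreal (lam x)) * indicator K x \<noteq> \<infinity>"
    using lam_int[OF assms] by (intro nn_integral_PInf_AE) auto
  then show ?thesis
    by eventually_elim (use lam_nonneg in \<open>auto simp: less_le ennreal_mult_eq_top_iff dest: sym\<close>)
qed

section \<open>Finiteness of the measure and control of L1 norms\<close>

text \<open>The measure is only assumed to be \<open>\<sigma>\<close>-finite. It is finite because the energy of a single bump
  function, whose fractional gradients are bounded below uniformly in \<open>s\<close>, is finite.\<close>

lemma mu_finite: "emeasure \<mu> {0<..1} < \<infinity>"
proof (cases "emeasure \<mu> {0<..1} = 0")
  case False
  obtain x0 where "x0 \<in> \<Omega>" using dom(2) by blast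
  then obtain e where e: "e > 0" "cball x0 e \<subseteq> \<Omega>" using dom(1) open_contains_cball by blast
  define r where "r = min e 1"
  have r: "0 < r" "r \<le> 1" using e by (auto simp: r_def)
  have cb: "cball x0 r \<subseteq> \<Omega>" using e(2) subset_cball[of r e x0] by (auto simp: r_def)
  define \<phi> where "\<phi> x = bump 0 (r\<^sup>2 - (norm (x - x0))\<^sup>2)" for x
  have test: "\<phi> \<in> test_functions \<Omega>" unfolding \<phi>_def by (rule bump_test_function[OF r(1) cb])
  obtain \<kappa> where \<kappa>: "\<kappa> > 0" "\<And>s x. s \<in> {0<..1} \<Longrightarrow> norm (x - x0) \<le> r / 2
      \<Longrightarrow> \<kappa> * norm (x - x0) \<le> norm (frac_grad s \<phi> x)"
    using frac_grad_bump_lower_bound[OF r, of x0] unfolding \<phi>_def by blast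
  have b: "ball x0 (r/2) \<in> sets lebesgue" by simp
  note [measurable] = lam_meas
  have "(\<lambda>x. norm (x - x0)) \<in> borel_measurable borel" by measurable
  then have [measurable]: "(\<lambda>x. norm (x - x0)) \<in> borel_measurable lebesgue"
    by (intro measurable_completion) simp
  define g where "g x = ennreal (lam x * (\<kappa> * norm (x - x0))\<^sup>2) * indicator (ball x0 (r/2)) x" for x
  have g[measurable]: "g \<in> borel_measurable lebesgue" 
    unfolding g_def by (rule borel_measurable_times_ennreal[OF _ borel_measurable_indicator[OF b]]) measurable
  have "emeasure \<mu> {0<..1} * (\<integral>\<^sup>+x. g x \<partial>lebesgue) \<le> ennreal ((norm (\<iota> \<phi>))\<^sup>2)"
  proof (rule En_lower_product[OF test _ subset_refl g])
    show "{0<..1} \<in> sets \<mu>" by (rule sets_mu) auto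
    fix s :: real and x :: "real^'n" assume s: "s \<in> {0<..1}"
    show "g x \<le> ennreal (q s x (frac_grad s \<phi> x))"
    proof (cases "x \<in> ball x0 (r/2)")
      case True
      then have "norm (x - x0) \<le> r / 2" by (simp add: dist_norm norm_minus_commute)
      then have "(\<kappa> * norm (x - x0))\<^sup>2 \<le> (norm (frac_grad s \<phi> x))\<^sup>2"
        using \<kappa>(1) \<kappa>(2)[OF s] by (intro power_mono) auto
      then have "lam x * (\<kappa> * norm (x - x0))\<^sup>2 \<le> lam x * (norm (frac_grad s \<phi> x))\<^sup>2"
        using lam_nonneg[of x] by (rule mult_left_mono)
      also have "\<dots> \<le> q s x (frac_grad s \<phi> x)" unfolding q_def by (rule ellipt[OF s])
      finally show ?thesis using True by (simp add: g_def ennreal_leI)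
    qed (simp add: g_def)
  qed
  \<comment> \<open>Inside the ball \<open>g\<close> vanishes only at \<open>x0\<close> and at zeros
    of \<open>lam\<close>, a null set. A positive integral times the mass of \<open>\<mu>\<close>
    being finite forces the mass to be finite.\<close>
  moreover have "(\<integral>\<^sup>+x. g x \<partial>lebesgue) \<noteq> 0"
  proof
    assume "(\<integral>\<^sup>+x. g x \<partial>lebesgue) = 0"
    then have "AE x in lebesgue. g x = 0" using nn_integral_0_iff_AE[OF g] by simp
    moreover have "AE x in lebesgue. x \<noteq> x0"
      using negligible_sing[of x0] by (intro AE_I[where N="{x0}"]) (auto simp: negligible_iff_null_sets null_sets_def)
    ultimately have "AE x in lebesgue. x \<notin> ball x0 (r/2)"
      using AE_lam_pos[OF compact_cball[of x0 r]]
    proof eventually_elim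
      fix x assume *: "g x = 0" "x \<noteq> x0" "x \<in> cball x0 r \<longrightarrow> 0 < lam x"
      show "x \<notin> ball x0 (r/2)"
      proof
        assume x: "x \<in> ball x0 (r/2)"
        then have "lam x > 0" using * r(1) by auto
        then have "lam x * (\<kappa> * norm (x - x0))\<^sup>2 > 0" using \<kappa>(1) *(2) by simp
        then show False using *(1) x by (simp add: g_def ennreal_eq_0_iff)
      qed
    qed
    moreover have "(AE x in lebesgue. x \<notin> ball x0 (r/2)) \<longleftrightarrow> emeasure lebesgue (ball x0 (r/2)) = 0"
      by (rule AE_iff_measurable[OF b]) (simp del: mem_ball)
    ultimately have "emeasure lborel (ball x0 (r/2)) = 0" by simp
    then show False using r(1) unit_ball_vol_pos[of "real CARD('n)"] by (simp add: emeasure_ball)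
  qed
  ultimately show ?thesis by (auto simp: less_top[symmetric] ennreal_top_mult ennreal_mult_eq_top_iff top_unique)
qed simp

definition m0 where "m0 = measure \<mu> {0<..1}"

lemma emeasure_m0: "emeasure \<mu> {0<..1} = ennreal m0"
  unfolding m0_def by (rule emeasure_eq_ennreal_measure) (use mu_finite in auto)

text \<open>Cauchy-Schwarz applied to \<open>sqrt (lam x) * norm (gradient \<phi> x)\<close> and
  \<open>1 / sqrt (lam x)\<close>. The positive mass of \<open>\<mu>\<close> at 1 controls the first
  factor by the energy, local integrability of the reciprocal of \<open>lam\<close> controls the
  second.\<close>

lemma gradient_bound:
  obtains C where "C > 0" "\<And>\<phi>. \<phi> \<in> test_functions \<Omega> \<Longrightarrow> (LINT x|lborel. norm (gradient \<phi> x)) \<le> C * norm (\<iota> \<phi>)"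
proof -
  define K where "K = closure \<Omega>"
  have K: "compact K" using dom(3) by (simp add: K_def compact_closure)
  have Ks[measurable]: "K \<in> sets lebesgue" using compact_imp_closed[OF K] by (simp add: borel_closed)
  define M where "M = enn2real (\<integral>\<^sup>+x\<in>K. inverse (ennreal (lam x)) \<partial>lebesgue)"
  have M: "(\<integral>\<^sup>+x\<in>K. inverse (ennreal (lam x)) \<partial>lebesgue) = ennreal M" "M \<ge> 0"
    using lam_int[OF K] by (auto simp: M_def less_top)
  have s1: "{1} \<in> sets \<mu>" by (rule sets_mu) auto
  have "emeasure \<mu> {1} \<le> emeasure \<mu> {0<..1}" by (intro emeasure_mono sets_mu) auto
  then have "emeasure \<mu> {1} < \<infinity>" using mu_finite by (rule le_less_trans)
  then obtain m1 where m1: "emeasure \<mu> {1} = ennreal m1" "m1 > 0"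
    using mu1 by (cases "emeasure \<mu> {1}") (auto simp: ennreal_less_zero_iff)
  define C where "C = sqrt (M / m1) + 1"
  have C: "C > 0" using M(2) m1 by (simp add: C_def add_nonneg_pos)
  have "(LINT x|lborel. norm (gradient \<phi> x)) \<le> C * norm (\<iota> \<phi>)" if test: "\<phi> \<in> test_functions \<Omega>" for \<phi>
  proof -
    let ?D = "LINT x|lborel. norm (gradient \<phi> x)"
    have grad[measurable]: "gradient \<phi> \<in> borel_measurable lebesgue"
      by (rule measurable_completion) (use borel_measurable_gradient[OF test] in simp)
    note [measurable] = lam_meas
    define F where "F x = ennreal (sqrt (lam x) * norm (gradient \<phi> x))" for x
    define G where "G x = ennreal (1 / sqrt (lam x)) * indicator K x" for x
    have [measurable]: "F \<in> borel_measurable lebesgue" "G \<in> borel_measurable lebesgue"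
      unfolding F_def G_def by measurable
    have "ennreal ?D = (\<integral>\<^sup>+x. ennreal (norm (gradient \<phi> x)) \<partial>lebesgue)"
      using nn_integral_eq_integral[OF integrable_test(2)[OF test]] by (simp add: nn_integral_completion)
    also have "\<dots> = (\<integral>\<^sup>+x. F x * G x \<partial>lebesgue)"
    proof (rule nn_integral_cong_AE)
      show "AE x in lebesgue. ennreal (norm (gradient \<phi> x)) = F x * G x"
        using AE_lam_pos[OF K]
      proof eventually_elim
        fix x assume *: "x \<in> K \<longrightarrow> 0 < lam x"
        show "ennreal (norm (gradient \<phi> x)) = F x * G x"
        proof (cases "x \<in> K")
          case True
          then show ?thesis using * by (simp add: F_def G_def ennreal_mult[symmetric])
        next
          case False
          then have "x \<notin> \<Omega>" using closure_subset[of \<Omega>] by (auto simp: K_def)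
          then show ?thesis using False gradient_outside[OF test] by (simp add: G_def)
        qed
      qed
    qed
    finally have eq: "ennreal ?D = (\<integral>\<^sup>+x. F x * G x \<partial>lebesgue)" .
    have F2: "ennreal m1 * (\<integral>\<^sup>+x. (F x)\<^sup>2 \<partial>lebesgue) \<le> ennreal ((norm (\<iota> \<phi>))\<^sup>2)"
      unfolding m1(1)[symmetric]
    proof (rule En_lower_product[OF test s1])
      fix s :: real and x assume "s \<in> {1}"
      then have s: "s = 1" by simp
      have "lam x * (norm (gradient \<phi> x))\<^sup>2 \<le> q 1 x (gradient \<phi> x)" unfolding q_def by (rule ellipt) simp
      then show "(F x)\<^sup>2 \<le> ennreal (q s x (frac_grad s \<phi> x))"
        using lam_nonneg[of x] by (simp add: F_def s frac_grad_1 ennreal_power power_mult_distrib ennreal_leI)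
    qed auto
    have G2: "(\<integral>\<^sup>+x. (G x)\<^sup>2 \<partial>lebesgue) \<le> ennreal M"
      unfolding M(1)[symmetric]
    proof (rule nn_integral_mono)
      fix x
      show "(G x)\<^sup>2 \<le> inverse (ennreal (lam x)) * indicator K x"
        using lam_nonneg[of x]
        by (cases "lam x = 0") (auto simp: G_def power_mult_distrib ennreal_power power_divide inverse_ennreal indicator_def divide_inverse power_inverse)
    qed
    have "ennreal (m1 * ?D\<^sup>2) = ennreal m1 * (\<integral>\<^sup>+x. F x * G x \<partial>lebesgue)\<^sup>2"
      using m1 by (simp add: eq[symmetric] ennreal_mult ennreal_power)
    also have "\<dots> \<le> ennreal m1 * ((\<integral>\<^sup>+x. (F x)\<^sup>2 \<partial>lebesgue) * (\<integral>\<^sup>+x. (G x)\<^sup>2 \<partial>lebesgue))"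
      by (intro mult_left_mono Cauchy_Schwarz_nn_integral) auto
    also have "\<dots> \<le> ennreal ((norm (\<iota> \<phi>))\<^sup>2) * ennreal M"
      unfolding mult.assoc[symmetric] by (intro mult_mono F2 G2) auto
    also have "\<dots> = ennreal (M * (norm (\<iota> \<phi>))\<^sup>2)" using M(2) by (simp add: ennreal_mult mult.commute)
    finally have "m1 * ?D\<^sup>2 \<le> M * (norm (\<iota> \<phi>))\<^sup>2" using M(2) by (simp add: ennreal_le_iff)
    then have "?D\<^sup>2 \<le> M / m1 * (norm (\<iota> \<phi>))\<^sup>2" using m1 by (simp add: field_simps)
    also have "\<dots> = (sqrt (M / m1) * norm (\<iota> \<phi>))\<^sup>2" using M(2) m1 by (simp add: power_mult_distrib)
    finally have "?D \<le> sqrt (M / m1) * norm (\<iota> \<phi>)"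
      using M(2) m1 by (intro power2_le_imp_le[of ?D]) auto
    also have "\<dots> \<le> C * norm (\<iota> \<phi>)" by (intro mult_right_mono) (auto simp: C_def)
    finally show ?thesis .
  qed
  then show ?thesis using that C by blast
qed

lemma ex_L1_bound: "\<exists>C>0. \<forall>\<phi>\<in>test_functions \<Omega>. (LINT x|lborel. \<bar>\<phi> x\<bar>) \<le> C * norm (\<iota> \<phi>)"
proof -
  obtain C where C: "C > 0" "\<And>\<phi>. \<phi> \<in> test_functions \<Omega> \<Longrightarrow> (LINT x|lborel. norm (gradient \<phi> x)) \<le> C * norm (\<iota> \<phi>)"
    using gradient_bound by blast
  obtain R where R: "R > 0" "\<Omega> \<subseteq> ball 0 R"
    using bounded_subset_ballD[OF dom(3), of 0] by blast
  have "(LINT x|lborel. \<bar>\<phi> x\<bar>) \<le> R * C * norm (\<iota> \<phi>)" if "\<phi> \<in> test_functions \<Omega>" for \<phi>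
  proof -
    have "(LINT x|lborel. \<bar>\<phi> x\<bar>) \<le> R * (LINT x|lborel. norm (gradient \<phi> x))"
      by (rule poincare_inequality[OF that R(2,1)])
    also have "\<dots> \<le> R * (C * norm (\<iota> \<phi>))" using C(2)[OF that] R(1) by (intro mult_left_mono) auto
    finally show ?thesis by (simp add: mult.assoc)
  qed
  then show ?thesis using R(1) C(1) by (intro exI[of _ "R * C"]) auto
qed

definition C1 where "C1 = (SOME C. C > 0 \<and> (\<forall>\<phi>\<in>test_functions \<Omega>. (LINT x|lborel. \<bar>\<phi> x\<bar>) \<le> C * norm (\<iota> \<phi>)))"

lemma C1: "C1 > 0" "\<phi> \<in> test_functions \<Omega> \<Longrightarrow> (LINT x|lborel. \<bar>\<phi> x\<bar>) \<le> C1 * norm (\<iota> \<phi>)"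
  using someI_ex[of "\<lambda>C. C > 0 \<and> (\<forall>\<phi>\<in>test_functions \<Omega>. (LINT x|lborel. \<bar>\<phi> x\<bar>) \<le> C * norm (\<iota> \<phi>))"] ex_L1_bound
  unfolding C1_def[symmetric] by auto


section \<open>Limits representing elements of the completion\<close>

lemma represents_eq:
  "represents \<Omega> \<mu> A \<iota> u w G \<longleftrightarrow> integrable lebesgue w \<and> (\<forall>x. x \<notin> \<Omega> \<longrightarrow> w x = 0) \<and>
     (\<lambda>p. G (fst p) (snd p)) \<in> borel_measurable P \<and>
     (\<exists>\<phi>. (\<forall>k. \<phi> k \<in> test_functions \<Omega>) \<and> (\<lambda>k. \<iota> (\<phi> k)) \<longlonglongrightarrow> u \<and>
        (\<lambda>k. LINT x|lebesgue. \<bar>\<phi> k x - w x\<bar>) \<longlonglongrightarrow> 0 \<and>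
        (\<lambda>k. En (\<lambda>s x. frac_grad s (\<phi> k) x - G s x)) \<longlonglongrightarrow> 0)"
  unfolding represents_def unfolding En_eq_set_nn_integral by (simp add: case_prod_beta')

lemma integrable_test_lebesgue: "\<phi> \<in> test_functions \<Omega> \<Longrightarrow> integrable lebesgue \<phi>"
  using integrable_test(1)[of \<phi> \<Omega>] borel_measurable_test[of \<phi> \<Omega>] by (simp add: integrable_completion)

lemma L1_test_diff:
  assumes "\<phi> \<in> test_functions \<Omega>" "\<psi> \<in> test_functions \<Omega>"
  shows "(\<integral>\<^sup>+x. ennreal \<bar>\<phi> x - \<psi> x\<bar> \<partial>lebesgue) \<le> ennreal (C1 * norm (\<iota> \<phi> - \<iota> \<psi>))"
proof -
  have t: "(\<lambda>x. \<phi> x - \<psi> x) \<in> test_functions \<Omega>" by (rule test_functions_diff[OF assms])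
  have "(\<integral>\<^sup>+x. ennreal \<bar>\<phi> x - \<psi> x\<bar> \<partial>lebesgue) = ennreal (LINT x|lborel. \<bar>\<phi> x - \<psi> x\<bar>)"
    unfolding nn_integral_completion
    by (rule nn_integral_eq_integral[OF integrable_abs[OF integrable_test(1)[OF t]]]) simp
  also have "\<dots> \<le> ennreal (C1 * norm (\<iota> \<phi> - \<iota> \<psi>))"
    using C1(2)[OF t] by (simp add: \<iota>_diff[OF assms] ennreal_leI)
  finally show ?thesis .
qed

text \<open>The rate \<open>(1/8) ^ k\<close> beats the weights \<open>4 ^ k\<close> in
  \<open>AE_convergent_of_summable_powers\<close>, for the L1 norm as well as for the squared
  norm.\<close>

lemma ex_fast_sequence:
  obtains \<phi> where "\<And>k. \<phi> k \<in> test_functions \<Omega>" "\<And>k. norm (\<iota> (\<phi> k) - u) \<le> (1/8) ^ k"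
proof -
  have "\<exists>\<phi>\<in>test_functions \<Omega>. dist (\<iota> \<phi>) u < (1/8) ^ k" for k :: nat
  proof -
    have "u \<in> closure (\<iota> ` test_functions \<Omega>)" using H0 by (simp add: is_H0_completion_def)
    then show ?thesis unfolding closure_approachable by (auto dest!: spec[of _ "(1/8) ^ k"])
  qed
  then obtain \<phi> where "\<And>k. \<phi> k \<in> test_functions \<Omega>" "\<And>k. dist (\<iota> (\<phi> k)) u < (1/8) ^ k" by metis
  then show ?thesis by (intro that[of \<phi>]) (simp_all add: dist_norm[symmetric] less_imp_le)
qed

lemma suminf_geometric_finite:
  assumes "0 \<le> B" "\<And>k. e k \<le> ennreal (B * (1/8) ^ k)"
  shows "(\<Sum>k. 4 ^ k * e k) < \<infinity>"
proof -
  have le: "4 ^ k * e k \<le> ennreal (B * (1/2) ^ k)" for k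
  proof -
    have "4 ^ k * e k \<le> 4 ^ k * ennreal (B * (1/8) ^ k)" by (intro mult_left_mono assms(2)) simp
    also have "\<dots> = ennreal (4 ^ k * (B * (1/8) ^ k))"
      using assms(1) by (simp add: ennreal_mult ennreal_power[symmetric])
    also have "(4::real) ^ k * (B * (1/8) ^ k) = B * (1/2) ^ k"
      using power_mult_distrib[of "4::real" "1/8" k] by simp
    finally show ?thesis .
  qed
  have "(\<Sum>k. 4 ^ k * e k) \<le> (\<Sum>k. ennreal (B * (1/2) ^ k))" by (intro suminf_le le summableI)
  also have "\<dots> = ennreal (\<Sum>k. B * (1/2) ^ k)"
    using assms(1) by (intro suminf_ennreal2 summable_mult summable_geometric) auto
  also have "\<dots> < \<infinity>" by simp
  finally show ?thesis .
qed

text \<open>A fast sequence of test functions and its gradients converge almost everywhere, which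
  defines \<open>w\<close> and \<open>G\<close>. Fatou's lemma then upgrades this to convergence in
  L1 and in energy, with the rate of convergence in the completion.\<close>

lemma represents_exists: "\<exists>w G. represents \<Omega> \<mu> A \<iota> u w G"
proof -
  obtain \<phi> where test: "\<And>k. \<phi> k \<in> test_functions \<Omega>" and fast: "\<And>k. norm (\<iota> (\<phi> k) - u) \<le> (1/8) ^ k"
    using ex_fast_sequence by blast
  have \<iota>lim: "(\<lambda>k. \<iota> (\<phi> k)) \<longlonglongrightarrow> u"
  proof (rule LIM_zero_cancel, rule Lim_null_comparison)
    show "eventually (\<lambda>k. norm (\<iota> (\<phi> k) - u) \<le> (1/8) ^ k) sequentially" using fast by simp
    show "(\<lambda>k. (1/8::real) ^ k) \<longlonglongrightarrow> 0" by (rule LIMSEQ_power_zero) simp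
  qed
  have step: "norm (\<iota> (\<phi> (Suc k)) - \<iota> (\<phi> k)) \<le> 2 * (1/8) ^ k" for k
  proof -
    have "norm (\<iota> (\<phi> (Suc k)) - \<iota> (\<phi> k)) \<le> norm (\<iota> (\<phi> (Suc k)) - u) + norm (\<iota> (\<phi> k) - u)"
      using norm_triangle_ineq4[of "\<iota> (\<phi> (Suc k)) - u" "\<iota> (\<phi> k) - u"] by simp
    moreover have "(1/8::real) ^ Suc k \<le> (1/8) ^ k" by (rule power_decreasing) auto
    ultimately show ?thesis using fast[of k] fast[of "Suc k"] by linarith
  qed
  have tm[measurable]: "\<phi> k \<in> borel_measurable lebesgue" for k
    using integrable_test_lebesgue[OF test] by (rule borel_measurable_integrable)
  have Dm[measurable]: "(\<lambda>p. Dg (\<phi> k) (fst p) (snd p)) \<in> borel_measurable P" for k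
    by (rule measurable_Dg[OF test])
  define w where "w x = lim (\<lambda>k. \<phi> k x)" for x
  define G where "G s x = lim (\<lambda>k. Dg (\<phi> k) s x)" for s x
  have wm[measurable]: "w \<in> borel_measurable lebesgue" unfolding w_def by measurable
  have Gm: "(\<lambda>p. G (fst p) (snd p)) \<in> borel_measurable P" unfolding G_def by measurable
  have w_AE: "AE x in lebesgue. (\<lambda>k. \<phi> k x) \<longlonglongrightarrow> w x"
  proof -
    have "AE x in lebesgue. convergent (\<lambda>k. \<phi> k x)"
    proof (rule AE_convergent_of_summable_powers[where m=1 and d="\<lambda>k x. ennreal \<bar>\<phi> (Suc k) x - \<phi> k x\<bar>"])
      show "(\<Sum>k. 4 ^ k * (\<integral>\<^sup>+x. ennreal \<bar>\<phi> (Suc k) x - \<phi> k x\<bar> \<partial>lebesgue)) < \<infinity>"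
      proof (rule suminf_geometric_finite[of "C1 * 2"])
        fix k
        have "C1 * norm (\<iota> (\<phi> (Suc k)) - \<iota> (\<phi> k)) \<le> C1 * 2 * (1/8) ^ k"
          using mult_left_mono[OF step[of k], of C1] C1(1) by simp
        then show "(\<integral>\<^sup>+x. ennreal \<bar>\<phi> (Suc k) x - \<phi> k x\<bar> \<partial>lebesgue) \<le> ennreal (C1 * 2 * (1/8) ^ k)"
          using L1_test_diff[OF test test] ennreal_leI order_trans by blast
      qed (use C1(1) in simp)
    qed (auto intro!: exI[of _ 1])
    then show ?thesis by eventually_elim (simp add: w_def convergent_LIMSEQ_iff)
  qed
  have G_AE: "AE p in P. (\<lambda>k. Dg (\<phi> k) (fst p) (snd p)) \<longlonglongrightarrow> G (fst p) (snd p)"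
  proof -
    let ?\<Delta> = "\<lambda>k s x. Dg (\<phi> (Suc k)) s x - Dg (\<phi> k) s x"
    let ?d = "\<lambda>k p. ennreal (q (fst p) (snd p) (?\<Delta> k (fst p) (snd p))) * indicator ({0<..1} \<times> UNIV) p"
    have "AE p in P. convergent (\<lambda>k. Dg (\<phi> k) (fst p) (snd p))"
    proof (rule AE_convergent_of_summable_powers[where m=2 and d="?d"])
      have "(\<lambda>p. q (fst p) (snd p) (?\<Delta> k (fst p) (snd p))) \<in> borel_measurable P" for k
        by (rule measurable_q) measurable
      then show "?d k \<in> borel_measurable P" for k by measurable
      show "(\<Sum>k. 4 ^ k * (\<integral>\<^sup>+p. ?d k p \<partial>P)) < \<infinity>"
      proof (rule suminf_geometric_finite[of 4])
        fix k
        have "(\<integral>\<^sup>+p. ?d k p \<partial>P) = En (?\<Delta> k)" by (simp add: En_def)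
        also have "\<dots> = En (\<lambda>s x. frac_grad s (\<phi> (Suc k)) x - frac_grad s (\<phi> k) x)"
          by (rule En_cong) (simp add: Dg_def)
        also have "\<dots> = ennreal ((norm (\<iota> (\<phi> (Suc k)) - \<iota> (\<phi> k)))\<^sup>2)" by (rule En_test_diff[OF test test])
        also have "\<dots> \<le> ennreal (4 * (1/8) ^ k)"
        proof (rule ennreal_leI)
          have "(norm (\<iota> (\<phi> (Suc k)) - \<iota> (\<phi> k)))\<^sup>2 \<le> (2 * (1/8) ^ k)\<^sup>2" by (rule power_mono[OF step]) simp
          also have "\<dots> = 4 * ((1/8) ^ k * (1/8) ^ k)" by (simp add: power2_eq_square)
          also have "\<dots> \<le> 4 * ((1/8) ^ k * 1)" by (intro mult_left_mono power_le_one) auto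
          finally show "(norm (\<iota> (\<phi> (Suc k)) - \<iota> (\<phi> k)))\<^sup>2 \<le> 4 * (1/8) ^ k" by simp
        qed
        finally show "(\<integral>\<^sup>+p. ?d k p \<partial>P) \<le> ennreal (4 * (1/8) ^ k)" .
      qed simp
      fix p assume "p \<in> space P"
      show "\<exists>c>0. \<forall>k. ennreal (c * norm (Dg (\<phi> (Suc k)) (fst p) (snd p) - Dg (\<phi> k) (fst p) (snd p)) ^ 2) \<le> ?d k p"
      proof (cases "fst p \<in> {0<..1}")
        case True
        then obtain c where "c > 0" "\<And>\<xi>. c * (norm \<xi>)\<^sup>2 \<le> q (fst p) (snd p) \<xi>" using q_lower by blast
        then show ?thesis using True by (intro exI[of _ c]) (auto simp: mem_Times_iff intro!: ennreal_leI)
      next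
        case False
        then show ?thesis by (intro exI[of _ 1]) (simp add: Dg_def)
      qed
    qed simp
    then show ?thesis by eventually_elim (simp add: G_def convergent_LIMSEQ_iff)
  qed
  have L1: "(\<integral>\<^sup>+x. ennreal \<bar>\<phi> k x - w x\<bar> \<partial>lebesgue) \<le> ennreal (C1 * norm (\<iota> (\<phi> k) - u))" for k
  proof -
    have "(\<integral>\<^sup>+x. ennreal \<bar>\<phi> k x - w x\<bar> \<partial>lebesgue) = (\<integral>\<^sup>+x. liminf (\<lambda>j. ennreal \<bar>\<phi> k x - \<phi> j x\<bar>) \<partial>lebesgue)"
    proof (rule nn_integral_cong_AE)
      show "AE x in lebesgue. ennreal \<bar>\<phi> k x - w x\<bar> = liminf (\<lambda>j. ennreal \<bar>\<phi> k x - \<phi> j x\<bar>)"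
        using w_AE
      proof eventually_elim
        fix x assume *: "(\<lambda>j. \<phi> j x) \<longlonglongrightarrow> w x"
        have "(\<lambda>j. ennreal \<bar>\<phi> k x - \<phi> j x\<bar>) \<longlonglongrightarrow> ennreal \<bar>\<phi> k x - w x\<bar>"
          by (intro tendsto_ennrealI tendsto_intros *)
        then show "ennreal \<bar>\<phi> k x - w x\<bar> = liminf (\<lambda>j. ennreal \<bar>\<phi> k x - \<phi> j x\<bar>)"
          by (intro lim_imp_Liminf[symmetric]) auto
      qed
    qed
    also have "\<dots> \<le> liminf (\<lambda>j. \<integral>\<^sup>+x. ennreal \<bar>\<phi> k x - \<phi> j x\<bar> \<partial>lebesgue)"
      by (rule nn_integral_liminf) measurable
    also have "\<dots> \<le> liminf (\<lambda>j. ennreal (C1 * norm (\<iota> (\<phi> k) - \<iota> (\<phi> j))))"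
      by (rule Liminf_mono) (simp add: L1_test_diff[OF test test])
    also have "\<dots> = ennreal (C1 * norm (\<iota> (\<phi> k) - u))"
      by (rule lim_imp_Liminf) (auto intro!: tendsto_ennrealI tendsto_intros \<iota>lim)
    finally show ?thesis .
  qed
  have E: "En (\<lambda>s x. frac_grad s (\<phi> k) x - G s x) \<le> ennreal ((norm (\<iota> (\<phi> k) - u))\<^sup>2)" for k
  proof -
    let ?F = "\<lambda>H p. ennreal (q (fst p) (snd p) (Dg (\<phi> k) (fst p) (snd p) - H (fst p) (snd p))) * indicator ({0<..1} \<times> UNIV) p"
    have m: "?F (Dg (\<phi> j)) \<in> borel_measurable P" for j
    proof -
      have "(\<lambda>p. q (fst p) (snd p) (Dg (\<phi> k) (fst p) (snd p) - Dg (\<phi> j) (fst p) (snd p))) \<in> borel_measurable P"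
        by (rule measurable_q) measurable
      then show ?thesis by measurable
    qed
    have "En (\<lambda>s x. frac_grad s (\<phi> k) x - G s x) = En (\<lambda>s x. Dg (\<phi> k) s x - G s x)"
      by (rule En_cong) (simp add: Dg_def)
    also have "\<dots> = (\<integral>\<^sup>+p. ?F G p \<partial>P)" by (simp add: En_def)
    also have "\<dots> = (\<integral>\<^sup>+p. liminf (\<lambda>j. ?F (Dg (\<phi> j)) p) \<partial>P)"
    proof (rule nn_integral_cong_AE)
      show "AE p in P. ?F G p = liminf (\<lambda>j. ?F (Dg (\<phi> j)) p)"
        using G_AE
      proof eventually_elim
        fix p assume *: "(\<lambda>j. Dg (\<phi> j) (fst p) (snd p)) \<longlonglongrightarrow> G (fst p) (snd p)"
        have "(\<lambda>j. ennreal (q (fst p) (snd p) (Dg (\<phi> k) (fst p) (snd p) - Dg (\<phi> j) (fst p) (snd p))))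
            \<longlonglongrightarrow> ennreal (q (fst p) (snd p) (Dg (\<phi> k) (fst p) (snd p) - G (fst p) (snd p)))"
          by (intro tendsto_ennrealI q_tendsto tendsto_diff tendsto_const *)
        then have "(\<lambda>j. ?F (Dg (\<phi> j)) p) \<longlonglongrightarrow> ?F G p" by (cases "p \<in> {0<..1} \<times> UNIV") auto
        then show "?F G p = liminf (\<lambda>j. ?F (Dg (\<phi> j)) p)" by (intro lim_imp_Liminf[symmetric]) auto
      qed
    qed
    also have "\<dots> \<le> liminf (\<lambda>j. \<integral>\<^sup>+p. ?F (Dg (\<phi> j)) p \<partial>P)" by (rule nn_integral_liminf) (rule m)
    also have "(\<lambda>j. \<integral>\<^sup>+p. ?F (Dg (\<phi> j)) p \<partial>P) = (\<lambda>j. ennreal ((norm (\<iota> (\<phi> k) - \<iota> (\<phi> j)))\<^sup>2))"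
    proof
      fix j
      have "(\<integral>\<^sup>+p. ?F (Dg (\<phi> j)) p \<partial>P) = En (\<lambda>s x. Dg (\<phi> k) s x - Dg (\<phi> j) s x)" by (simp add: En_def)
      also have "\<dots> = En (\<lambda>s x. frac_grad s (\<phi> k) x - frac_grad s (\<phi> j) x)"
        by (rule En_cong) (simp add: Dg_def)
      finally show "(\<integral>\<^sup>+p. ?F (Dg (\<phi> j)) p \<partial>P) = ennreal ((norm (\<iota> (\<phi> k) - \<iota> (\<phi> j)))\<^sup>2)"
        using En_test_diff[OF test test] by simp
    qed
    also have "liminf \<dots> = ennreal ((norm (\<iota> (\<phi> k) - u))\<^sup>2)"
      by (rule lim_imp_Liminf) (auto intro!: tendsto_ennrealI tendsto_intros \<iota>lim)
    finally show ?thesis .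
  qed
  have norm0: "(\<lambda>k. norm (\<iota> (\<phi> k) - u)) \<longlonglongrightarrow> 0" using \<iota>lim by (simp add: LIM_zero tendsto_norm_zero)
  have intd: "integrable lebesgue (\<lambda>x. \<phi> k x - w x)" for k
    using L1[of k] by (intro integrableI_bounded) (auto intro: le_less_trans)
  have "integrable lebesgue (\<lambda>x. \<phi> 0 x - (\<phi> 0 x - w x))"
    by (intro Bochner_Integration.integrable_diff integrable_test_lebesgue test intd)
  then have 1: "integrable lebesgue w" by simp
  \<comment> \<open>All approximants vanish at \<open>x\<close>, so the limit is 0 at every point
    outside \<open>\<Omega>\<close>, not merely almost everywhere.\<close>
  have 2: "w x = 0" if "x \<notin> \<Omega>" for x
    using test_outside[OF test that] by (simp add: w_def)
  have 3: "(\<lambda>k. LINT x|lebesgue. \<bar>\<phi> k x - w x\<bar>) \<longlonglongrightarrow> 0"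
  proof (rule Lim_null_comparison)
    show "eventually (\<lambda>k. norm (LINT x|lebesgue. \<bar>\<phi> k x - w x\<bar>) \<le> C1 * norm (\<iota> (\<phi> k) - u)) sequentially"
    proof (intro always_eventually allI)
      fix k
      have "ennreal (LINT x|lebesgue. \<bar>\<phi> k x - w x\<bar>) = (\<integral>\<^sup>+x. ennreal \<bar>\<phi> k x - w x\<bar> \<partial>lebesgue)"
        by (rule nn_integral_eq_integral[OF integrable_abs[OF intd], symmetric]) simp
      also note L1[of k]
      finally have "(LINT x|lebesgue. \<bar>\<phi> k x - w x\<bar>) \<le> C1 * norm (\<iota> (\<phi> k) - u)"
        using C1(1) by (subst (asm) ennreal_le_iff) auto
      then show "norm (LINT x|lebesgue. \<bar>\<phi> k x - w x\<bar>) \<le> C1 * norm (\<iota> (\<phi> k) - u)"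
        by simp
    qed
    show "(\<lambda>k. C1 * norm (\<iota> (\<phi> k) - u)) \<longlonglongrightarrow> 0" using tendsto_mult_right_zero[OF norm0] .
  qed
  have 4: "(\<lambda>k. En (\<lambda>s x. frac_grad s (\<phi> k) x - G s x)) \<longlonglongrightarrow> 0"
  proof (rule tendsto_sandwich[where f="\<lambda>k. 0"])
    have "(\<lambda>k. ennreal ((norm (\<iota> (\<phi> k) - u))\<^sup>2)) \<longlonglongrightarrow> ennreal (0\<^sup>2)"
      by (intro tendsto_ennrealI tendsto_power norm0)
    then show "(\<lambda>k. ennreal ((norm (\<iota> (\<phi> k) - u))\<^sup>2)) \<longlonglongrightarrow> 0" by simp
  qed (use E in auto)
  show ?thesis unfolding represents_eq using 1 2 Gm test \<iota>lim 3 4 by blast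
qed

lemma En_add:
  assumes "(\<lambda>p. X (fst p) (snd p)) \<in> borel_measurable P" "(\<lambda>p. Y (fst p) (snd p)) \<in> borel_measurable P"
    and Z: "\<And>s x. s \<in> {0<..1} \<Longrightarrow> Z s x = X s x + Y s x"
  shows "En Z \<le> 2 * En X + 2 * En Y"
proof -
  note [measurable] = measurable_q[OF assms(1)] measurable_q[OF assms(2)]
  let ?e = "\<lambda>X p. ennreal (q (fst p) (snd p) (X (fst p) (snd p))) * indicator ({0<..1} \<times> UNIV) p"
  have "En Z \<le> (\<integral>\<^sup>+p. 2 * ?e X p + 2 * ?e Y p \<partial>P)"
    unfolding En_def
  proof (rule nn_integral_mono)
    fix p
    show "?e Z p \<le> 2 * ?e X p + 2 * ?e Y p"
    proof (cases "fst p \<in> {0<..1}")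
      case True
      have "ennreal (q (fst p) (snd p) (Z (fst p) (snd p)))
          \<le> ennreal (2 * q (fst p) (snd p) (X (fst p) (snd p)) + 2 * q (fst p) (snd p) (Y (fst p) (snd p)))"
        unfolding Z[OF True] by (intro ennreal_leI q_add[OF True])
      also have "\<dots> = 2 * ennreal (q (fst p) (snd p) (X (fst p) (snd p))) + 2 * ennreal (q (fst p) (snd p) (Y (fst p) (snd p)))"
        using q_nonneg[OF True] by (simp add: ennreal_mult)
      finally show ?thesis using True by (simp add: mem_Times_iff)
    qed (simp add: mem_Times_iff)
  qed
  also have "\<dots> = 2 * En X + 2 * En Y"
    unfolding En_def by (subst nn_integral_add) (simp_all add: nn_integral_cmult)
  finally show ?thesis .
qed

lemma En_scale: "(\<lambda>p. X (fst p) (snd p)) \<in> borel_measurable P \<Longrightarrow> En (\<lambda>s x. c *\<^sub>R X s x) = ennreal (c\<^sup>2) * En X"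
  unfolding En_def using measurable_q[of X]
  by (subst nn_integral_cmult[symmetric]) (auto simp: q_scale ennreal_mult' mult.assoc)

text \<open>Approximating sequences are combined linearly; the factor 2 lost in
  \<open>En_add\<close> is harmless because both errors tend to 0.\<close>

lemma represents_linear_combination:
  assumes "represents \<Omega> \<mu> A \<iota> u w G" "represents \<Omega> \<mu> A \<iota> v z H"
  shows "represents \<Omega> \<mu> A \<iota> (c *\<^sub>R u + d *\<^sub>R v) (\<lambda>x. c * w x + d * z x) (\<lambda>s x. c *\<^sub>R G s x + d *\<^sub>R H s x)"
proof -
  from assms obtain \<phi> \<psi> where
    w: "integrable lebesgue w" "\<And>x. x \<notin> \<Omega> \<Longrightarrow> w x = 0" and
    z: "integrable lebesgue z" "\<And>x. x \<notin> \<Omega> \<Longrightarrow> z x = 0" and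
    G[measurable]: "(\<lambda>p. G (fst p) (snd p)) \<in> borel_measurable P" and
    H[measurable]: "(\<lambda>p. H (fst p) (snd p)) \<in> borel_measurable P" and
    \<phi>: "\<And>k. \<phi> k \<in> test_functions \<Omega>" "(\<lambda>k. \<iota> (\<phi> k)) \<longlonglongrightarrow> u"
      "(\<lambda>k. LINT x|lebesgue. \<bar>\<phi> k x - w x\<bar>) \<longlonglongrightarrow> 0"
      "(\<lambda>k. En (\<lambda>s x. frac_grad s (\<phi> k) x - G s x)) \<longlonglongrightarrow> 0" and
    \<psi>: "\<And>k. \<psi> k \<in> test_functions \<Omega>" "(\<lambda>k. \<iota> (\<psi> k)) \<longlonglongrightarrow> v"
      "(\<lambda>k. LINT x|lebesgue. \<bar>\<psi> k x - z x\<bar>) \<longlonglongrightarrow> 0"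
      "(\<lambda>k. En (\<lambda>s x. frac_grad s (\<psi> k) x - H s x)) \<longlonglongrightarrow> 0"
    unfolding represents_eq by blast
  define \<theta> where "\<theta> k x = c * \<phi> k x + d * \<psi> k x" for k x
  have \<theta>_eq: "\<theta> k = (\<lambda>x. c * \<phi> k x + d * \<psi> k x)" for k by (simp add: \<theta>_def fun_eq_iff)
  have \<theta>: "\<theta> k \<in> test_functions \<Omega>" for k
    unfolding \<theta>_def by (rule test_functions_linear_combination[OF \<phi>(1) \<psi>(1)])
  have 1: "integrable lebesgue (\<lambda>x. c * w x + d * z x)" using w(1) z(1) by simp
  have 2: "(\<lambda>k. \<iota> (\<theta> k)) \<longlonglongrightarrow> c *\<^sub>R u + d *\<^sub>R v"
    unfolding \<theta>_def \<iota>_lin[OF \<phi>(1) \<psi>(1)] by (intro tendsto_intros \<phi>(2) \<psi>(2))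
  have 3: "(\<lambda>k. LINT x|lebesgue. \<bar>\<theta> k x - (c * w x + d * z x)\<bar>) \<longlonglongrightarrow> 0"
  proof (rule Lim_null_comparison)
    let ?b = "\<lambda>k. \<bar>c\<bar> * (LINT x|lebesgue. \<bar>\<phi> k x - w x\<bar>) + \<bar>d\<bar> * (LINT x|lebesgue. \<bar>\<psi> k x - z x\<bar>)"
    show "eventually (\<lambda>k. norm (LINT x|lebesgue. \<bar>\<theta> k x - (c * w x + d * z x)\<bar>) \<le> ?b k) sequentially"
    proof (intro always_eventually allI)
      fix k
      have i: "integrable lebesgue (\<lambda>x. \<bar>\<phi> k x - w x\<bar>)" "integrable lebesgue (\<lambda>x. \<bar>\<psi> k x - z x\<bar>)"
        using w(1) z(1) integrable_test_lebesgue[OF \<phi>(1)] integrable_test_lebesgue[OF \<psi>(1)] by auto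
      have "(LINT x|lebesgue. \<bar>\<theta> k x - (c * w x + d * z x)\<bar>)
          \<le> (LINT x|lebesgue. \<bar>c\<bar> * \<bar>\<phi> k x - w x\<bar> + \<bar>d\<bar> * \<bar>\<psi> k x - z x\<bar>)"
      proof (rule integral_mono)
        show "integrable lebesgue (\<lambda>x. \<bar>\<theta> k x - (c * w x + d * z x)\<bar>)"
          using integrable_test_lebesgue[OF \<theta>] 1 by auto
        show "integrable lebesgue (\<lambda>x. \<bar>c\<bar> * \<bar>\<phi> k x - w x\<bar> + \<bar>d\<bar> * \<bar>\<psi> k x - z x\<bar>)" using i by auto
        fix x
        have "\<theta> k x - (c * w x + d * z x) = c * (\<phi> k x - w x) + d * (\<psi> k x - z x)"
          by (simp add: \<theta>_def algebra_simps)
        then show "\<bar>\<theta> k x - (c * w x + d * z x)\<bar> \<le> \<bar>c\<bar> * \<bar>\<phi> k x - w x\<bar> + \<bar>d\<bar> * \<bar>\<psi> k x - z x\<bar>"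
          using abs_triangle_ineq[of "c * (\<phi> k x - w x)" "d * (\<psi> k x - z x)"] by (simp only: abs_mult)
      qed
      also have "\<dots> = ?b k" using i by simp
      finally show "norm (LINT x|lebesgue. \<bar>\<theta> k x - (c * w x + d * z x)\<bar>) \<le> ?b k" by simp
    qed
    show "?b \<longlonglongrightarrow> 0" using tendsto_add[OF tendsto_mult_right_zero[OF \<phi>(3)] tendsto_mult_right_zero[OF \<psi>(3)]] by simp
  qed
  have 4: "(\<lambda>k. En (\<lambda>s x. frac_grad s (\<theta> k) x - (c *\<^sub>R G s x + d *\<^sub>R H s x))) \<longlonglongrightarrow> 0"
  proof (rule tendsto_sandwich[where f="\<lambda>k. 0"])
    let ?b = "\<lambda>k. 2 * (ennreal (c\<^sup>2) * En (\<lambda>s x. frac_grad s (\<phi> k) x - G s x))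
        + 2 * (ennreal (d\<^sup>2) * En (\<lambda>s x. frac_grad s (\<psi> k) x - H s x))"
    show "eventually (\<lambda>k. En (\<lambda>s x. frac_grad s (\<theta> k) x - (c *\<^sub>R G s x + d *\<^sub>R H s x)) \<le> ?b k) sequentially"
    proof (intro always_eventually allI)
      fix k
      let ?X = "\<lambda>s x. Dg (\<phi> k) s x - G s x" and ?Y = "\<lambda>s x. Dg (\<psi> k) s x - H s x"
      note [measurable] = measurable_Dg[OF \<phi>(1)] measurable_Dg[OF \<psi>(1)]
      have X: "(\<lambda>p. ?X (fst p) (snd p)) \<in> borel_measurable P" and Y: "(\<lambda>p. ?Y (fst p) (snd p)) \<in> borel_measurable P"
        by measurable
      have X': "(\<lambda>p. c *\<^sub>R ?X (fst p) (snd p)) \<in> borel_measurable P" and Y': "(\<lambda>p. d *\<^sub>R ?Y (fst p) (snd p)) \<in> borel_measurable P"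
        by measurable
      have "En (\<lambda>s x. frac_grad s (\<theta> k) x - (c *\<^sub>R G s x + d *\<^sub>R H s x))
          \<le> 2 * En (\<lambda>s x. c *\<^sub>R ?X s x) + 2 * En (\<lambda>s x. d *\<^sub>R ?Y s x)"
        by (rule En_add[OF X' Y'])
           (simp add: \<theta>_eq Dg_def frac_grad_linear_combination[OF \<phi>(1) \<psi>(1)] algebra_simps)
      also have "En (\<lambda>s x. c *\<^sub>R ?X s x) = ennreal (c\<^sup>2) * En ?X" by (rule En_scale[OF X])
      also have "En (\<lambda>s x. d *\<^sub>R ?Y s x) = ennreal (d\<^sup>2) * En ?Y" by (rule En_scale[OF Y])
      also have "En ?X = En (\<lambda>s x. frac_grad s (\<phi> k) x - G s x)" by (rule En_cong) (simp add: Dg_def)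
      also have "En ?Y = En (\<lambda>s x. frac_grad s (\<psi> k) x - H s x)" by (rule En_cong) (simp add: Dg_def)
      finally show "En (\<lambda>s x. frac_grad s (\<theta> k) x - (c *\<^sub>R G s x + d *\<^sub>R H s x)) \<le> ?b k" .
    qed
    have "?b \<longlonglongrightarrow> 2 * (ennreal (c\<^sup>2) * 0) + 2 * (ennreal (d\<^sup>2) * 0)"
      by (intro tendsto_add ennreal_tendsto_cmult \<phi>(4) \<psi>(4)) auto
    then show "?b \<longlonglongrightarrow> 0" by simp
  qed auto
  have "(\<lambda>p. c *\<^sub>R G (fst p) (snd p) + d *\<^sub>R H (fst p) (snd p)) \<in> borel_measurable P" by measurable
  then show ?thesis unfolding represents_eq using 1 2 3 4 \<theta> w(2) z(2) by auto
qed

text \<open>The factors \<open>2\<close> could be removed, but two-sided bounds suffice for coercivity.\<close>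

lemma represents_bounds:
  assumes "represents \<Omega> \<mu> A \<iota> u w G"
  shows "En G \<le> ennreal (2 * (norm u)\<^sup>2)" "ennreal ((norm u)\<^sup>2) \<le> 2 * En G"
    "(LINT x|lebesgue. \<bar>w x\<bar>) \<le> C1 * norm u"
proof -
  from assms obtain \<phi> where
    w: "integrable lebesgue w" and
    G[measurable]: "(\<lambda>p. G (fst p) (snd p)) \<in> borel_measurable P" and
    \<phi>: "\<And>k. \<phi> k \<in> test_functions \<Omega>" "(\<lambda>k. \<iota> (\<phi> k)) \<longlonglongrightarrow> u"
      "(\<lambda>k. LINT x|lebesgue. \<bar>\<phi> k x - w x\<bar>) \<longlonglongrightarrow> 0"
      "(\<lambda>k. En (\<lambda>s x. frac_grad s (\<phi> k) x - G s x)) \<longlonglongrightarrow> 0"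
    unfolding represents_eq by blast
  let ?R = "\<lambda>k. En (\<lambda>s x. frac_grad s (\<phi> k) x - G s x)"
  note [measurable] = measurable_Dg[OF \<phi>(1)]
  have Dm: "(\<lambda>p. Dg (\<phi> k) (fst p) (snd p)) \<in> borel_measurable P"
    "(\<lambda>p. Dg (\<phi> k) (fst p) (snd p) - G (fst p) (snd p)) \<in> borel_measurable P"
    "(\<lambda>p. G (fst p) (snd p) - Dg (\<phi> k) (fst p) (snd p)) \<in> borel_measurable P" for k by measurable
  have D: "En (Dg (\<phi> k)) = ennreal ((norm (\<iota> (\<phi> k)))\<^sup>2)" for k
    unfolding En_test[OF \<phi>(1), symmetric] by (rule En_cong) (simp add: Dg_def)
  have R: "En (\<lambda>s x. Dg (\<phi> k) s x - G s x) = ?R k" "En (\<lambda>s x. G s x - Dg (\<phi> k) s x) = ?R k" for k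
    by (rule En_cong, simp add: Dg_def) (rule En_cong, simp add: Dg_def q_minus[symmetric, of _ _ "G _ _ - _"])
  have n: "(\<lambda>k. ennreal ((norm (\<iota> (\<phi> k)))\<^sup>2)) \<longlonglongrightarrow> ennreal ((norm u)\<^sup>2)"
    by (intro tendsto_ennrealI tendsto_intros \<phi>(2))
  have "En G \<le> 2 * ennreal ((norm (\<iota> (\<phi> k)))\<^sup>2) + 2 * ?R k" for k
    using En_add[OF Dm(1) Dm(3), of G k k] by (simp add: D R)
  moreover have "(\<lambda>k. 2 * ennreal ((norm (\<iota> (\<phi> k)))\<^sup>2) + 2 * ?R k) \<longlonglongrightarrow> 2 * ennreal ((norm u)\<^sup>2) + 2 * 0"
    by (intro tendsto_add ennreal_tendsto_cmult n \<phi>(4)) auto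
  ultimately have "En G \<le> 2 * ennreal ((norm u)\<^sup>2) + 2 * 0" by (intro LIMSEQ_le_const) auto
  then show "En G \<le> ennreal (2 * (norm u)\<^sup>2)" by (simp add: ennreal_mult)
  have "ennreal ((norm (\<iota> (\<phi> k)))\<^sup>2) \<le> 2 * En G + 2 * ?R k" for k
    using En_add[OF G Dm(2), of "Dg (\<phi> k)" k] by (simp add: D R)
  moreover have "(\<lambda>k. 2 * En G + 2 * ?R k) \<longlonglongrightarrow> 2 * En G + 2 * 0"
    by (intro tendsto_add ennreal_tendsto_cmult \<phi>(4) tendsto_const) auto
  ultimately have "ennreal ((norm u)\<^sup>2) \<le> 2 * En G + 2 * 0" by (intro LIMSEQ_le[OF n]) auto
  then show "ennreal ((norm u)\<^sup>2) \<le> 2 * En G" by simp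
  have "(LINT x|lebesgue. \<bar>w x\<bar>) \<le> (LINT x|lebesgue. \<bar>\<phi> k x - w x\<bar>) + C1 * norm (\<iota> (\<phi> k))" for k
  proof -
    have i: "integrable lebesgue (\<phi> k)" by (rule integrable_test_lebesgue[OF \<phi>(1)])
    have "(LINT x|lebesgue. \<bar>w x\<bar>) \<le> (LINT x|lebesgue. \<bar>\<phi> k x - w x\<bar> + \<bar>\<phi> k x\<bar>)"
      using i w by (intro integral_mono) auto
    also have "\<dots> = (LINT x|lebesgue. \<bar>\<phi> k x - w x\<bar>) + (LINT x|lebesgue. \<bar>\<phi> k x\<bar>)" using i w by simp
    also have "(LINT x|lebesgue. \<bar>\<phi> k x\<bar>) = (LINT x|lborel. \<bar>\<phi> k x\<bar>)"
      by (rule integral_completion) (use borel_measurable_test[OF \<phi>(1)] in simp)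
    finally show ?thesis using C1(2)[OF \<phi>(1)[of k]] by simp
  qed
  moreover have "(\<lambda>k. (LINT x|lebesgue. \<bar>\<phi> k x - w x\<bar>) + C1 * norm (\<iota> (\<phi> k))) \<longlonglongrightarrow> 0 + C1 * norm u"
    by (intro tendsto_intros \<phi>(3) \<phi>(2))
  ultimately have "(LINT x|lebesgue. \<bar>w x\<bar>) \<le> 0 + C1 * norm u" by (intro LIMSEQ_le_const) auto
  then show "(LINT x|lebesgue. \<bar>w x\<bar>) \<le> C1 * norm u" by simp
qed

text \<open>By linearity this amounts to almost everywhere uniqueness of representatives, which
  makes the choices behind \<open>H0_fun\<close> and \<open>H0_grad\<close> harmless.\<close>

lemma represents_0:
  assumes "represents \<Omega> \<mu> A \<iota> 0 w G"
  shows "AE x in lebesgue. w x = 0" "AE p in P. fst p \<in> {0<..1} \<longrightarrow> G (fst p) (snd p) = 0"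
proof -
  have w: "integrable lebesgue w" and G: "(\<lambda>p. G (fst p) (snd p)) \<in> borel_measurable P"
    using assms by (auto simp: represents_eq)
  have "(LINT x|lebesgue. \<bar>w x\<bar>) \<le> 0" using represents_bounds(3)[OF assms] by simp
  then have "(LINT x|lebesgue. \<bar>w x\<bar>) = 0" by (intro antisym Bochner_Integration.integral_nonneg) auto
  then show "AE x in lebesgue. w x = 0"
    using integral_nonneg_eq_0_iff_AE[of lebesgue "\<lambda>x. \<bar>w x\<bar>"] w by simp
  note [measurable] = measurable_q[OF G]
  have "En G = 0" using represents_bounds(1)[OF assms] by simp
  then have "AE p in P. ennreal (q (fst p) (snd p) (G (fst p) (snd p))) * indicator ({0<..1} \<times> UNIV) p = 0"
    unfolding En_def by (subst (asm) nn_integral_0_iff_AE) auto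
  then show "AE p in P. fst p \<in> {0<..1} \<longrightarrow> G (fst p) (snd p) = 0"
  proof eventually_elim
    fix p assume *: "ennreal (q (fst p) (snd p) (G (fst p) (snd p))) * indicator ({0<..1} \<times> UNIV) p = 0"
    show "fst p \<in> {0<..1} \<longrightarrow> G (fst p) (snd p) = 0"
    proof
      assume s: "fst p \<in> {0<..1}"
      then have "q (fst p) (snd p) (G (fst p) (snd p)) \<le> 0" using * by (simp add: mem_Times_iff ennreal_eq_0_iff)
      then show "G (fst p) (snd p) = 0" using q_nonneg[OF s] q_eq_0[OF s] by (meson antisym)
    qed
  qed
qed

end


section \<open>The forms of the operators\<close>

text \<open>Rescaling both arguments to unit length turns the sum of squared norms into twice the
  product of the norms.\<close>

lemma bounded_bilinear_of_quadratic_bound: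
  fixes B :: "'h::real_inner \<Rightarrow> 'h \<Rightarrow> real"
  assumes left: "\<And>c d u u' v. B (c *\<^sub>R u + d *\<^sub>R u') v = c * B u v + d * B u' v"
    and right: "\<And>c d u v v'. B u (c *\<^sub>R v + d *\<^sub>R v') = c * B u v + d * B u v'"
    and bd: "\<And>u v. \<bar>B u v\<bar> \<le> C * ((norm u)\<^sup>2 + (norm v)\<^sup>2)"
  shows "bounded_bilinear B"
proof
  fix a a' b b' and r :: real
  show "B (a + a') b = B a b + B a' b" using left[of 1 a 1 a' b] by simp
  show "B a (b + b') = B a b + B a b'" using right[of a 1 b 1 b'] by simp
  have l0: "B (r *\<^sub>R a) b = r * B a b" for r a b using left[of r a 0 a b] by simp
  have r0: "B a (r *\<^sub>R b) = r * B a b" for r a b using right[of a r b 0 b] by simp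
  show "B (r *\<^sub>R a) b = r *\<^sub>R B a b" "B a (r *\<^sub>R b) = r *\<^sub>R B a b" using l0 r0 by auto
  show "\<exists>K. \<forall>a b. norm (B a b) \<le> norm a * norm b * K"
  proof (intro exI allI)
    fix a b
    show "norm (B a b) \<le> norm a * norm b * (2 * C)"
    proof (cases "a = 0 \<or> b = 0")
      case True
      then show ?thesis using l0[of 0 a b] r0[of a 0 b] by auto
    next
      case False
      have "B ((1 / norm a) *\<^sub>R a) ((1 / norm b) *\<^sub>R b) = B a b / (norm a * norm b)"
        unfolding l0 r0 by simp
      moreover have "\<bar>B ((1 / norm a) *\<^sub>R a) ((1 / norm b) *\<^sub>R b)\<bar> \<le> C * (1\<^sup>2 + 1\<^sup>2)"
        using bd[of "(1 / norm a) *\<^sub>R a" "(1 / norm b) *\<^sub>R b"] False by simp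
      ultimately have "\<bar>B a b\<bar> / (norm a * norm b) \<le> 2 * C" by (simp add: abs_divide abs_mult)
      then show ?thesis using False by (simp add: divide_le_eq mult.commute split: if_splits)
    qed
  qed
qed

section \<open>The functions and gradients chosen for elements of the completion\<close>

context fractional_setting
begin

abbreviation "fu \<equiv> H0_fun \<Omega> \<mu> A \<iota>"
abbreviation "Du \<equiv> H0_grad \<Omega> \<mu> A \<iota>"

text \<open>\<open>fu u\<close> and \<open>Du u\<close> are chosen separately, so each is only known
  to possess some partner in \<open>represents\<close>.\<close>

lemma represents_fu: "\<exists>G. represents \<Omega> \<mu> A \<iota> u (fu u) G"
  unfolding H0_fun_def by (rule someI_ex[of "\<lambda>w. \<exists>G. represents \<Omega> \<mu> A \<iota> u w G"]) (rule represents_exists)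

lemma represents_Du: "\<exists>w. represents \<Omega> \<mu> A \<iota> u w (Du u)"
  unfolding H0_grad_def
  by (rule someI_ex[of "\<lambda>G. \<exists>w. represents \<Omega> \<mu> A \<iota> u w G"]) (use represents_exists in blast)

lemma integrable_fu: "integrable lebesgue (fu u)"
  using represents_fu[of u] by (auto simp: represents_eq)

lemma fu_outside: "x \<notin> \<Omega> \<Longrightarrow> fu u x = 0"
  using represents_fu[of u] by (auto simp: represents_eq)

lemma measurable_Du: "(\<lambda>p. Du u (fst p) (snd p)) \<in> borel_measurable P"
  using represents_Du[of u] by (auto simp: represents_eq)

lemma L1_fu: "(LINT x|lebesgue. \<bar>fu u x\<bar>) \<le> C1 * norm u"
  using represents_fu[of u] represents_bounds(3) by blast

lemma En_Du: "En (Du u) \<le> ennreal (2 * (norm u)\<^sup>2)" "ennreal ((norm u)\<^sup>2) \<le> 2 * En (Du u)"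
  using represents_Du[of u] represents_bounds(1,2) by blast+

lemma represents_unique:
  assumes "represents \<Omega> \<mu> A \<iota> u w G" "represents \<Omega> \<mu> A \<iota> u z H"
  shows "AE x in lebesgue. w x = z x" "AE p in P. fst p \<in> {0<..1} \<longrightarrow> G (fst p) (snd p) = H (fst p) (snd p)"
proof -
  have r: "represents \<Omega> \<mu> A \<iota> 0 (\<lambda>x. 1 * w x + (-1) * z x) (\<lambda>s x. 1 *\<^sub>R G s x + (-1) *\<^sub>R H s x)"
    using represents_linear_combination[OF assms, of 1 "-1"] by simp
  show "AE x in lebesgue. w x = z x" using represents_0(1)[OF r] by eventually_elim simp
  show "AE p in P. fst p \<in> {0<..1} \<longrightarrow> G (fst p) (snd p) = H (fst p) (snd p)"
    using represents_0(2)[OF r] by eventually_elim simp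
qed

lemma fu_linear: "AE x in lebesgue. fu (c *\<^sub>R u + d *\<^sub>R v) x = c * fu u x + d * fu v x"
  using represents_fu[of u] represents_fu[of v] represents_fu[of "c *\<^sub>R u + d *\<^sub>R v"]
    represents_linear_combination represents_unique(1) by meson

lemma Du_linear: "AE p in P. fst p \<in> {0<..1} \<longrightarrow>
    Du (c *\<^sub>R u + d *\<^sub>R v) (fst p) (snd p) = c *\<^sub>R Du u (fst p) (snd p) + d *\<^sub>R Du v (fst p) (snd p)"
proof -
  obtain w z y where r: "represents \<Omega> \<mu> A \<iota> u w (Du u)" "represents \<Omega> \<mu> A \<iota> v z (Du v)"
    "represents \<Omega> \<mu> A \<iota> (c *\<^sub>R u + d *\<^sub>R v) y (Du (c *\<^sub>R u + d *\<^sub>R v))"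
    using represents_Du by metis
  show ?thesis
    by (rule represents_unique(2)[OF r(3) represents_linear_combination[OF r(1,2)]])
qed

lemma AE_snd: assumes "AE x in lebesgue. Q x" shows "AE p in P. Q (snd p)"
proof -
  obtain N where N: "{x \<in> space lebesgue. \<not> Q x} \<subseteq> N" "emeasure lebesgue N = 0" "N \<in> sets lebesgue"
    by (rule AE_E[OF assms]) (rule that)
  show ?thesis
  proof (rule AE_I[where N="space \<mu> \<times> N"])
    show "{p \<in> space P. \<not> Q (snd p)} \<subseteq> space \<mu> \<times> N" using N(1) by (auto simp: space_pair_measure)
    show "emeasure P (space \<mu> \<times> N) = 0"
      using leb.emeasure_pair_measure_Times[OF sets.top N(3), of \<mu>] N(2) by simp
    show "space \<mu> \<times> N \<in> sets P" using N(3) by (intro pair_measureI) auto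
  qed
qed

text \<open>Passing to a subsequence adds almost everywhere convergence, which Fatou's lemma
  requires in \<open>compactly_bounded_fu\<close>.\<close>

lemma approximating_sequence:
  obtains \<phi> where "\<And>k. \<phi> k \<in> test_functions \<Omega>" "(\<lambda>k. \<iota> (\<phi> k)) \<longlonglongrightarrow> u"
    "(\<lambda>k. LINT x|lebesgue. \<bar>\<phi> k x - fu u x\<bar>) \<longlonglongrightarrow> 0" "AE x in lebesgue. (\<lambda>k. \<phi> k x) \<longlonglongrightarrow> fu u x"
proof -
  obtain \<psi> where \<psi>: "\<And>k. \<psi> k \<in> test_functions \<Omega>" "(\<lambda>k. \<iota> (\<psi> k)) \<longlonglongrightarrow> u"
    "(\<lambda>k. LINT x|lebesgue. \<bar>\<psi> k x - fu u x\<bar>) \<longlonglongrightarrow> 0"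
    using represents_fu[of u] unfolding represents_eq by blast
  have "integrable lebesgue (\<lambda>x. \<psi> k x - fu u x)" for k
    using integrable_test_lebesgue[OF \<psi>(1)] integrable_fu by auto
  then obtain r where r: "strict_mono r"
    "AE x in lebesgue. (\<lambda>k. \<psi> (r k) x - fu u x) \<longlonglongrightarrow> 0"
    using tendsto_L1_AE_subseq[of lebesgue "\<lambda>k x. \<psi> k x - fu u x"] \<psi>(3) by auto
  show ?thesis
  proof (rule that[of "\<lambda>k. \<psi> (r k)"])
    show "\<psi> (r k) \<in> test_functions \<Omega>" for k by (rule \<psi>(1))
    show "(\<lambda>k. \<iota> (\<psi> (r k))) \<longlonglongrightarrow> u" using LIMSEQ_subseq_LIMSEQ[OF \<psi>(2) r(1)] by (simp add: o_def)
    show "(\<lambda>k. LINT x|lebesgue. \<bar>\<psi> (r k) x - fu u x\<bar>) \<longlonglongrightarrow> 0"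
      using LIMSEQ_subseq_LIMSEQ[OF \<psi>(3) r(1)] by (simp add: o_def)
    show "AE x in lebesgue. (\<lambda>k. \<psi> (r k) x) \<longlonglongrightarrow> fu u x"
      using r(2) by eventually_elim (rule LIM_zero_cancel)
  qed
qed

lemma set_integral_tendsto:
  fixes \<phi> :: "nat \<Rightarrow> real^'n \<Rightarrow> real"
  assumes "\<And>k. integrable lebesgue (\<phi> k)" "integrable lebesgue w"
    and lim: "(\<lambda>k. LINT x|lebesgue. \<bar>\<phi> k x - w x\<bar>) \<longlonglongrightarrow> 0" and Q: "Q \<in> sets lebesgue"
  shows "(\<lambda>k. LINT x:Q|lebesgue. \<phi> k x) \<longlonglongrightarrow> (LINT x:Q|lebesgue. w x)"
    "(\<lambda>k. LINT x|lebesgue. \<bar>\<phi> k x\<bar>) \<longlonglongrightarrow> (LINT x|lebesgue. \<bar>w x\<bar>)"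
proof -
  have i: "integrable lebesgue (\<lambda>x. \<bar>\<phi> k x - w x\<bar>)" for k using assms by auto
  have iQ: "integrable lebesgue (\<lambda>x. indicator Q x *\<^sub>R \<phi> k x)" "integrable lebesgue (\<lambda>x. indicator Q x *\<^sub>R w x)" for k
    by (rule integrable_mult_indicator[OF Q assms(1)], rule integrable_mult_indicator[OF Q assms(2)])
  show "(\<lambda>k. LINT x:Q|lebesgue. \<phi> k x) \<longlonglongrightarrow> (LINT x:Q|lebesgue. w x)"
  proof (rule LIM_zero_cancel, rule Lim_null_comparison[OF _ lim], intro always_eventually allI)
    fix k
    have "(LINT x:Q|lebesgue. \<phi> k x) - (LINT x:Q|lebesgue. w x)
        = (LINT x|lebesgue. indicator Q x *\<^sub>R \<phi> k x - indicator Q x *\<^sub>R w x)"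
      unfolding set_lebesgue_integral_def by (rule Bochner_Integration.integral_diff[OF iQ, symmetric])
    also have "norm \<dots> \<le> (LINT x|lebesgue. \<bar>\<phi> k x - w x\<bar>)"
      by (rule Bochner_Integration.integral_norm_bound_integral) (use iQ i in \<open>auto simp: indicator_def\<close>)
    finally show "norm ((LINT x:Q|lebesgue. \<phi> k x) - (LINT x:Q|lebesgue. w x)) \<le> (LINT x|lebesgue. \<bar>\<phi> k x - w x\<bar>)" .
  qed
  show "(\<lambda>k. LINT x|lebesgue. \<bar>\<phi> k x\<bar>) \<longlonglongrightarrow> (LINT x|lebesgue. \<bar>w x\<bar>)"
  proof (rule LIM_zero_cancel, rule Lim_null_comparison[OF _ lim], intro always_eventually allI)
    fix k
    have ia: "integrable lebesgue (\<lambda>x. \<bar>\<phi> k x\<bar>)" "integrable lebesgue (\<lambda>x. \<bar>w x\<bar>)" using assms by auto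
    have "(LINT x|lebesgue. \<bar>\<phi> k x\<bar>) - (LINT x|lebesgue. \<bar>w x\<bar>) = (LINT x|lebesgue. \<bar>\<phi> k x\<bar> - \<bar>w x\<bar>)"
      by (rule Bochner_Integration.integral_diff[OF ia, symmetric])
    also have "norm \<dots> \<le> (LINT x|lebesgue. \<bar>\<phi> k x - w x\<bar>)"
      by (rule Bochner_Integration.integral_norm_bound_integral) (use ia i in auto)
    finally show "norm ((LINT x|lebesgue. \<bar>\<phi> k x\<bar>) - (LINT x|lebesgue. \<bar>w x\<bar>)) \<le> (LINT x|lebesgue. \<bar>\<phi> k x - w x\<bar>)" .
  qed
qed

text \<open>Both sides are continuous along the approximating sequence, so the inequality passes
  from test functions to the completion.\<close>

lemma rellich_fu:
  assumes "\<epsilon> > 0"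
  obtains \<Q> where "finite \<Q>" "\<Q> \<subseteq> sets lebesgue"
    "\<And>u. (LINT x|lebesgue. \<bar>fu u x\<bar>) \<le> (\<Sum>Q\<in>\<Q>. \<bar>LINT x:Q|lebesgue. fu u x\<bar>) + \<epsilon> * norm u"
proof -
  obtain C where C: "C > 0" "\<And>\<phi>. \<phi> \<in> test_functions \<Omega> \<Longrightarrow> (LINT x|lborel. norm (gradient \<phi> x)) \<le> C * norm (\<iota> \<phi>)"
    using gradient_bound by blast
  have "\<epsilon> / C > 0" using assms C(1) by simp
  then obtain \<Q> where Q: "finite \<Q>" "\<Q> \<subseteq> sets borel" "\<And>\<phi>. \<phi> \<in> test_functions \<Omega> \<Longrightarrow>
      (LINT x|lborel. \<bar>\<phi> x\<bar>) \<le> (\<Sum>Q\<in>\<Q>. \<bar>LINT x:Q|lborel. \<phi> x\<bar>) + \<epsilon> / C * (LINT x|lborel. norm (gradient \<phi> x))"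
    using rellich_cubes[OF dom(3)] by blast
  have Ql: "\<Q> \<subseteq> sets lebesgue" using Q(2) by auto
  have est: "(LINT x|lebesgue. \<bar>\<phi> x\<bar>) \<le> (\<Sum>Q\<in>\<Q>. \<bar>LINT x:Q|lebesgue. \<phi> x\<bar>) + \<epsilon> * norm (\<iota> \<phi>)"
    if t: "\<phi> \<in> test_functions \<Omega>" for \<phi>
  proof -
    note [measurable] = borel_measurable_test[OF t]
    have 1: "(LINT x|lebesgue. \<bar>\<phi> x\<bar>) = (LINT x|lborel. \<bar>\<phi> x\<bar>)" by (rule integral_completion) simp
    have 2: "(\<Sum>Q\<in>\<Q>. \<bar>LINT x:Q|lebesgue. \<phi> x\<bar>) = (\<Sum>Q\<in>\<Q>. \<bar>LINT x:Q|lborel. \<phi> x\<bar>)"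
    proof (rule sum.cong[OF refl])
      fix B assume "B \<in> \<Q>"
      then have [measurable]: "B \<in> sets borel" using Q(2) by auto
      show "\<bar>LINT x:B|lebesgue. \<phi> x\<bar> = \<bar>LINT x:B|lborel. \<phi> x\<bar>"
        unfolding set_lebesgue_integral_def by (subst integral_completion) simp_all
    qed
    have "\<epsilon> / C * (LINT x|lborel. norm (gradient \<phi> x)) \<le> \<epsilon> / C * (C * norm (\<iota> \<phi>))"
      using assms C by (intro mult_left_mono C(2)[OF t]) auto
    then show ?thesis using Q(3)[OF t] C(1) by (simp add: 1 2)
  qed
  have "(LINT x|lebesgue. \<bar>fu u x\<bar>) \<le> (\<Sum>Q\<in>\<Q>. \<bar>LINT x:Q|lebesgue. fu u x\<bar>) + \<epsilon> * norm u" for u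
  proof -
    obtain \<phi> where \<phi>: "\<And>k. \<phi> k \<in> test_functions \<Omega>" "(\<lambda>k. \<iota> (\<phi> k)) \<longlonglongrightarrow> u"
      "(\<lambda>k. LINT x|lebesgue. \<bar>\<phi> k x - fu u x\<bar>) \<longlonglongrightarrow> 0"
      using approximating_sequence by blast
    note lim = set_integral_tendsto[OF integrable_test_lebesgue[OF \<phi>(1)] integrable_fu \<phi>(3)]
    have "(\<lambda>k. (\<Sum>Q\<in>\<Q>. \<bar>LINT x:Q|lebesgue. \<phi> k x\<bar>) + \<epsilon> * norm (\<iota> (\<phi> k)))
        \<longlonglongrightarrow> (\<Sum>Q\<in>\<Q>. \<bar>LINT x:Q|lebesgue. fu u x\<bar>) + \<epsilon> * norm u"
      using Ql by (intro tendsto_intros lim(1) \<phi>(2)) auto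
    then show ?thesis
      using lim(2)[OF sets.empty_sets] est[OF \<phi>(1)] by (intro LIMSEQ_le[of "\<lambda>k. LINT x|lebesgue. \<bar>\<phi> k x\<bar>"]) auto
  qed
  then show ?thesis using that Q(1) Ql by blast
qed

lemma bounded_linear_set_integral: assumes "Q \<in> sets lebesgue" shows "bounded_linear (\<lambda>u. LINT x:Q|lebesgue. fu u x)"
proof -
  have iQ: "integrable lebesgue (\<lambda>x. indicator Q x *\<^sub>R fu u x)" for u
    by (rule integrable_mult_indicator[OF assms integrable_fu])
  have lin: "(LINT x:Q|lebesgue. fu (c *\<^sub>R u + d *\<^sub>R v) x) = c * (LINT x:Q|lebesgue. fu u x) + d * (LINT x:Q|lebesgue. fu v x)" for c d u v
  proof -
    have "(LINT x:Q|lebesgue. fu (c *\<^sub>R u + d *\<^sub>R v) x)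
        = (LINT x|lebesgue. c * (indicator Q x *\<^sub>R fu u x) + d * (indicator Q x *\<^sub>R fu v x))"
      unfolding set_lebesgue_integral_def
    proof (rule integral_cong_AE)
      show "AE x in lebesgue. indicator Q x *\<^sub>R fu (c *\<^sub>R u + d *\<^sub>R v) x
          = c * (indicator Q x *\<^sub>R fu u x) + d * (indicator Q x *\<^sub>R fu v x)"
        using fu_linear[of c u d v] by eventually_elim (simp add: algebra_simps)
    qed (use iQ in \<open>auto intro!: borel_measurable_integrable\<close>)
    also have "\<dots> = c * (LINT x:Q|lebesgue. fu u x) + d * (LINT x:Q|lebesgue. fu v x)"
      unfolding set_lebesgue_integral_def using iQ by simp
    finally show ?thesis .
  qed
  show ?thesis
  proof (rule bounded_linear_intro[where K=C1])
    show "(LINT x:Q|lebesgue. fu (u + v) x) = (LINT x:Q|lebesgue. fu u x) + (LINT x:Q|lebesgue. fu v x)" for u v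
      using lin[of 1 u 1 v] by simp
    show "(LINT x:Q|lebesgue. fu (c *\<^sub>R u) x) = c *\<^sub>R (LINT x:Q|lebesgue. fu u x)" for c u
      using lin[of c u 0 u] by simp
    fix u
    have "norm (LINT x:Q|lebesgue. fu u x) \<le> (LINT x|lebesgue. \<bar>fu u x\<bar>)"
      unfolding set_lebesgue_integral_def
      by (rule Bochner_Integration.integral_norm_bound_integral) (use iQ integrable_fu in \<open>auto simp: indicator_def\<close>)
    also have "\<dots> \<le> norm u * C1" using L1_fu[of u] by (simp add: mult.commute)
    finally show "norm (LINT x:Q|lebesgue. fu u x) \<le> norm u * C1" .
  qed
qed

text \<open>Fatou's lemma treats the weighted integral, for which no convergence is known; the right
  side converges together with the norm and the L1 norm.\<close>

lemma compactly_bounded_fu: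
  assumes f: "f \<in> borel_measurable (lebesgue_on \<Omega>)" "\<forall>x\<in>\<Omega>. 0 \<le> f x" and K: "0 \<le> \<epsilon>" "0 \<le> K"
    and bd: "\<forall>\<phi>\<in>test_functions \<Omega>. (\<integral>\<^sup>+x\<in>\<Omega>. ennreal (f x * (\<phi> x)\<^sup>2) \<partial>lebesgue)
          \<le> ennreal (\<epsilon> * H0_inner \<mu> A \<phi> \<phi> + K * (LINT x:\<Omega>|lebesgue. \<bar>\<phi> x\<bar>)\<^sup>2)"
  shows "(\<integral>\<^sup>+x. ennreal (indicator \<Omega> x * f x * (fu u x)\<^sup>2) \<partial>lebesgue)
    \<le> ennreal (\<epsilon> * (norm u)\<^sup>2 + K * (LINT x|lebesgue. \<bar>fu u x\<bar>)\<^sup>2)"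
proof -
  have \<Omega>: "\<Omega> \<in> sets lebesgue" using dom(1) by simp
  have F[measurable]: "(\<lambda>x. indicator \<Omega> x * f x) \<in> borel_measurable lebesgue"
    using f(1) \<Omega> by (simp add: borel_measurable_restrict_space_iff)
  obtain \<phi> where \<phi>: "\<And>k. \<phi> k \<in> test_functions \<Omega>" "(\<lambda>k. \<iota> (\<phi> k)) \<longlonglongrightarrow> u"
    "(\<lambda>k. LINT x|lebesgue. \<bar>\<phi> k x - fu u x\<bar>) \<longlonglongrightarrow> 0" "AE x in lebesgue. (\<lambda>k. \<phi> k x) \<longlonglongrightarrow> fu u x"
    using approximating_sequence by blast
  have [measurable]: "\<phi> k \<in> borel_measurable lebesgue" for k
    using integrable_test_lebesgue[OF \<phi>(1)] by (rule borel_measurable_integrable)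
  have "(\<integral>\<^sup>+x. ennreal (indicator \<Omega> x * f x * (fu u x)\<^sup>2) \<partial>lebesgue)
      = (\<integral>\<^sup>+x. liminf (\<lambda>k. ennreal (indicator \<Omega> x * f x * (\<phi> k x)\<^sup>2)) \<partial>lebesgue)"
  proof (rule nn_integral_cong_AE)
    show "AE x in lebesgue. ennreal (indicator \<Omega> x * f x * (fu u x)\<^sup>2) = liminf (\<lambda>k. ennreal (indicator \<Omega> x * f x * (\<phi> k x)\<^sup>2))"
      using \<phi>(4)
    proof eventually_elim
      fix x assume *: "(\<lambda>k. \<phi> k x) \<longlonglongrightarrow> fu u x"
      have "(\<lambda>k. ennreal (indicator \<Omega> x * f x * (\<phi> k x)\<^sup>2)) \<longlonglongrightarrow> ennreal (indicator \<Omega> x * f x * (fu u x)\<^sup>2)"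
        by (intro tendsto_ennrealI tendsto_intros *)
      then show "ennreal (indicator \<Omega> x * f x * (fu u x)\<^sup>2) = liminf (\<lambda>k. ennreal (indicator \<Omega> x * f x * (\<phi> k x)\<^sup>2))"
        by (intro lim_imp_Liminf[symmetric]) auto
    qed
  qed
  also have "\<dots> \<le> liminf (\<lambda>k. \<integral>\<^sup>+x. ennreal (indicator \<Omega> x * f x * (\<phi> k x)\<^sup>2) \<partial>lebesgue)"
    by (rule nn_integral_liminf) measurable
  also have "\<dots> \<le> liminf (\<lambda>k. ennreal (\<epsilon> * (norm (\<iota> (\<phi> k)))\<^sup>2 + K * (LINT x|lebesgue. \<bar>\<phi> k x\<bar>)\<^sup>2))"
  proof (rule Liminf_mono, intro always_eventually allI)
    fix k
    have 1: "(\<integral>\<^sup>+x. ennreal (indicator \<Omega> x * f x * (\<phi> k x)\<^sup>2) \<partial>lebesgue) = (\<integral>\<^sup>+x\<in>\<Omega>. ennreal (f x * (\<phi> k x)\<^sup>2) \<partial>lebesgue)"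
      by (intro nn_integral_cong) (simp add: indicator_def)
    have 2: "H0_inner \<mu> A (\<phi> k) (\<phi> k) = (norm (\<iota> (\<phi> k)))\<^sup>2"
      using H0 \<phi>(1) by (simp add: is_H0_completion_def power2_norm_eq_inner)
    have 3: "(LINT x:\<Omega>|lebesgue. \<bar>\<phi> k x\<bar>) = (LINT x|lebesgue. \<bar>\<phi> k x\<bar>)"
      unfolding set_lebesgue_integral_def
      by (intro Bochner_Integration.integral_cong) (auto simp: indicator_def test_outside[OF \<phi>(1)])
    show "(\<integral>\<^sup>+x. ennreal (indicator \<Omega> x * f x * (\<phi> k x)\<^sup>2) \<partial>lebesgue)
        \<le> ennreal (\<epsilon> * (norm (\<iota> (\<phi> k)))\<^sup>2 + K * (LINT x|lebesgue. \<bar>\<phi> k x\<bar>)\<^sup>2)"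
      using bd[rule_format, OF \<phi>(1)[of k]] by (simp only: 1 2 3)
  qed
  also have "\<dots> = ennreal (\<epsilon> * (norm u)\<^sup>2 + K * (LINT x|lebesgue. \<bar>fu u x\<bar>)\<^sup>2)"
  proof (rule lim_imp_Liminf)
    have "(\<lambda>k. LINT x|lebesgue. \<bar>\<phi> k x\<bar>) \<longlonglongrightarrow> (LINT x|lebesgue. \<bar>fu u x\<bar>)"
      by (rule set_integral_tendsto(2)[OF integrable_test_lebesgue[OF \<phi>(1)] integrable_fu \<phi>(3) sets.empty_sets])
    then show "(\<lambda>k. ennreal (\<epsilon> * (norm (\<iota> (\<phi> k)))\<^sup>2 + K * (LINT x|lebesgue. \<bar>\<phi> k x\<bar>)\<^sup>2))
        \<longlonglongrightarrow> ennreal (\<epsilon> * (norm u)\<^sup>2 + K * (LINT x|lebesgue. \<bar>fu u x\<bar>)\<^sup>2)"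
      by (intro tendsto_ennrealI tendsto_intros \<phi>(2))
  qed simp
  finally show ?thesis .
qed

end

section \<open>The lower-order terms\<close>

locale fractional_operator = fractional_setting \<Omega> \<mu> A lam \<iota>
  for \<Omega> :: "(real^'n::finite) set" and \<mu> A lam and \<iota> :: "(real^'n \<Rightarrow> real) \<Rightarrow> 'h::{real_inner, complete_space}" +
  fixes a1 b1 :: "real \<Rightarrow> real^'n \<Rightarrow> real^'n" and a :: "real^'n \<Rightarrow> real"
    and bB :: "real^'n \<Rightarrow> real^'n^'n" and ba bb :: "real^'n \<Rightarrow> real^'n" and K\<^sub>A :: real and f :: "real^'n \<Rightarrow> real"
  assumes a1_meas: "(\<lambda>(s, x). a1 s x) \<in> borel_measurable (\<mu> \<Otimes>\<^sub>M lebesgue)"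
    and b1_meas: "(\<lambda>(s, x). b1 s x) \<in> borel_measurable (\<mu> \<Otimes>\<^sub>M lebesgue)"
    and a_meas: "a \<in> borel_measurable (lebesgue_on \<Omega>)"
    and K\<^sub>A: "0 < K\<^sub>A"
    and sector: "\<And>s x \<xi> \<psi>. s \<in> {0<..1} \<Longrightarrow> \<bar>\<xi> \<bullet> (A s x *v \<psi>)\<bar>\<^sup>2 \<le> K\<^sub>A * (\<xi> \<bullet> (A s x *v \<xi>)) * (\<psi> \<bullet> (A s x *v \<psi>))"
    and bB: "\<And>s x i j. s \<in> {0<..1} \<Longrightarrow> \<bar>matrix_inv (A s x) $ i $ j\<bar> \<le> bB x $ i $ j"
    and ba: "\<And>s x i. s \<in> {0<..1} \<Longrightarrow> \<bar>a1 s x $ i\<bar> \<le> ba x $ i"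
    and bb: "\<And>s x i. s \<in> {0<..1} \<Longrightarrow> \<bar>b1 s x $ i\<bar> \<le> bb x $ i"
    and f: "\<And>x. x \<in> \<Omega> \<Longrightarrow> f x = (\<Sum>i\<in>UNIV. \<Sum>j\<in>UNIV.
                 bB x $ i $ j * (ba x $ i * ba x $ j + bb x $ i * bb x $ j)) + \<bar>a x\<bar>"
    and f_cb: "compactly_bounded \<Omega> \<mu> A f"
begin

definition F :: "real^'n \<Rightarrow> real" where "F x = indicator \<Omega> x * f x"
definition a0 :: "real^'n \<Rightarrow> real" where "a0 x = indicator \<Omega> x * a x"

lemma \<Omega>_sets: "\<Omega> \<in> sets lebesgue" using dom(1) by simp

lemma F_meas [measurable]: "F \<in> borel_measurable lebesgue"
  using f_cb \<Omega>_sets by (simp add: compactly_bounded_def F_def[abs_def] borel_measurable_restrict_space_iff)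

lemma a0_meas [measurable]: "a0 \<in> borel_measurable lebesgue"
  using a_meas \<Omega>_sets by (simp add: a0_def[abs_def] borel_measurable_restrict_space_iff)

lemma F_nonneg: "0 \<le> F x"
  using f_cb by (cases "x \<in> \<Omega>") (auto simp: compactly_bounded_def F_def)

lemma bounds_nonneg: "0 \<le> bB x $ i $ j" "0 \<le> ba x $ i" "0 \<le> bb x $ i"
  using bB[of 1 x i j] ba[of 1 x i] bb[of 1 x i] by auto

lemma a0_le_F: "\<bar>a0 x\<bar> \<le> F x"
proof (cases "x \<in> \<Omega>")
  case True
  have "0 \<le> (\<Sum>i\<in>UNIV. \<Sum>j\<in>UNIV. bB x $ i $ j * (ba x $ i * ba x $ j + bb x $ i * bb x $ j))"
    by (intro sum_nonneg mult_nonneg_nonneg add_nonneg_nonneg bounds_nonneg)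
  then show ?thesis using True f[of x] by (simp add: F_def a0_def)
qed (simp add: F_def a0_def)

text \<open>Since \<open>\<alpha> = A y\<close> for \<open>y = A\<^sup>-\<^sup>1 \<alpha>\<close>, the sector condition bounds \<open>\<alpha> \<bullet> \<xi>\<close> by the energy of \<open>\<xi>\<close> and that of \<open>y\<close>;
  the latter is \<open>\<alpha> \<bullet> A\<^sup>-\<^sup>1 \<alpha>\<close>, hence at most \<open>F\<close>.\<close>

lemma drift_bound:
  assumes s: "s \<in> {0<..1}" and x: "x \<in> \<Omega>"
    and \<alpha>: "(\<forall>i. \<bar>\<alpha> $ i\<bar> \<le> ba x $ i) \<or> (\<forall>i. \<bar>\<alpha> $ i\<bar> \<le> bb x $ i)"
  shows "(\<alpha> \<bullet> \<xi>)\<^sup>2 \<le> K\<^sub>A * q s x \<xi> * F x"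
proof -
  let ?B = "matrix_inv (A s x)"
  have "\<xi> = 0" if "A s x *v \<xi> = 0" for \<xi> using posdef[OF s, of \<xi> x] that by fastforce
  then have "invertible (A s x)" by (meson matrix_left_invertible_ker invertible_left_inverse)
  then have inv: "A s x ** ?B = mat 1"
    unfolding invertible_def matrix_inv_def by (rule someI_ex[THEN conjunct1])
  define y where "y = ?B *v \<alpha>"
  have y: "A s x *v y = \<alpha>" by (simp add: y_def matrix_vector_mul_assoc inv)
  have "\<alpha> \<bullet> y = (\<Sum>i\<in>UNIV. \<Sum>j\<in>UNIV. ?B $ i $ j * \<alpha> $ j * \<alpha> $ i)" unfolding y_def by (rule quadratic_sum)
  also have "\<dots> \<le> (\<Sum>i\<in>UNIV. \<Sum>j\<in>UNIV. bB x $ i $ j * (ba x $ i * ba x $ j + bb x $ i * bb x $ j))"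
  proof (intro sum_mono)
    fix i j
    have "?B $ i $ j * \<alpha> $ j * \<alpha> $ i \<le> \<bar>?B $ i $ j\<bar> * (\<bar>\<alpha> $ i\<bar> * \<bar>\<alpha> $ j\<bar>)"
      using abs_ge_self[of "?B $ i $ j * \<alpha> $ j * \<alpha> $ i"] by (simp only: abs_mult mult_ac)
    also have "\<dots> \<le> bB x $ i $ j * (ba x $ i * ba x $ j + bb x $ i * bb x $ j)"
    proof (rule mult_mono)
      show "\<bar>\<alpha> $ i\<bar> * \<bar>\<alpha> $ j\<bar> \<le> ba x $ i * ba x $ j + bb x $ i * bb x $ j"
        using \<alpha>
      proof
        assume "\<forall>i. \<bar>\<alpha> $ i\<bar> \<le> ba x $ i"
        then have "\<bar>\<alpha> $ i\<bar> * \<bar>\<alpha> $ j\<bar> \<le> ba x $ i * ba x $ j" by (intro mult_mono bounds_nonneg) auto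
        moreover have "0 \<le> bb x $ i * bb x $ j" by (intro mult_nonneg_nonneg bounds_nonneg)
        ultimately show ?thesis by linarith
      next
        assume "\<forall>i. \<bar>\<alpha> $ i\<bar> \<le> bb x $ i"
        then have "\<bar>\<alpha> $ i\<bar> * \<bar>\<alpha> $ j\<bar> \<le> bb x $ i * bb x $ j" by (intro mult_mono bounds_nonneg) auto
        moreover have "0 \<le> ba x $ i * ba x $ j" by (intro mult_nonneg_nonneg bounds_nonneg)
        ultimately show ?thesis by linarith
      qed
    qed (use bB[OF s] bounds_nonneg in auto)
    finally show "?B $ i $ j * \<alpha> $ j * \<alpha> $ i \<le> bB x $ i $ j * (ba x $ i * ba x $ j + bb x $ i * bb x $ j)" .
  qed
  also have "\<dots> \<le> F x" using x f[OF x] by (simp add: F_def)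
  finally have yF: "y \<bullet> (A s x *v y) \<le> F x" by (simp add: y inner_commute)
  have "(\<alpha> \<bullet> \<xi>)\<^sup>2 = \<bar>\<xi> \<bullet> (A s x *v y)\<bar>\<^sup>2" by (simp add: y inner_commute)
  also have "\<dots> \<le> K\<^sub>A * (\<xi> \<bullet> (A s x *v \<xi>)) * (y \<bullet> (A s x *v y))" by (rule sector[OF s])
  also have "\<dots> \<le> K\<^sub>A * (\<xi> \<bullet> (A s x *v \<xi>)) * F x"
    using yF K\<^sub>A q_nonneg[OF s, of x \<xi>] by (intro mult_left_mono) (auto simp: q_def)
  finally show ?thesis by (simp add: q_def)
qed

text \<open>Young's inequality with a free parameter: \<open>\<delta> = 1\<close> suffices for
  boundedness of the form, while a specific \<open>\<delta>\<close> lets the energy absorb the drift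
  terms in \<open>garding\<close>.\<close>

lemma weighted_am_gm:
  fixes X p r K \<delta> :: real
  assumes "X\<^sup>2 \<le> K * p * r" "0 < K" "0 \<le> p" "0 \<le> r" "0 < \<delta>"
  shows "\<bar>X\<bar> \<le> sqrt K * (\<delta> * p + r / \<delta>) / 2"
proof -
  have "4 * (p * r) \<le> (\<delta> * p + r / \<delta>)\<^sup>2"
  proof -
    have "0 \<le> (\<delta> * p - r / \<delta>)\<^sup>2" by simp
    moreover have "2 * (\<delta> * p) * (r / \<delta>) = 2 * (p * r)" using assms(5) by simp
    ultimately show ?thesis unfolding power2_sum power2_diff by linarith
  qed
  then have "K * (p * r) \<le> K * ((\<delta> * p + r / \<delta>)\<^sup>2 / 4)" using assms by (intro mult_left_mono) auto
  also have "\<dots> = (sqrt K * (\<delta> * p + r / \<delta>) / 2)\<^sup>2"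
    using assms by (simp add: power_mult_distrib power_divide)
  finally have "\<bar>X\<bar>\<^sup>2 \<le> (sqrt K * (\<delta> * p + r / \<delta>) / 2)\<^sup>2" using assms(1) by (simp add: mult.assoc)
  then show ?thesis by (rule power2_le_imp_le) (use assms in auto)
qed

section \<open>Boundedness and compactness of the weighted square form\<close>

definition t where "t u v = (LINT x|lebesgue. F x * fu u x * fu v x)"

lemma fu_meas [measurable]: "fu u \<in> borel_measurable lebesgue"
  using integrable_fu by (rule borel_measurable_integrable)

lemma F_fu_bound:
  assumes "\<epsilon> > 0"
  shows "\<exists>K\<ge>0. \<forall>u. integrable lebesgue (\<lambda>x. F x * (fu u x)\<^sup>2) \<and>
    t u u \<le> \<epsilon> * (norm u)\<^sup>2 + K * (LINT x|lebesgue. \<bar>fu u x\<bar>)\<^sup>2"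
proof -
  from f_cb assms obtain K where K: "K \<ge> 0" "\<forall>\<phi>\<in>test_functions \<Omega>.
        (\<integral>\<^sup>+x\<in>\<Omega>. ennreal (f x * (\<phi> x)\<^sup>2) \<partial>lebesgue)
          \<le> ennreal (\<epsilon> * H0_inner \<mu> A \<phi> \<phi> + K * (LINT x:\<Omega>|lebesgue. \<bar>\<phi> x\<bar>)\<^sup>2)"
    unfolding compactly_bounded_def by blast
  have nn: "(\<integral>\<^sup>+x. ennreal (F x * (fu u x)\<^sup>2) \<partial>lebesgue) \<le> ennreal (\<epsilon> * (norm u)\<^sup>2 + K * (LINT x|lebesgue. \<bar>fu u x\<bar>)\<^sup>2)" for u
    unfolding F_def using f_cb assms K by (intro compactly_bounded_fu) (auto simp: compactly_bounded_def)
  have int: "integrable lebesgue (\<lambda>x. F x * (fu u x)\<^sup>2)" for u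
  proof (rule integrableI_bounded)
    show "(\<integral>\<^sup>+x. ennreal (norm (F x * (fu u x)\<^sup>2)) \<partial>lebesgue) < \<infinity>"
      using le_less_trans[OF nn[of u]] F_nonneg by (simp add: abs_mult)
  qed measurable
  have "t u u \<le> \<epsilon> * (norm u)\<^sup>2 + K * (LINT x|lebesgue. \<bar>fu u x\<bar>)\<^sup>2" for u
  proof -
    have eq: "(\<integral>\<^sup>+x. ennreal (F x * (fu u x)\<^sup>2) \<partial>lebesgue) = ennreal (LINT x|lebesgue. F x * (fu u x)\<^sup>2)"
      by (rule nn_integral_eq_integral[OF int]) (simp add: F_nonneg)
    have "(LINT x|lebesgue. F x * (fu u x)\<^sup>2) \<le> \<epsilon> * (norm u)\<^sup>2 + K * (LINT x|lebesgue. \<bar>fu u x\<bar>)\<^sup>2"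
      using nn[of u] assms K(1) unfolding eq by (subst (asm) ennreal_le_iff) auto
    then show ?thesis by (simp add: t_def power2_eq_square mult.assoc)
  qed
  then show ?thesis using K(1) int by blast
qed

lemma integrable_F_fu2: "integrable lebesgue (\<lambda>x. F x * (fu u x)\<^sup>2)"
  using F_fu_bound[OF zero_less_one] by blast

lemma t_eq: "t u u = (LINT x|lebesgue. F x * (fu u x)\<^sup>2)"
  by (simp add: t_def power2_eq_square mult.assoc)

lemma t_pos: "0 \<le> t u u"
  unfolding t_eq by (intro Bochner_Integration.integral_nonneg mult_nonneg_nonneg F_nonneg) auto

lemma t_quadratic_bound: obtains K where "K \<ge> 0" "\<And>u. t u u \<le> K * (norm u)\<^sup>2"
proof -
  obtain K where K: "K \<ge> 0" "\<And>u. t u u \<le> 1 * (norm u)\<^sup>2 + K * (LINT x|lebesgue. \<bar>fu u x\<bar>)\<^sup>2"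
    using F_fu_bound[OF zero_less_one] by blast
  have "t u u \<le> (1 + K * C1\<^sup>2) * (norm u)\<^sup>2" for u
  proof -
    have "(LINT x|lebesgue. \<bar>fu u x\<bar>)\<^sup>2 \<le> (C1 * norm u)\<^sup>2" by (intro power_mono L1_fu) auto
    then have "K * (LINT x|lebesgue. \<bar>fu u x\<bar>)\<^sup>2 \<le> K * (C1 * norm u)\<^sup>2" using K(1) by (rule mult_left_mono)
    then show ?thesis using K(2)[of u] by (simp add: power_mult_distrib algebra_simps)
  qed
  then show ?thesis using that[of "1 + K * C1\<^sup>2"] K(1) by simp
qed

lemma two_mult_le: "\<bar>y * z\<bar> \<le> (y\<^sup>2 + z\<^sup>2) / 2" for y z :: real
  using zero_le_power2[of "\<bar>y\<bar> - \<bar>z\<bar>"] by (simp add: power2_diff abs_mult)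

text \<open>A general weight below \<open>F\<close> covers both \<open>F\<close> itself, in
  \<open>t\<close>, and the zeroth-order coefficient \<open>a0\<close>, in \<open>b\<close>.\<close>

lemma weighted_product_integral:
  assumes [measurable]: "g \<in> borel_measurable lebesgue" and g: "\<And>x. \<bar>g x\<bar> \<le> F x"
  shows "integrable lebesgue (\<lambda>x. g x * fu u x * fu v x)"
    "\<bar>LINT x|lebesgue. g x * fu u x * fu v x\<bar> \<le> (t u u + t v v) / 2"
    "(LINT x|lebesgue. g x * fu (c *\<^sub>R u + d *\<^sub>R u') x * fu v x)
      = c * (LINT x|lebesgue. g x * fu u x * fu v x) + d * (LINT x|lebesgue. g x * fu u' x * fu v x)"
proof -
  have ib: "integrable lebesgue (\<lambda>x. (F x * (fu u x)\<^sup>2 + F x * (fu v x)\<^sup>2) / 2)" for u v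
    using integrable_F_fu2 by auto
  have le: "\<bar>g x * fu u x * fu v x\<bar> \<le> (F x * (fu u x)\<^sup>2 + F x * (fu v x)\<^sup>2) / 2" for u v x
  proof -
    have "\<bar>g x * fu u x * fu v x\<bar> = \<bar>g x\<bar> * \<bar>fu u x * fu v x\<bar>" by (simp add: abs_mult)
    also have "\<dots> \<le> F x * (((fu u x)\<^sup>2 + (fu v x)\<^sup>2) / 2)"
      by (intro mult_mono g two_mult_le F_nonneg) auto
    finally show ?thesis by (simp add: distrib_left)
  qed
  have int: "integrable lebesgue (\<lambda>x. g x * fu u x * fu v x)" for u v
    by (rule Bochner_Integration.integrable_bound[OF ib[of u v]])
       (measurable, intro AE_I2, use le[of _ u v] in \<open>auto intro: order_trans[OF _ abs_ge_self]\<close>)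
  show "integrable lebesgue (\<lambda>x. g x * fu u x * fu v x)" by (rule int)
  have "\<bar>LINT x|lebesgue. g x * fu u x * fu v x\<bar> \<le> (LINT x|lebesgue. (F x * (fu u x)\<^sup>2 + F x * (fu v x)\<^sup>2) / 2)"
    using Bochner_Integration.integral_norm_bound_integral[OF int[of u v] ib[of u v]] le by simp
  also have "\<dots> = (t u u + t v v) / 2" unfolding t_eq using integrable_F_fu2 by simp
  finally show "\<bar>LINT x|lebesgue. g x * fu u x * fu v x\<bar> \<le> (t u u + t v v) / 2" .
  have "(LINT x|lebesgue. g x * fu (c *\<^sub>R u + d *\<^sub>R u') x * fu v x)
      = (LINT x|lebesgue. c * (g x * fu u x * fu v x) + d * (g x * fu u' x * fu v x))"
  proof (rule integral_cong_AE)
    show "AE x in lebesgue. g x * fu (c *\<^sub>R u + d *\<^sub>R u') x * fu v x = c * (g x * fu u x * fu v x) + d * (g x * fu u' x * fu v x)"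
      using fu_linear[of c u d u'] by eventually_elim (simp add: algebra_simps)
  qed measurable
  also have "\<dots> = c * (LINT x|lebesgue. g x * fu u x * fu v x) + d * (LINT x|lebesgue. g x * fu u' x * fu v x)"
    using int by simp
  finally show "(LINT x|lebesgue. g x * fu (c *\<^sub>R u + d *\<^sub>R u') x * fu v x)
      = c * (LINT x|lebesgue. g x * fu u x * fu v x) + d * (LINT x|lebesgue. g x * fu u' x * fu v x)" .
qed

lemma weighted_product_commute:
  "(LINT x|lebesgue. g x * fu u x * fu v x) = (LINT x|lebesgue. g x * fu v x * fu u x)"
  by (simp add: mult_ac)

lemma t_bilinear: "bounded_bilinear t"
proof -
  obtain K where K: "K \<ge> 0" "\<And>u. t u u \<le> K * (norm u)\<^sup>2" using t_quadratic_bound by blast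
  have F: "\<bar>F x\<bar> \<le> F x" for x using F_nonneg by simp
  note P = weighted_product_integral[OF F_meas F]
  show ?thesis
  proof (rule bounded_bilinear_of_quadratic_bound[where C=K])
    show "t (c *\<^sub>R u + d *\<^sub>R u') v = c * t u v + d * t u' v" for c d u u' v
      unfolding t_def by (rule P(3))
    show "t u (c *\<^sub>R v + d *\<^sub>R v') = c * t u v + d * t u v'" for c d u v v'
      unfolding t_def weighted_product_commute[of F u] by (rule P(3))
    show "\<bar>t u v\<bar> \<le> K * ((norm u)\<^sup>2 + (norm v)\<^sup>2)" for u v
    proof -
      have "\<bar>t u v\<bar> \<le> (t u u + t v v) / 2" unfolding t_def[of u v] by (rule P(2))
      then show ?thesis using K(2)[of u] K(2)[of v] t_pos[of u] t_pos[of v] by (simp add: distrib_left)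
    qed
  qed
qed

lemma t_compact:
  assumes "e > 0"
  shows "\<exists>G. finite G \<and> (\<forall>u. t u u \<le> e * (norm u)\<^sup>2 + (\<Sum>g\<in>G. (inner g u)\<^sup>2))"
proof -
  obtain K where K: "K \<ge> 0" "\<And>u. t u u \<le> e / 2 * (norm u)\<^sup>2 + K * (LINT x|lebesgue. \<bar>fu u x\<bar>)\<^sup>2"
    using F_fu_bound[OF half_gt_zero[OF assms]] by blast
  \<comment> \<open>Squaring the Rellich estimate produces
    \<open>2 * K * \<delta>\<^sup>2 * (norm u)\<^sup>2\<close>, which must fit into the second half
    of \<open>e\<close>; \<open>K + 1\<close> avoids division by zero.\<close>
  define \<delta> where "\<delta> = sqrt (e / (4 * (K + 1)))"
  have \<delta>: "\<delta> > 0" "2 * K * \<delta>\<^sup>2 \<le> e / 2"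
  proof -
    show "\<delta> > 0" using assms K(1) by (simp add: \<delta>_def)
    have "\<delta>\<^sup>2 = e / (4 * (K + 1))" using assms K(1) by (simp add: \<delta>_def)
    moreover have "2 * K * (e / (4 * d)) = e / 2 * (K / d)" for d :: real by simp
    ultimately have "2 * K * \<delta>\<^sup>2 = e / 2 * (K / (K + 1))" by (simp only:)
    also have "\<dots> \<le> e / 2 * 1" using assms K(1) by (intro mult_left_mono) auto
    finally show "2 * K * \<delta>\<^sup>2 \<le> e / 2" by simp
  qed
  obtain \<Q> where Q: "finite \<Q>" "\<Q> \<subseteq> sets lebesgue"
    "\<And>u. (LINT x|lebesgue. \<bar>fu u x\<bar>) \<le> (\<Sum>Q\<in>\<Q>. \<bar>LINT x:Q|lebesgue. fu u x\<bar>) + \<delta> * norm u"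
    using rellich_fu[OF \<delta>(1)] by blast
  have "\<exists>g. \<forall>u. (LINT x:Q|lebesgue. fu u x) = inner g u" if "Q \<in> \<Q>" for Q
    using riesz_representation[OF bounded_linear_set_integral[of Q]] that Q(2) by (metis subsetD)
  then obtain g where g: "\<And>Q u. Q \<in> \<Q> \<Longrightarrow> (LINT x:Q|lebesgue. fu u x) = inner (g Q) u" by metis
  define N where "N = real (card \<Q>)"
  \<comment> \<open>\<open>c\<^sup>2\<close> has to dominate \<open>2 * K * N * N\<close>, which
    stems from \<open>N\<close> means, each at most \<open>sqrt S\<close>. The added 1 keeps the
    scaling injective when \<open>K\<close> or \<open>N\<close> is 0.\<close>
  define c where "c = sqrt (2 * K * N * N) + 1"
  have c: "c > 0" "2 * K * N * N \<le> c\<^sup>2"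
  proof -
    have "0 \<le> 2 * K * N * N" using K(1) by (simp add: N_def)
    then show "c > 0" by (simp add: c_def add_nonneg_pos)
    have "(sqrt (2 * K * N * N))\<^sup>2 \<le> c\<^sup>2" using \<open>0 \<le> 2 * K * N * N\<close> unfolding c_def by (intro power_mono) auto
    then show "2 * K * N * N \<le> c\<^sup>2" using \<open>0 \<le> 2 * K * N * N\<close> by simp
  qed
  define G where "G = (\<lambda>v. c *\<^sub>R v) ` g ` \<Q>"
  have "t u u \<le> e * (norm u)\<^sup>2 + (\<Sum>v\<in>G. (inner v u)\<^sup>2)" for u
  proof -
    \<comment> \<open>The sum runs over the image of \<open>g\<close>, as different cubes may share
      a representing vector; each mean is still bounded by \<open>sqrt S\<close>.\<close>
    define S where "S = (\<Sum>v\<in>g ` \<Q>. (inner v u)\<^sup>2)"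
    have S: "S \<ge> 0" unfolding S_def by (intro sum_nonneg) auto
    have GS: "(\<Sum>v\<in>G. (inner v u)\<^sup>2) = c\<^sup>2 * S"
      unfolding G_def S_def using c(1)
      by (subst sum.reindex) (auto simp: inj_on_def power_mult_distrib sum_distrib_left)
    have each: "\<bar>LINT x:B|lebesgue. fu u x\<bar> \<le> sqrt S" if "B \<in> \<Q>" for B
    proof -
      have "(inner (g B) u)\<^sup>2 \<le> S" unfolding S_def
        using that Q(1) by (intro member_le_sum) auto
      then show ?thesis unfolding g[OF that] by (simp add: real_le_rsqrt)
    qed
    have "(\<Sum>Q\<in>\<Q>. \<bar>LINT x:Q|lebesgue. fu u x\<bar>) \<le> N * sqrt S"
      unfolding N_def using sum_bounded_above[of \<Q> "\<lambda>Q. \<bar>LINT x:Q|lebesgue. fu u x\<bar>" "sqrt S"] each by simp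
    then have L: "(LINT x|lebesgue. \<bar>fu u x\<bar>) \<le> N * sqrt S + \<delta> * norm u" using Q(3)[of u] by simp
    have "(LINT x|lebesgue. \<bar>fu u x\<bar>)\<^sup>2 \<le> (N * sqrt S + \<delta> * norm u)\<^sup>2"
      by (rule power_mono[OF L]) simp
    also have "\<dots> \<le> 2 * (N * sqrt S)\<^sup>2 + 2 * (\<delta> * norm u)\<^sup>2"
      using zero_le_power2[of "N * sqrt S - \<delta> * norm u"] by (simp add: power2_sum power2_diff)
    also have "\<dots> = 2 * N * N * S + 2 * \<delta>\<^sup>2 * (norm u)\<^sup>2"
      using S by (simp add: power_mult_distrib power2_eq_square)
    finally have "K * (LINT x|lebesgue. \<bar>fu u x\<bar>)\<^sup>2 \<le> K * (2 * N * N * S + 2 * \<delta>\<^sup>2 * (norm u)\<^sup>2)"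
      using K(1) by (rule mult_left_mono)
    also have "\<dots> = (2 * K * N * N) * S + (2 * K * \<delta>\<^sup>2) * (norm u)\<^sup>2" by (simp add: algebra_simps)
    also have "\<dots> \<le> c\<^sup>2 * S + e / 2 * (norm u)\<^sup>2"
      using c(2) \<delta>(2) S by (intro add_mono mult_right_mono) auto
    finally show ?thesis using K(2)[of u] unfolding GS by simp
  qed
  moreover have "finite G" using Q(1) by (simp add: G_def)
  ultimately show ?thesis by blast
qed

section \<open>Boundedness and Garding inequality on the product space\<close>

definition X :: "'h \<Rightarrow> 'h \<Rightarrow> real \<times> (real^'n) \<Rightarrow> real" where
  "X u v p = indicator {0<..1} (fst p) * (Du v (fst p) (snd p) \<bullet> (A (fst p) (snd p) *v Du u (fst p) (snd p))
     + fu u (snd p) * (a1 (fst p) (snd p) \<bullet> Du v (fst p) (snd p))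
     + fu v (snd p) * (b1 (fst p) (snd p) \<bullet> Du u (fst p) (snd p)))"

text \<open>\<open>qd\<close> and \<open>sd\<close> are the nonnegative densities that dominate
  \<open>X\<close>: the energy, and the weighted square of the function spread over all
  \<open>s\<close>.\<close>

definition qd :: "'h \<Rightarrow> real \<times> (real^'n) \<Rightarrow> real" where
  "qd u p = indicator {0<..1} (fst p) * q (fst p) (snd p) (Du u (fst p) (snd p))"

definition sd :: "'h \<Rightarrow> real \<times> (real^'n) \<Rightarrow> real" where
  "sd u p = indicator {0<..1} (fst p) * (F (snd p) * (fu u (snd p))\<^sup>2)"

lemma measurable_ind: "(\<lambda>p. indicator {0<..1} (fst p) :: real) \<in> borel_measurable P"
proof -
  have "(\<lambda>s. indicator {0<..1} s :: real) \<in> borel_measurable \<mu>"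
    by (rule borel_measurable_indicator) (auto intro: sets_mu)
  from measurable_compose[OF measurable_fst this] show ?thesis .
qed

lemma measurable_fu_snd: "(\<lambda>p. fu u (snd p)) \<in> borel_measurable P"
  by (rule measurable_compose[OF measurable_snd fu_meas])

lemma qd_nonneg: "0 \<le> qd u p" and sd_nonneg: "0 \<le> sd u p"
  using q_nonneg[of "fst p"] F_nonneg by (auto simp: qd_def sd_def indicator_def)

lemma X_meas: "X u v \<in> borel_measurable P"
proof -
  note [measurable] = measurable_ind measurable_fu_snd measurable_Du
    borel_measurable_quadratic[OF measurable_A measurable_Du measurable_Du]
    a1_meas[unfolded case_prod_beta'] b1_meas[unfolded case_prod_beta']
  show ?thesis unfolding X_def[abs_def] by measurable
qed

lemma qd_int: "integrable P (qd u)" "(norm u)\<^sup>2 / 2 \<le> integral\<^sup>L P (qd u)" "integral\<^sup>L P (qd u) \<le> 2 * (norm u)\<^sup>2"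
proof -
  note [measurable] = measurable_ind measurable_q[OF measurable_Du]
  have m: "qd u \<in> borel_measurable P" unfolding qd_def[abs_def] by measurable
  have En: "(\<integral>\<^sup>+p. ennreal (qd u p) \<partial>P) = En (Du u)"
    unfolding En_def by (intro nn_integral_cong) (auto simp: qd_def indicator_def)
  show int: "integrable P (qd u)"
  proof (rule integrableI_bounded[OF m])
    show "(\<integral>\<^sup>+p. ennreal (norm (qd u p)) \<partial>P) < \<infinity>"
      using le_less_trans[OF En_Du(1)[of u]] qd_nonneg by (simp add: En)
  qed
  have eq: "En (Du u) = ennreal (integral\<^sup>L P (qd u))"
    unfolding En[symmetric] by (rule nn_integral_eq_integral[OF int]) (simp add: qd_nonneg)
  have nn: "0 \<le> integral\<^sup>L P (qd u)" by (rule Bochner_Integration.integral_nonneg[OF qd_nonneg])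
  show "integral\<^sup>L P (qd u) \<le> 2 * (norm u)\<^sup>2"
    using En_Du(1)[of u] unfolding eq by (subst (asm) ennreal_le_iff) auto
  have "ennreal ((norm u)\<^sup>2) \<le> ennreal (2 * integral\<^sup>L P (qd u))"
    using En_Du(2)[of u] nn unfolding eq by (simp add: ennreal_mult)
  then show "(norm u)\<^sup>2 / 2 \<le> integral\<^sup>L P (qd u)" using nn by (subst (asm) ennreal_le_iff) auto
qed

text \<open>The density is constant in \<open>s\<close>, so its integral carries the mass
  \<open>m0\<close>. This is where finiteness of \<open>\<mu>\<close> enters the bounds for the
  operator.\<close>

lemma sd_int: "integrable P (sd u)" "integral\<^sup>L P (sd u) = m0 * t u u"
proof -
  have [measurable]: "(\<lambda>s. indicator {0<..1} s :: ennreal) \<in> borel_measurable \<mu>"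
    by (rule borel_measurable_indicator) (auto intro: sets_mu)
  have [measurable]: "(\<lambda>p. F (snd p) * (fu u (snd p))\<^sup>2) \<in> borel_measurable P"
    by (rule measurable_compose[OF measurable_snd]) measurable
  note [measurable] = measurable_ind
  have m: "sd u \<in> borel_measurable P" unfolding sd_def[abs_def] by measurable
  have t: "(\<integral>\<^sup>+x. ennreal (F x * (fu u x)\<^sup>2) \<partial>lebesgue) = ennreal (t u u)"
    unfolding t_eq by (rule nn_integral_eq_integral[OF integrable_F_fu2]) (simp add: F_nonneg)
  have "(\<integral>\<^sup>+p. ennreal (sd u p) \<partial>P) = (\<integral>\<^sup>+p. indicator {0<..1} (fst p) * ennreal (F (snd p) * (fu u (snd p))\<^sup>2) \<partial>P)"
    by (intro nn_integral_cong) (auto simp: sd_def indicator_def)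
  also have "\<dots> = (\<integral>\<^sup>+s. \<integral>\<^sup>+x. indicator {0<..1} (fst (s, x)) * ennreal (F (snd (s, x)) * (fu u (snd (s, x)))\<^sup>2) \<partial>lebesgue \<partial>\<mu>)"
    by (rule leb.nn_integral_fst[symmetric]) measurable
  also have "\<dots> = (\<integral>\<^sup>+s. indicator {0<..1} s * ennreal (t u u) \<partial>\<mu>)"
    by (simp add: nn_integral_cmult t)
  also have "\<dots> = ennreal m0 * ennreal (t u u)"
    using sets_mu[of "{0<..1}"] by (simp add: nn_integral_multc nn_integral_indicator emeasure_m0 subset_iff)
  also have "\<dots> = ennreal (m0 * t u u)" using t_pos by (simp add: ennreal_mult m0_def)
  finally have nn: "(\<integral>\<^sup>+p. ennreal (sd u p) \<partial>P) = ennreal (m0 * t u u)" .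
  show int: "integrable P (sd u)"
    by (rule integrableI_bounded[OF m]) (simp add: sd_nonneg nn)
  have "ennreal (integral\<^sup>L P (sd u)) = ennreal (m0 * t u u)"
    unfolding nn[symmetric] by (rule nn_integral_eq_integral[OF int, symmetric]) (simp add: sd_nonneg)
  then show "integral\<^sup>L P (sd u) = m0 * t u u"
    using t_pos[of u] by (subst (asm) ennreal_inj) (auto intro!: Bochner_Integration.integral_nonneg simp: sd_nonneg m0_def)
qed

lemma drift_pointwise:
  assumes s: "s \<in> {0<..1}" and \<alpha>: "(\<forall>i. \<bar>\<alpha> $ i\<bar> \<le> ba x $ i) \<or> (\<forall>i. \<bar>\<alpha> $ i\<bar> \<le> bb x $ i)" and \<delta>: "\<delta> > 0"
  shows "\<bar>fu u x * (\<alpha> \<bullet> \<xi>)\<bar> \<le> sqrt K\<^sub>A * (\<delta> * q s x \<xi> + F x * (fu u x)\<^sup>2 / \<delta>) / 2"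
proof (rule weighted_am_gm)
  show "(fu u x * (\<alpha> \<bullet> \<xi>))\<^sup>2 \<le> K\<^sub>A * q s x \<xi> * (F x * (fu u x)\<^sup>2)"
  \<comment> \<open>\<open>drift_bound\<close> is available in \<open>\<Omega>\<close> only;
    outside, \<open>fu u\<close> vanishes and there is nothing to estimate.\<close>
  proof (cases "x \<in> \<Omega>")
    case True
    have "(fu u x)\<^sup>2 * (\<alpha> \<bullet> \<xi>)\<^sup>2 \<le> (fu u x)\<^sup>2 * (K\<^sub>A * q s x \<xi> * F x)"
      using drift_bound[OF s True \<alpha>] by (rule mult_left_mono) simp
    then show ?thesis by (simp add: power_mult_distrib mult_ac)
  qed (simp add: fu_outside)
qed (use K\<^sub>A \<delta> q_nonneg[OF s] F_nonneg in auto)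

lemma X_bound:
  "\<bar>X u v p\<bar> \<le> sqrt K\<^sub>A * (qd u p + qd v p + (sd u p + sd v p) / 2)"
proof (cases "fst p \<in> {0<..1}")
  case True
  let ?s = "fst p" and ?x = "snd p"
  let ?D = "Du u ?s ?x" and ?E = "Du v ?s ?x"
  have 1: "\<bar>?E \<bullet> (A ?s ?x *v ?D)\<bar> \<le> sqrt K\<^sub>A * (1 * q ?s ?x ?E + q ?s ?x ?D / 1) / 2"
    by (rule weighted_am_gm) (use sector[OF True, of ?E ?x ?D] K\<^sub>A q_nonneg[OF True] in \<open>auto simp: q_def\<close>)
  have 2: "\<bar>fu u ?x * (a1 ?s ?x \<bullet> ?E)\<bar> \<le> sqrt K\<^sub>A * (1 * q ?s ?x ?E + F ?x * (fu u ?x)\<^sup>2 / 1) / 2"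
    by (rule drift_pointwise[OF True]) (use ba[OF True] in auto)
  have 3: "\<bar>fu v ?x * (b1 ?s ?x \<bullet> ?D)\<bar> \<le> sqrt K\<^sub>A * (1 * q ?s ?x ?D + F ?x * (fu v ?x)\<^sup>2 / 1) / 2"
    by (rule drift_pointwise[OF True]) (use bb[OF True] in auto)
  have "\<bar>X u v p\<bar> \<le> \<bar>?E \<bullet> (A ?s ?x *v ?D)\<bar> + \<bar>fu u ?x * (a1 ?s ?x \<bullet> ?E)\<bar> + \<bar>fu v ?x * (b1 ?s ?x \<bullet> ?D)\<bar>"
    using True by (simp add: X_def)
  also have "\<dots> \<le> sqrt K\<^sub>A * (qd u p + qd v p + (sd u p + sd v p) / 2)"
    using 1 2 3 True by (simp add: qd_def sd_def algebra_simps add_divide_distrib)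
  finally show ?thesis .
qed (simp add: X_def qd_def sd_def)

lemma X_integrable: "integrable P (X u v)"
proof (rule Bochner_Integration.integrable_bound)
  show "integrable P (\<lambda>p. sqrt K\<^sub>A * (qd u p + qd v p + (sd u p + sd v p) / 2))"
    by (intro integrable_mult_right Bochner_Integration.integrable_add integrable_divide qd_int(1) sd_int(1))
  show "AE p in P. norm (X u v p) \<le> norm (sqrt K\<^sub>A * (qd u p + qd v p + (sd u p + sd v p) / 2))"
    using X_bound by (intro AE_I2) (auto intro: order_trans[OF _ abs_ge_self])
qed (rule X_meas)

definition b where "b u v = integral\<^sup>L P (X u v) + (LINT x|lebesgue. a0 x * fu u x * fu v x)"

lemma X_linear_left: "AE p in P. X (c *\<^sub>R u + d *\<^sub>R u') v p = c * X u v p + d * X u' v p"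
  using AE_snd[OF fu_linear[of c u d u']] Du_linear[of c u d u']
proof eventually_elim
  fix p assume "fu (c *\<^sub>R u + d *\<^sub>R u') (snd p) = c * fu u (snd p) + d * fu u' (snd p)"
    "fst p \<in> {0<..1} \<longrightarrow> Du (c *\<^sub>R u + d *\<^sub>R u') (fst p) (snd p) = c *\<^sub>R Du u (fst p) (snd p) + d *\<^sub>R Du u' (fst p) (snd p)"
  then show "X (c *\<^sub>R u + d *\<^sub>R u') v p = c * X u v p + d * X u' v p"
    by (cases "fst p \<in> {0<..1}")
       (simp_all add: X_def matrix_vector_right_distrib matrix_vector_mult_scaleR inner_add_right algebra_simps)
qed

lemma X_linear_right: "AE p in P. X u (c *\<^sub>R v + d *\<^sub>R v') p = c * X u v p + d * X u v' p"
  using AE_snd[OF fu_linear[of c v d v']] Du_linear[of c v d v']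
proof eventually_elim
  fix p assume "fu (c *\<^sub>R v + d *\<^sub>R v') (snd p) = c * fu v (snd p) + d * fu v' (snd p)"
    "fst p \<in> {0<..1} \<longrightarrow> Du (c *\<^sub>R v + d *\<^sub>R v') (fst p) (snd p) = c *\<^sub>R Du v (fst p) (snd p) + d *\<^sub>R Du v' (fst p) (snd p)"
  then show "X u (c *\<^sub>R v + d *\<^sub>R v') p = c * X u v p + d * X u v' p"
    by (cases "fst p \<in> {0<..1}")
       (simp_all add: X_def inner_add_left inner_add_right algebra_simps)
qed

lemma b_bilinear: "bounded_bilinear b"
proof -
  obtain K where K: "K \<ge> 0" "\<And>u. t u u \<le> K * (norm u)\<^sup>2" using t_quadratic_bound by blast
  note W = weighted_product_integral[OF a0_meas a0_le_F]
  define C where "C = sqrt K\<^sub>A * (2 + m0 * K / 2) + K / 2"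
  show ?thesis
  proof (rule bounded_bilinear_of_quadratic_bound[where C=C])
    show "b (c *\<^sub>R u + d *\<^sub>R u') v = c * b u v + d * b u' v" for c d u u' v
    proof -
      have "integral\<^sup>L P (X (c *\<^sub>R u + d *\<^sub>R u') v) = (LINT p|P. c * X u v p + d * X u' v p)"
        by (rule integral_cong_AE[OF X_meas _ X_linear_left])
           (intro borel_measurable_add borel_measurable_times borel_measurable_const X_meas)
      also have "\<dots> = c * integral\<^sup>L P (X u v) + d * integral\<^sup>L P (X u' v)" using X_integrable by simp
      finally show ?thesis unfolding b_def W(3) by (simp add: algebra_simps)
    qed
    show "b u (c *\<^sub>R v + d *\<^sub>R v') = c * b u v + d * b u v'" for c d u v v'
    proof -
      have "integral\<^sup>L P (X u (c *\<^sub>R v + d *\<^sub>R v')) = (LINT p|P. c * X u v p + d * X u v' p)"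
        by (rule integral_cong_AE[OF X_meas _ X_linear_right])
           (intro borel_measurable_add borel_measurable_times borel_measurable_const X_meas)
      also have "\<dots> = c * integral\<^sup>L P (X u v) + d * integral\<^sup>L P (X u v')" using X_integrable by simp
      finally show ?thesis unfolding b_def weighted_product_commute[of a0 u] W(3) by (simp add: algebra_simps)
    qed
    show "\<bar>b u v\<bar> \<le> C * ((norm u)\<^sup>2 + (norm v)\<^sup>2)" for u v
    proof -
      have "\<bar>integral\<^sup>L P (X u v)\<bar> \<le> (LINT p|P. sqrt K\<^sub>A * (qd u p + qd v p + (sd u p + sd v p) / 2))"
        using Bochner_Integration.integral_norm_bound_integral[OF X_integrable, of "\<lambda>p. sqrt K\<^sub>A * (qd u p + qd v p + (sd u p + sd v p) / 2)" u v]
          X_bound qd_int(1) sd_int(1) by simp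
      also have "\<dots> = sqrt K\<^sub>A * (integral\<^sup>L P (qd u) + integral\<^sup>L P (qd v) + (m0 * t u u + m0 * t v v) / 2)"
        using qd_int(1) sd_int by simp
      also have "\<dots> \<le> sqrt K\<^sub>A * (2 * (norm u)\<^sup>2 + 2 * (norm v)\<^sup>2 + (m0 * (K * (norm u)\<^sup>2) + m0 * (K * (norm v)\<^sup>2)) / 2)"
        using K\<^sub>A by (intro mult_left_mono add_mono divide_right_mono qd_int(3) mult_left_mono[of _ _ m0] K(2)) (auto simp: m0_def)
      also have "\<dots> = sqrt K\<^sub>A * (2 + m0 * K / 2) * ((norm u)\<^sup>2 + (norm v)\<^sup>2)" by (simp add: algebra_simps)
      finally have 1: "\<bar>integral\<^sup>L P (X u v)\<bar> \<le> sqrt K\<^sub>A * (2 + m0 * K / 2) * ((norm u)\<^sup>2 + (norm v)\<^sup>2)" .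
      have 2: "\<bar>LINT x|lebesgue. a0 x * fu u x * fu v x\<bar> \<le> K / 2 * ((norm u)\<^sup>2 + (norm v)\<^sup>2)"
        using W(2)[of u v] K(2)[of u] K(2)[of v] by (simp add: algebra_simps)
      have "\<bar>b u v\<bar> \<le> \<bar>integral\<^sup>L P (X u v)\<bar> + \<bar>LINT x|lebesgue. a0 x * fu u x * fu v x\<bar>"
        unfolding b_def by (rule abs_triangle_ineq)
      also have "\<dots> \<le> C * ((norm u)\<^sup>2 + (norm v)\<^sup>2)" using add_mono[OF 1 2] by (simp add: C_def distrib_right)
      finally show ?thesis .
    qed
  qed
qed

text \<open>The choice of \<open>\<delta>\<close> makes each of the two drift terms cost a quarter
  of the energy density plus \<open>K\<^sub>A\<close> times the weighted square. Half of the energy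
  remains, and the factor 2 between energy and squared norm turns it into \<open>1/4\<close>. The
  \<open>+ 1\<close> pays for the zeroth-order coefficient, which \<open>F\<close>
  dominates.\<close>

lemma garding: "1/4 * (norm u)\<^sup>2 - (2 * K\<^sub>A * m0 + 1) * t u u \<le> b u u"
proof -
  define \<delta> where "\<delta> = 1 / (2 * sqrt K\<^sub>A)"
  have \<delta>: "\<delta> > 0" "sqrt K\<^sub>A * \<delta> = 1/2" "sqrt K\<^sub>A / \<delta> = 2 * K\<^sub>A"
    using K\<^sub>A by (auto simp: \<delta>_def)
  have low: "1/2 * qd u p - 2 * K\<^sub>A * sd u p \<le> X u u p" for p
  proof (cases "fst p \<in> {0<..1}")
    case True
    let ?s = "fst p" and ?x = "snd p"
    let ?D = "Du u ?s ?x"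
    have e: "sqrt K\<^sub>A * (\<delta> * y + z / \<delta>) / 2 = y / 4 + K\<^sub>A * z" for y z :: real
    proof -
      have "sqrt K\<^sub>A * (\<delta> * y + z / \<delta>) / 2 = ((sqrt K\<^sub>A * \<delta>) * y + (sqrt K\<^sub>A / \<delta>) * z) / 2" by (simp add: algebra_simps)
      then show ?thesis unfolding \<delta>(2,3) by simp
    qed
    have 2: "\<bar>fu u ?x * (a1 ?s ?x \<bullet> ?D)\<bar> \<le> q ?s ?x ?D / 4 + K\<^sub>A * (F ?x * (fu u ?x)\<^sup>2)"
      unfolding e[symmetric] by (rule drift_pointwise[OF True]) (use ba[OF True] \<delta> in auto)
    have 3: "\<bar>fu u ?x * (b1 ?s ?x \<bullet> ?D)\<bar> \<le> q ?s ?x ?D / 4 + K\<^sub>A * (F ?x * (fu u ?x)\<^sup>2)"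
      unfolding e[symmetric] by (rule drift_pointwise[OF True]) (use bb[OF True] \<delta> in auto)
    have "X u u p = q ?s ?x ?D + fu u ?x * (a1 ?s ?x \<bullet> ?D) + fu u ?x * (b1 ?s ?x \<bullet> ?D)"
      using True by (simp add: X_def q_def)
    moreover have "qd u p = q ?s ?x ?D" using True by (simp add: qd_def)
    moreover have "2 * K\<^sub>A * sd u p = K\<^sub>A * (F ?x * (fu u ?x)\<^sup>2) + K\<^sub>A * (F ?x * (fu u ?x)\<^sup>2)"
      using True by (simp add: sd_def)
    ultimately show ?thesis using 2 3 by linarith
  qed (simp add: X_def qd_def sd_def)
  have "1/2 * ((norm u)\<^sup>2 / 2) - 2 * K\<^sub>A * (m0 * t u u) \<le> 1/2 * integral\<^sup>L P (qd u) - 2 * K\<^sub>A * (m0 * t u u)"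
    using qd_int(2)[of u] by simp
  also have "\<dots> = (LINT p|P. 1/2 * qd u p - 2 * K\<^sub>A * sd u p)"
    using qd_int(1) sd_int by simp
  also have "\<dots> \<le> integral\<^sup>L P (X u u)"
    using qd_int(1) sd_int(1) by (intro integral_mono X_integrable low) auto
  finally have "1/4 * (norm u)\<^sup>2 - 2 * K\<^sub>A * m0 * t u u \<le> integral\<^sup>L P (X u u)" by simp
  moreover have "\<bar>LINT x|lebesgue. a0 x * fu u x * fu u x\<bar> \<le> t u u"
    using weighted_product_integral(2)[OF a0_meas a0_le_F, of u u] by simp
  ultimately show ?thesis unfolding b_def by (simp add: algebra_simps)
qed

sublocale garding: garding_pair b t "1/4" "2 * K\<^sub>A * m0 + 1"
proof (rule garding_pair.intro)
  show "t u v = t v u" for u v unfolding t_def by (rule weighted_product_commute)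
  show "0 \<le> 2 * K\<^sub>A * m0 + 1" using K\<^sub>A by (simp add: m0_def add_nonneg_nonneg)
qed (use b_bilinear t_bilinear t_pos garding t_compact in simp_all)

section \<open>Identification with the operators of the statement\<close>

lemma L_form_eq: "L_form \<Omega> \<mu> A a1 b1 a \<iota> u v = b u v"
proof -
  let ?f = "\<lambda>s x. X u v (s, x)"
  have eq: "indicator {0<..1} s *\<^sub>R ((\<Sum>i\<in>UNIV. \<Sum>j\<in>UNIV. A s x $ i $ j * Du u s x $ j * Du v s x $ i)
            + (\<Sum>i\<in>UNIV. a1 s x $ i * fu u x * Du v s x $ i)
            + (\<Sum>i\<in>UNIV. b1 s x $ i * fu v x * Du u s x $ i)) = ?f s x" for s x
    unfolding quadratic_sum[symmetric] by (simp add: X_def inner_vec_def sum_distrib_left mult_ac)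
  \<comment> \<open>The definition integrates over \<open>s\<close> first; integrability of
    \<open>X\<close> on the product permits passing to a single product integral.\<close>
  have "(LINT x|lebesgue. LINT s|\<mu>. ?f s x) = integral\<^sup>L P (\<lambda>(s, x). ?f s x)"
    by (rule pair.integral_snd) (simp add: X_integrable)
  then show ?thesis
    unfolding L_form_def Let_def set_lebesgue_integral_def eq b_def by (simp add: a0_def mult_ac)
qed

lemma L_adj_form_eq: "L_adj_form \<Omega> \<mu> A a1 b1 a \<iota> u v = b v u"
proof -
  have "(\<Sum>i\<in>UNIV. \<Sum>j\<in>UNIV. A s x $ j $ i * Du u s x $ j * Du v s x $ i)
      = (\<Sum>i\<in>UNIV. \<Sum>j\<in>UNIV. A s x $ i $ j * Du v s x $ j * Du u s x $ i)" for s x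
    by (subst sum.swap) (simp add: mult_ac)
  then show ?thesis
    unfolding L_form_eq[symmetric] L_adj_form_def L_form_def Let_def by (simp add: add_ac mult_ac)
qed

lemma I_form_eq: "I_form \<Omega> \<mu> A f \<iota> u v = t u v"
  by (simp add: I_form_def t_def F_def set_lebesgue_integral_def mult_ac)

lemma L_op_eq: "L_op \<Omega> \<mu> A a1 b1 a \<iota> f = garding.L"
  by (simp add: fun_eq_iff L_op_def garding.L_def L_form_eq I_form_eq)

lemma L_adj_op_eq: "L_adj_op \<Omega> \<mu> A a1 b1 a \<iota> f = garding.L'"
  by (simp add: fun_eq_iff L_adj_op_def garding.L'_def L_adj_form_eq I_form_eq)

end

theorem mainTheorem3:
  fixes \<Omega> :: "(real^'n::finite) set"
    and \<mu> :: "real measure"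
    and A :: "real \<Rightarrow> real^'n \<Rightarrow> real^'n^'n"
    and a1 b1 :: "real \<Rightarrow> real^'n \<Rightarrow> real^'n"
    and a :: "real^'n \<Rightarrow> real"
    and lam Lam :: "real^'n \<Rightarrow> real"
    and bB :: "real^'n \<Rightarrow> real^'n^'n"
    and ba bb :: "real^'n \<Rightarrow> real^'n"
    and R C p K\<^sub>A :: real
    and f :: "real^'n \<Rightarrow> real"
    and \<iota> :: "(real^'n \<Rightarrow> real) \<Rightarrow> 'h::{real_inner, complete_space}"
  assumes dom: "open \<Omega>" "connected \<Omega>" "\<Omega> \<noteq> {}" "bounded \<Omega>"
    and mu: "sets \<mu> = sets (restrict_space borel {0..1})" "sigma_finite_measure \<mu>"
      "\<exists>\<delta>>0. \<forall>s\<in>measure_support \<mu>. \<delta> \<le> s"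
    and mu1: "emeasure \<mu> {1} > 0"
    and meas: "(\<lambda>(s, x). A s x) \<in> borel_measurable (\<mu> \<Otimes>\<^sub>M lebesgue)"
      "(\<lambda>(s, x). a1 s x) \<in> borel_measurable (\<mu> \<Otimes>\<^sub>M lebesgue)"
      "(\<lambda>(s, x). b1 s x) \<in> borel_measurable (\<mu> \<Otimes>\<^sub>M lebesgue)"
      "a \<in> borel_measurable (lebesgue_on \<Omega>)"
    and posdef: "\<forall>s\<in>{0<..1}. \<forall>x \<xi>. \<xi> \<noteq> 0 \<longrightarrow> 0 < \<xi> \<bullet> (A s x *v \<xi>)"
    and lam_nonneg: "\<forall>x. 0 \<le> lam x" "\<forall>x. 0 \<le> Lam x"
    and ellipt: "\<forall>s\<in>{0<..1}. \<forall>x \<xi>. lam x * (norm \<xi>)\<^sup>2 \<le> \<xi> \<bullet> (A s x *v \<xi>)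
                                   \<and> \<xi> \<bullet> (A s x *v \<xi>) \<le> Lam x * (norm \<xi>)\<^sup>2"
    and Lam: "0 < R" "0 < C" "p < real CARD('n)"
      "set_integrable lebesgue (ball 0 R) Lam"
      "\<forall>x. x \<notin> ball 0 R \<longrightarrow> Lam x \<le> C * norm x powr p"
    and lam: "lam \<in> borel_measurable lebesgue"
      "\<forall>K. compact K \<longrightarrow> (\<integral>\<^sup>+x\<in>K. inverse (ennreal (lam x)) \<partial>lebesgue) < \<infinity>"
    and sector: "0 < K\<^sub>A"
      "\<forall>s\<in>{0<..1}. \<forall>x \<xi> \<psi>. \<bar>\<xi> \<bullet> (A s x *v \<psi>)\<bar>\<^sup>2
                              \<le> K\<^sub>A * (\<xi> \<bullet> (A s x *v \<xi>)) * (\<psi> \<bullet> (A s x *v \<psi>))"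
    and bounds: "\<forall>s\<in>{0<..1}. \<forall>x i j. \<bar>matrix_inv (A s x) $ i $ j\<bar> \<le> bB x $ i $ j"
      "\<forall>s\<in>{0<..1}. \<forall>x i. \<bar>a1 s x $ i\<bar> \<le> ba x $ i"
      "\<forall>s\<in>{0<..1}. \<forall>x i. \<bar>b1 s x $ i\<bar> \<le> bb x $ i"
    and f: "\<forall>x\<in>\<Omega>. f x = (\<Sum>i\<in>UNIV. \<Sum>j\<in>UNIV.
                 bB x $ i $ j * (ba x $ i * ba x $ j + bb x $ i * bb x $ j)) + \<bar>a x\<bar>"
    and H0: "is_H0_completion \<Omega> \<mu> A \<iota>"
    and f_cb: "compactly_bounded \<Omega> \<mu> A f"
  shows "let L = L_op \<Omega> \<mu> A a1 b1 a \<iota> f; L' = L_adj_op \<Omega> \<mu> A a1 b1 a \<iota> f in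
    (\<exists>\<sigma>\<^sub>0 :: real. \<exists>\<Sigma> :: real set.
       \<Sigma> \<subseteq> {..<\<sigma>\<^sub>0} \<and> countable \<Sigma> \<and> (\<forall>\<sigma>\<in>\<Sigma>. \<sigma> isolated_in \<Sigma>) \<and>
       (\<forall>\<sigma>. \<sigma> \<notin> \<Sigma> \<longrightarrow>
          bij_betw (L \<sigma>) UNIV dual \<and> (\<forall>T\<in>dual. \<exists>!u. L \<sigma> u = T)) \<and>
       (\<forall>\<sigma>\<in>\<Sigma>. op_kernel (L \<sigma>) \<noteq> {0}) \<and>
       (\<forall>\<sigma>\<in>\<Sigma>.
          finite_dim (op_kernel (L \<sigma>)) \<and> finite_dim (op_kernel (L' \<sigma>)) \<and>
          dim (op_kernel (L \<sigma>)) = dim (op_kernel (L' \<sigma>)) \<and> 0 < dim (op_kernel (L \<sigma>)) \<and>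
          (\<forall>T\<in>dual. {u. L \<sigma> u = T} = {} \<or> infinite {u. L \<sigma> u = T}))) \<and>
    (\<forall>\<sigma>. \<forall>T\<in>dual. (\<exists>u. L \<sigma> u = T) \<longleftrightarrow> (\<forall>u'. L' \<sigma> u' = (\<lambda>v. 0) \<longrightarrow> T u' = 0))"
proof -
  have setting: "fractional_setting \<Omega> \<mu> A lam \<iota>"
    by (rule fractional_setting.intro)
       (use dom mu mu1 meas posdef lam_nonneg ellipt lam H0 in blast)+
  interpret fractional_operator \<Omega> \<mu> A lam \<iota> a1 b1 a bB ba bb K\<^sub>A f
    by (rule fractional_operator.intro[OF setting], rule fractional_operator_axioms.intro)
       (use meas sector bounds f f_cb in blast)+
  show ?thesis unfolding Let_def L_op_eq L_adj_op_eq by (rule garding.spectrum)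
qed

end
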